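(* Let $n>1$ and $m\ge1$ be coprime natural numbers, let $\lambda\in k$ be a primitive $n$-th root of unity, and let $\mu\in k$. Let $A=A^{n,m}_\lambda$ and $X=X^{n,m}_{\lambda,\mu}$. Let $C$ be the unital algebra generated by three elements $u,u^{-1}$ and $w$, such that $u^{-1}$ is the inverse of $u$, $uw=\lambda wu$ and $\mu\cdot1+w^n=\mu u^{mn}$. Then $C$ is not trivial. One can define a unital multiplicative comultiplication $\Delta_C$ on $C$, given on the generators by $\Delta_C(u)=u\otimes u$ and $\Delta_C(w)=w\otimes u^m+1\otimes w$, making it an algebraic quantum group of compact type. It has a left coaction $\gamma$ on $X$ determined by $\gamma(x)=u\otimes x$ and $\gamma(y)=1\otimes y+w\otimes x^m$, making $X$ a $C$-$A$-bi-Galois object.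
   Context: $k$ is a field and all algebras are $k$-algebras. $A^{n,m}_\lambda$ is the unital algebra generated by $a,a^{-1},b$ with $a^{-1}$ the inverse of $a$, $ab=\lambda ba$, $b^n=0$, and comultiplication $\Delta(a)=a\otimes a$, $\Delta(b)=b\otimes a^m+1\otimes b$. $X^{n,m}_{\lambda,\mu}$ is the unital algebra generated by $x,x^{-1},y$ with $x^{-1}$ the inverse of $x$, $xy=\lambda yx$, $y^n=\mu x^{mn}$, with right coaction $\alpha$ of $A^{n,m}_\lambda$ determined by $\alpha(x)=x\otimes a$, $\alpha(y)=y\otimes a^m+1\otimes b$. An algebraic quantum group of compact type is (in the unital case relevant here) a Hopf algebra $C$ with bijective antipode possessing a non-zero left invariant functional $\varphi_C$, i.e. $(\iota\otimes\varphi_C)\Delta_C(c)=\varphi_C(c)1$ for all $c\in C$. A right $A$-Galois object for such $A$ is a non-zero unital algebra $X$ with a right coaction $\alpha:X\to X\otimes A$ (an injective homomorphism with $(\alpha\otimes\iota)\alpha=(\iota\otimes\Delta)\alpha$ and $(\iota\otimes\varepsilon)\alpha=\iota$) whose coinvariants $\{f:\alpha(f)=f\otimes1\}$ are the scalars and such that $X\otimes X\to X\otimes A$, $z\otimes z'\mapsto(z\otimes1)\alpha(z')$, is bijective. A left $C$-Galois object is defined symmetrically using a left coaction $\gamma:X\to C\otimes X$ and the map $X\otimes X\to C\otimes X$, $z\otimes z'\mapsto\gamma(z)(1\otimes z')$. $X$ is a $C$-$A$-bi-Galois object if it is simultaneously a left $C$-Galois object and a right $A$-Galois object, with commuting coactions: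 $(\gamma\otimes\iota)\alpha=(\iota\otimes\alpha)\gamma$. *)

theory Defs
  imports
    "HOL.Vector_Spaces"
    "HOL-Algebra.QuotRing"
    "HOL-Algebra.Module"
    "HOL-Library.Poly_Mapping"
begin

section \<open>Algebras over a field\<close>

text \<open>
  The ground field is a type \<open>'k\<close> of class \<^class>\<open>field\<close>. Vector spaces and algebras are
  HOL-Algebra \<open>module\<close> records over \<^term>\<open>class_ring :: 'k::field ring\<close>.
  The locale \<open>algebra\<close> of HOL-Algebra requires a commutative multiplication and
  can therefore not be used.
\<close>

definition class_ring :: "'r::ring_1 ring" where
  "class_ring =
    \<lparr>carrier = UNIV, monoid.mult = (*), one = 1, zero = 0, add = (+)\<rparr>"

locale k_algebra =
  module "class_ring :: 'k::field ring" A + ring A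
  for A :: "('k::field, 'a) module" (structure) +
  assumes smult_mult_left:
      "\<lbrakk>x \<in> carrier A; y \<in> carrier A\<rbrakk> \<Longrightarrow> (c \<odot> x) \<otimes> y = c \<odot> (x \<otimes> y)"
    and smult_mult_right:
      "\<lbrakk>x \<in> carrier A; y \<in> carrier A\<rbrakk> \<Longrightarrow> x \<otimes> (c \<odot> y) = c \<odot> (x \<otimes> y)"

definition scalars :: "('k::field, 'k) module" where
  "scalars = ring.extend class_ring (module.fields (*))"

definition lin_map :: "('k, 'a) module \<Rightarrow> ('k, 'b) module \<Rightarrow> ('a \<Rightarrow> 'b) set" where
  "lin_map V W = {f. f \<in> carrier V \<rightarrow> carrier W \<and>
     (\<forall>x\<in>carrier V. \<forall>y\<in>carrier V. f (x \<oplus>\<^bsub>V\<^esub> y) = f x \<oplus>\<^bsub>W\<^esub> f y) \<and>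
     (\<forall>c. \<forall>x\<in>carrier V. f (c \<odot>\<^bsub>V\<^esub> x) = c \<odot>\<^bsub>W\<^esub> f x)}"

definition alg_hom :: "('k, 'a) module \<Rightarrow> ('k, 'b) module \<Rightarrow> ('a \<Rightarrow> 'b) set" where
  "alg_hom A B = ring_hom A B \<inter> lin_map A B"

text \<open>\<open>f\<close> is, up to its values outside the carrier, the only unital algebra homomorphism
  whose graph contains the set \<open>E\<close> of pairs (argument, prescribed value).\<close>

definition determined_hom ::
    "('k, 'a) module \<Rightarrow> ('k, 'b) module \<Rightarrow> ('a \<times> 'b) set \<Rightarrow> ('a \<Rightarrow> 'b) \<Rightarrow> bool" where
  "determined_hom A B E f \<longleftrightarrow>
     f \<in> alg_hom A B \<and> (\<forall>(x, v)\<in>E. f x = v) \<and>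
     (\<forall>g\<in>alg_hom A B. (\<forall>(x, v)\<in>E. g x = v) \<longrightarrow> (\<forall>x\<in>carrier A. g x = f x))"

definition quot_alg :: "('k, 'a) module \<Rightarrow> 'a set \<Rightarrow> ('k, 'a set) module" where
  "quot_alg F I = ring.extend (F Quot I)
     (module.fields (\<lambda>c X. \<Union>p\<in>X. I +>\<^bsub>F\<^esub> (c \<odot>\<^bsub>F\<^esub> p)))"


section \<open>Algebras given by generators and relations\<close>

datatype 'g free_mon = Word (letters: "'g list")

instantiation free_mon :: (type) monoid_add
begin

definition zero_free_mon :: "'a free_mon" where
  "0 = Word []"

definition plus_free_mon :: "'a free_mon \<Rightarrow> 'a free_mon \<Rightarrow> 'a free_mon" where
  "v + w = Word (letters v @ letters w)"

instance
  by standard (simp_all add: zero_free_mon_def plus_free_mon_def)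

end

text \<open>The monoid algebra of the free monoid, with the convolution product of
  \<^theory>\<open>HOL-Library.Poly_Mapping\<close>, is the free unital algebra on \<open>'g\<close>. (The monoid is
  written additively, as the class instance for finitely supported functions demands.)\<close>

type_synonym ('k, 'g) free_alg = "'g free_mon \<Rightarrow>\<^sub>0 'k"

definition scale :: "'k::field \<Rightarrow> ('b \<Rightarrow>\<^sub>0 'k) \<Rightarrow> ('b \<Rightarrow>\<^sub>0 'k)" where
  "scale c p = Poly_Mapping.map ((*) c) p"

definition var :: "'g \<Rightarrow> ('k::field, 'g) free_alg" where
  "var g = Poly_Mapping.single (Word [g]) 1"

definition free_algebra :: "('k::field, ('k, 'g) free_alg) module" where
  "free_algebra = ring.extend class_ring (module.fields scale)"

text \<open>A pair \<open>(p, q)\<close> stands for the relation \<open>p = q\<close>.\<close>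

definition rel_ideal ::
    "(('k::field, 'g) free_alg \<times> ('k, 'g) free_alg) set \<Rightarrow> ('k, 'g) free_alg set" where
  "rel_ideal E = Idl\<^bsub>free_algebra\<^esub> ((\<lambda>(p, q). p - q) ` E)"

definition presented ::
    "(('k::field, 'g) free_alg \<times> ('k, 'g) free_alg) set \<Rightarrow> ('k, ('k, 'g) free_alg set) module" where
  "presented E = quot_alg free_algebra (rel_ideal E)"

definition generator ::
    "(('k::field, 'g) free_alg \<times> ('k, 'g) free_alg) set \<Rightarrow> 'g \<Rightarrow> ('k, 'g) free_alg set" where
  "generator E g = rel_ideal E +>\<^bsub>free_algebra\<^esub> var g"


section \<open>Tensor products\<close>

text \<open>\<open>free_tensor A B\<close> is the vector space with basis \<open>carrier A \<times> carrier B\<close>, with the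
  bilinear product satisfying \<open>(a, b) (a', b') = (a a', b b')\<close> on basis elements.\<close>

definition free_tensor ::
    "('k::field, 'a) module \<Rightarrow> ('k, 'b) module \<Rightarrow> ('k, ('a \<times> 'b) \<Rightarrow>\<^sub>0 'k) module" where
  "free_tensor A B =
    \<lparr>carrier = {t. Poly_Mapping.keys t \<subseteq> carrier A \<times> carrier B},
     monoid.mult = (\<lambda>s t. \<Sum>p\<in>Poly_Mapping.keys s. \<Sum>q\<in>Poly_Mapping.keys t.
        Poly_Mapping.single (fst p \<otimes>\<^bsub>A\<^esub> fst q, snd p \<otimes>\<^bsub>B\<^esub> snd q)
          (Poly_Mapping.lookup s p * Poly_Mapping.lookup t q)),
     one = Poly_Mapping.single (\<one>\<^bsub>A\<^esub>, \<one>\<^bsub>B\<^esub>) 1,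
     zero = 0,
     add = (+),
     smult = scale\<rparr>"

definition bilinear_relators ::
    "('k::field, 'a) module \<Rightarrow> ('k, 'b) module \<Rightarrow> (('a \<times> 'b) \<Rightarrow>\<^sub>0 'k) set" where
  "bilinear_relators A B =
     {Poly_Mapping.single (a \<oplus>\<^bsub>A\<^esub> a', b) 1
        - Poly_Mapping.single (a, b) 1 - Poly_Mapping.single (a', b) 1 |a a' b.
        a \<in> carrier A \<and> a' \<in> carrier A \<and> b \<in> carrier B} \<union>
     {Poly_Mapping.single (a, b \<oplus>\<^bsub>B\<^esub> b') 1
        - Poly_Mapping.single (a, b) 1 - Poly_Mapping.single (a, b') 1 |a b b'.
        a \<in> carrier A \<and> b \<in> carrier B \<and> b' \<in> carrier B} \<union>
     {Poly_Mapping.single (c \<odot>\<^bsub>A\<^esub> a, b) 1 - Poly_Mapping.single (a, b) c |c a b.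
        a \<in> carrier A \<and> b \<in> carrier B} \<union>
     {Poly_Mapping.single (a, c \<odot>\<^bsub>B\<^esub> b) 1 - Poly_Mapping.single (a, b) c |c a b.
        a \<in> carrier A \<and> b \<in> carrier B}"

definition bilinear_span ::
    "('k::field, 'a) module \<Rightarrow> ('k, 'b) module \<Rightarrow> (('a \<times> 'b) \<Rightarrow>\<^sub>0 'k) set" where
  "bilinear_span A B = module.span scale (bilinear_relators A B)"

definition tensor ::
    "('k::field, 'a) module \<Rightarrow> ('k, 'b) module \<Rightarrow> ('k, (('a \<times> 'b) \<Rightarrow>\<^sub>0 'k) set) module"
    (infixr \<open>\<boxtimes>\<close> 65) where
  "A \<boxtimes> B = quot_alg (free_tensor A B) (bilinear_span A B)"

definition ptensor ::
    "('k::field, 'a) module \<Rightarrow> ('k, 'b) module \<Rightarrow> 'a \<Rightarrow> 'b \<Rightarrow> (('a \<times> 'b) \<Rightarrow>\<^sub>0 'k) set" where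
  "ptensor A B a b = bilinear_span A B +>\<^bsub>free_tensor A B\<^esub> Poly_Mapping.single (a, b) 1"

text \<open>The linear map \<open>A \<boxtimes> B \<rightarrow> M\<close> induced by a bilinear map \<open>\<beta>\<close>: a coset is sent to the common
  value of the linear extension of \<open>\<beta>\<close> at its representatives. (For \<open>\<beta>\<close> that is not
  bilinear the result is meaningless.)\<close>

definition tensor_lift ::
    "('k::field, 'c) module \<Rightarrow> ('a \<Rightarrow> 'b \<Rightarrow> 'c) \<Rightarrow> (('a \<times> 'b) \<Rightarrow>\<^sub>0 'k) set \<Rightarrow> 'c" where
  "tensor_lift M \<beta> X = (THE v. \<forall>t\<in>X. v =
     (\<Oplus>\<^bsub>M\<^esub>p\<in>Poly_Mapping.keys t. Poly_Mapping.lookup t p \<odot>\<^bsub>M\<^esub> \<beta> (fst p) (snd p)))"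

text \<open>\<open>tensor_map A' B' f g\<close> is \<open>f \<otimes> g : A \<boxtimes> B \<rightarrow> A' \<boxtimes> B'\<close>.\<close>

definition tensor_map ::
    "('k::field, 'c) module \<Rightarrow> ('k, 'd) module \<Rightarrow> ('a \<Rightarrow> 'c) \<Rightarrow> ('b \<Rightarrow> 'd) \<Rightarrow>
     (('a \<times> 'b) \<Rightarrow>\<^sub>0 'k) set \<Rightarrow> (('c \<times> 'd) \<Rightarrow>\<^sub>0 'k) set" where
  "tensor_map A' B' f g = tensor_lift (A' \<boxtimes> B') (\<lambda>a b. ptensor A' B' (f a) (g b))"

text \<open>\<open>tensor_assoc A B C : (A \<boxtimes> B) \<boxtimes> C \<rightarrow> A \<boxtimes> (B \<boxtimes> C)\<close>\<close>

definition tensor_assoc ::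
    "('k::field, 'a) module \<Rightarrow> ('k, 'b) module \<Rightarrow> ('k, 'c) module \<Rightarrow>
     (((('a \<times> 'b) \<Rightarrow>\<^sub>0 'k) set \<times> 'c) \<Rightarrow>\<^sub>0 'k) set \<Rightarrow>
     (('a \<times> (('b \<times> 'c) \<Rightarrow>\<^sub>0 'k) set) \<Rightarrow>\<^sub>0 'k) set" where
  "tensor_assoc A B C = tensor_lift (A \<boxtimes> (B \<boxtimes> C))
     (\<lambda>t c. tensor_lift (A \<boxtimes> (B \<boxtimes> C))
       (\<lambda>a b. ptensor A (B \<boxtimes> C) a (ptensor B C b c)) t)"


section \<open>Hopf algebras and Galois objects\<close>

locale hopf_algebra = k_algebra A
  for A :: "('k::field, 'a) module" (structure) +
  fixes \<Delta> :: "'a \<Rightarrow> (('a \<times> 'a) \<Rightarrow>\<^sub>0 'k) set" and \<epsilon> :: "'a \<Rightarrow> 'k" and S :: "'a \<Rightarrow> 'a"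
  assumes comult_hom: "\<Delta> \<in> alg_hom A (A \<boxtimes> A)"
    and coassoc: "c \<in> carrier A \<Longrightarrow>
      tensor_assoc A A A (tensor_map (A \<boxtimes> A) A \<Delta> id (\<Delta> c)) =
      tensor_map A (A \<boxtimes> A) id \<Delta> (\<Delta> c)"
    and counit_hom: "\<epsilon> \<in> alg_hom A scalars"
    and counit_left: "c \<in> carrier A \<Longrightarrow> tensor_lift A (\<lambda>x y. \<epsilon> x \<odot> y) (\<Delta> c) = c"
    and counit_right: "c \<in> carrier A \<Longrightarrow> tensor_lift A (\<lambda>x y. \<epsilon> y \<odot> x) (\<Delta> c) = c"
    and antipode_linear: "S \<in> lin_map A A"
    and antipode_left: "c \<in> carrier A \<Longrightarrow> tensor_lift A (\<lambda>x y. S x \<otimes> y) (\<Delta> c) = \<epsilon> c \<odot> \<one>"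
    and antipode_right: "c \<in> carrier A \<Longrightarrow> tensor_lift A (\<lambda>x y. x \<otimes> S y) (\<Delta> c) = \<epsilon> c \<odot> \<one>"

text \<open>Algebraic quantum groups of compact type, in the unital case.\<close>

locale compact_type_aqg = hopf_algebra A \<Delta> \<epsilon> S
  for A :: "('k::field, 'a) module" (structure) and \<Delta> \<epsilon> S +
  assumes antipode_bij: "bij_betw S (carrier A) (carrier A)"
    and left_invariant_functional:
      "\<exists>\<phi>\<in>lin_map A scalars. (\<exists>c\<in>carrier A. \<phi> c \<noteq> 0) \<and>
         (\<forall>c\<in>carrier A. tensor_lift A (\<lambda>x y. \<phi> y \<odot> x) (\<Delta> c) = \<phi> c \<odot> \<one>)"

locale right_galois_object = H: compact_type_aqg A \<Delta> \<epsilon> S + X: k_algebra X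
  for A :: "('k::field, 'a) module" and \<Delta> \<epsilon> S and X :: "('k, 'x) module" +
  fixes \<alpha> :: "'x \<Rightarrow> (('x \<times> 'a) \<Rightarrow>\<^sub>0 'k) set"
  assumes nonzero: "\<one>\<^bsub>X\<^esub> \<noteq> \<zero>\<^bsub>X\<^esub>"
    and right_coact_hom: "\<alpha> \<in> alg_hom X (X \<boxtimes> A)"
    and right_coact_inj: "inj_on \<alpha> (carrier X)"
    and right_coact_assoc: "z \<in> carrier X \<Longrightarrow>
      tensor_assoc X A A (tensor_map (X \<boxtimes> A) A \<alpha> id (\<alpha> z)) =
      tensor_map X (A \<boxtimes> A) id \<Delta> (\<alpha> z)"
    and right_coact_counit: "z \<in> carrier X \<Longrightarrow>
      tensor_lift X (\<lambda>z c. \<epsilon> c \<odot>\<^bsub>X\<^esub> z) (\<alpha> z) = z"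
    and right_coinvariants:
      "{f \<in> carrier X. \<alpha> f = ptensor X A f \<one>\<^bsub>A\<^esub>} = range (\<lambda>c. c \<odot>\<^bsub>X\<^esub> \<one>\<^bsub>X\<^esub>)"
    and right_galois_bij:
      "bij_betw (tensor_lift (X \<boxtimes> A) (\<lambda>z z'. ptensor X A z \<one>\<^bsub>A\<^esub> \<otimes>\<^bsub>X \<boxtimes> A\<^esub> \<alpha> z'))
         (carrier (X \<boxtimes> X)) (carrier (X \<boxtimes> A))"

locale left_galois_object = H: compact_type_aqg C \<Delta> \<epsilon> S + X: k_algebra X
  for C :: "('k::field, 'c) module" and \<Delta> \<epsilon> S and X :: "('k, 'x) module" +
  fixes \<gamma> :: "'x \<Rightarrow> (('c \<times> 'x) \<Rightarrow>\<^sub>0 'k) set"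
  assumes nonzero: "\<one>\<^bsub>X\<^esub> \<noteq> \<zero>\<^bsub>X\<^esub>"
    and left_coact_hom: "\<gamma> \<in> alg_hom X (C \<boxtimes> X)"
    and left_coact_inj: "inj_on \<gamma> (carrier X)"
    and left_coact_assoc: "z \<in> carrier X \<Longrightarrow>
      tensor_assoc C C X (tensor_map (C \<boxtimes> C) X \<Delta> id (\<gamma> z)) =
      tensor_map C (C \<boxtimes> X) id \<gamma> (\<gamma> z)"
    and left_coact_counit: "z \<in> carrier X \<Longrightarrow>
      tensor_lift X (\<lambda>c z. \<epsilon> c \<odot>\<^bsub>X\<^esub> z) (\<gamma> z) = z"
    and left_coinvariants:
      "{f \<in> carrier X. \<gamma> f = ptensor C X \<one>\<^bsub>C\<^esub> f} = range (\<lambda>c. c \<odot>\<^bsub>X\<^esub> \<one>\<^bsub>X\<^esub>)"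
    and left_galois_bij:
      "bij_betw (tensor_lift (C \<boxtimes> X) (\<lambda>z z'. \<gamma> z \<otimes>\<^bsub>C \<boxtimes> X\<^esub> ptensor C X \<one>\<^bsub>C\<^esub> z'))
         (carrier (X \<boxtimes> X)) (carrier (C \<boxtimes> X))"

locale bi_galois_object =
  L: left_galois_object C \<Delta>C \<epsilon>C SC X \<gamma> + R: right_galois_object A \<Delta>A \<epsilon>A SA X \<alpha>
  for C :: "('k::field, 'c) module" and \<Delta>C \<epsilon>C SC
    and A :: "('k, 'a) module" and \<Delta>A \<epsilon>A SA
    and X :: "('k, 'x) module" and \<gamma> \<alpha> +
  assumes coactions_commute: "z \<in> carrier X \<Longrightarrow>
      tensor_assoc C X A (tensor_map (C \<boxtimes> X) A \<gamma> id (\<alpha> z)) =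
      tensor_map C (X \<boxtimes> A) id \<alpha> (\<gamma> z)"


section \<open>The algebras \<open>A\<close>, \<open>X\<close> and \<open>C\<close>\<close>

definition primitive_root_of_unity :: "nat \<Rightarrow> 'k::field \<Rightarrow> bool" where
  "primitive_root_of_unity n z \<longleftrightarrow>
     n > 0 \<and> z ^ n = 1 \<and> (\<forall>j. 0 < j \<and> j < n \<longrightarrow> z ^ j \<noteq> 1)"

text \<open>Names of the generators: \<open>G\<close> for \<open>a\<close>, \<open>x\<close>, \<open>u\<close>; \<open>Ginv\<close> for the inverse of \<open>G\<close>;
  \<open>H\<close> for \<open>b\<close>, \<open>y\<close>, \<open>w\<close>.\<close>

datatype gens = G | Ginv | H

definition skew_rels :: "'k::field \<Rightarrow> (('k, gens) free_alg \<times> ('k, gens) free_alg) set" where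
  "skew_rels q = {(var G * var Ginv, 1), (var Ginv * var G, 1),
     (var G * var H, scale q (var H * var G))}"

definition rels_A :: "nat \<Rightarrow> 'k::field \<Rightarrow> (('k, gens) free_alg \<times> ('k, gens) free_alg) set" where
  "rels_A n q = skew_rels q \<union> {(var H ^ n, 0)}"

definition rels_X ::
    "nat \<Rightarrow> nat \<Rightarrow> 'k::field \<Rightarrow> 'k \<Rightarrow> (('k, gens) free_alg \<times> ('k, gens) free_alg) set" where
  "rels_X n m q \<mu> = skew_rels q \<union> {(var H ^ n, scale \<mu> (var G ^ (m * n)))}"

definition rels_C ::
    "nat \<Rightarrow> nat \<Rightarrow> 'k::field \<Rightarrow> 'k \<Rightarrow> (('k, gens) free_alg \<times> ('k, gens) free_alg) set" where
  "rels_C n m q \<mu> = skew_rels q \<union> {(scale \<mu> 1 + var H ^ n, scale \<mu> (var G ^ (m * n)))}"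

end

theory Submission
  imports Defs
begin

text \<open>The three algebras belong to one family. For scalars \<open>s\<close> and \<open>t\<close> let \<open>E s t\<close> be generated by
  \<open>g\<close>, its inverse and \<open>h\<close>, subject to \<open>g h = \<lambda> h g\<close> and \<open>t \<cdot> 1 + h\<^sup>n = s g\<^sup>m\<^sup>n\<close>. Then \<open>A = E 0 0\<close>,
  \<open>X = E \<mu> 0\<close> and \<open>C = E \<mu> \<mu>\<close>. The comultiplication of \<open>A\<close>, that of \<open>C\<close> and both coactions on
  \<open>X\<close> are instances of a single map \<open>E s t \<rightarrow> E s r \<otimes> E r t\<close> with \<open>g \<mapsto> g \<otimes> g\<close> and
  \<open>h \<mapsto> h \<otimes> g\<^sup>m + 1 \<otimes> h\<close>: the algebras form a cogroupoid in the sense of Bichon, in which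
  \<open>E s s\<close> has a counit and in which the antipodes are anti-homomorphisms \<open>E s t \<rightarrow> E t s\<close> with
  \<open>g \<mapsto> g\<^sup>-\<^sup>1\<close> and \<open>h \<mapsto> - h g\<^sup>-\<^sup>m\<close>.

  This map exists because of one computation. The summands \<open>P = h \<otimes> g\<^sup>m\<close> and \<open>Q = 1 \<otimes> h\<close> satisfy
  \<open>P Q = \<lambda>\<^sup>m Q P\<close>, and \<open>\<lambda>\<^sup>m\<close> is again a primitive \<open>n\<close>-th root of unity since \<open>m\<close> and \<open>n\<close> are coprime.
  Hence the inner coefficients in the quantum binomial theorem vanish and
  \<open>(P + Q)\<^sup>n = P\<^sup>n + Q\<^sup>n\<close> (\<open>skew_power_of_sum\<close>); inserting \<open>h\<^sup>n = s g\<^sup>m\<^sup>n - r\<close> in the first factor and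
  \<open>h\<^sup>n = r g\<^sup>m\<^sup>n - t\<close> in the second makes the sum telescope. The axioms of a cogroupoid are equations
  between homomorphisms, or are stable under products, so they need checking on generators only.

  In any cogroupoid, \<open>z \<otimes> a \<mapsto> z S(a\<^sub>1) \<otimes> a\<^sub>2\<close> inverts the Galois map
  \<open>z \<otimes> z' \<mapsto> (z \<otimes> 1) \<alpha>(z')\<close>, and symmetrically on the left. If \<open>f\<close> is coinvariant, applying this inverse to
  \<open>\<alpha>(f) = f \<otimes> 1\<close> gives \<open>1 \<otimes> f = f \<otimes> 1\<close>, so \<open>f\<close> is a scalar. This is \<open>cogroupoid.bi_galois\<close>.

  What remains is not formal: that \<open>E s t\<close> is non-zero, and that \<open>E s s\<close> has an invariant functional.
  Both follow from a functional on \<open>E s t\<close> that takes the value \<open>1\<close> at \<open>h\<^sup>n\<^sup>-\<^sup>1\<close> and \<open>0\<close> at the other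
  monomials \<open>g\<^sup>i h\<^sup>j\<close> with \<open>j < n\<close>. It is a matrix coefficient of a representation on functions
  \<open>F\<close> on \<open>\<int> \<times> \<nat>\<close> with \<open>F(i, j + n) = s F(i + m n, j) - t F(i, j)\<close>. Finally, the square of the antipode scales
  \<open>h\<close> by the root of unity \<open>\<lambda>\<^sup>m\<close>, so a power of the antipode is the identity, and it is bijective.\<close>


section \<open>Linear maps between algebras\<close>

lemma class_ring_simps [simp]:
  "carrier class_ring = UNIV" "x \<otimes>\<^bsub>class_ring\<^esub> y = x * y" "\<one>\<^bsub>class_ring\<^esub> = 1"
  "\<zero>\<^bsub>class_ring\<^esub> = 0" "x \<oplus>\<^bsub>class_ring\<^esub> y = x + y"
  by (simp_all add: class_ring_def)

lemma cring_class_ring: "cring (class_ring :: 'k::field ring)"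
proof (rule cringI)
  show "abelian_group (class_ring :: 'k ring)"
    by (rule abelian_groupI) (auto simp: add.assoc add.commute intro: exI[of _ "- _"])
  show "comm_monoid (class_ring :: 'k ring)"
    by (rule comm_monoidI) (auto simp: mult.assoc mult.commute)
qed (auto simp: distrib_right)

lemma k_algebraI:
  fixes A :: "('k::field, 'a) module" (structure)
  assumes "ring A"
    and "\<And>c x. x \<in> carrier A \<Longrightarrow> c \<odot> x \<in> carrier A"
    and "\<And>c d x. x \<in> carrier A \<Longrightarrow> (c + d) \<odot> x = c \<odot> x \<oplus> d \<odot> x"
    and "\<And>c x y. x \<in> carrier A \<Longrightarrow> y \<in> carrier A \<Longrightarrow> c \<odot> (x \<oplus> y) = c \<odot> x \<oplus> c \<odot> y"
    and "\<And>c d x. x \<in> carrier A \<Longrightarrow> (c * d) \<odot> x = c \<odot> (d \<odot> x)"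
    and "\<And>x. x \<in> carrier A \<Longrightarrow> 1 \<odot> x = x"
    and "\<And>c x y. x \<in> carrier A \<Longrightarrow> y \<in> carrier A \<Longrightarrow> (c \<odot> x) \<otimes> y = c \<odot> (x \<otimes> y)"
    and "\<And>c x y. x \<in> carrier A \<Longrightarrow> y \<in> carrier A \<Longrightarrow> x \<otimes> (c \<odot> y) = c \<odot> (x \<otimes> y)"
  shows "k_algebra A"
proof -
  interpret ring A by fact
  have "Module.module class_ring A"
    by (rule moduleI) (auto simp: cring_class_ring assms abelian_group_axioms)
  then show ?thesis
    using assms by (auto simp: k_algebra_def k_algebra_axioms_def)
qed

context k_algebra
begin

lemma scal_closed [simp, intro]: "x \<in> carrier A \<Longrightarrow> c \<odot> x \<in> carrier A"
  by (simp add: smult_closed)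

lemma scal_add_left: "x \<in> carrier A \<Longrightarrow> (c + d) \<odot> x = c \<odot> x \<oplus> d \<odot> x"
  using smult_l_distr[of c d x] by simp

lemma scal_add_right: "x \<in> carrier A \<Longrightarrow> y \<in> carrier A \<Longrightarrow> c \<odot> (x \<oplus> y) = c \<odot> x \<oplus> c \<odot> y"
  using smult_r_distr[of c x y] by simp

lemma scal_scal [simp]: "x \<in> carrier A \<Longrightarrow> c \<odot> (d \<odot> x) = (c * d) \<odot> x"
  using smult_assoc1[of c d x] by simp

lemma scal_one [simp]: "x \<in> carrier A \<Longrightarrow> 1 \<odot> x = x"
  using smult_one[of x] by simp

lemma scal_zero_left [simp]: "x \<in> carrier A \<Longrightarrow> 0 \<odot> x = \<zero>"
  using smult_l_null[of x] by simp

lemma scal_zero_right [simp]: "c \<odot> \<zero> = \<zero>"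
  using smult_r_null[of c] by simp

lemma scal_minus_left: "x \<in> carrier A \<Longrightarrow> (- c) \<odot> x = \<ominus> (c \<odot> x)"
proof -
  assume x: "x \<in> carrier A"
  have "(- c) \<odot> x \<oplus> c \<odot> x = \<zero>"
    using scal_add_left[OF x, of "- c" c] x by simp
  then show ?thesis
    using x by (simp add: minus_equality)
qed

lemma scal_minus_one: "x \<in> carrier A \<Longrightarrow> (- 1) \<odot> x = \<ominus> x"
  by (simp add: scal_minus_left)

lemma scal_minus_one_cancel:
  "x \<in> carrier A \<Longrightarrow> (- 1) \<odot> x \<oplus> x = \<zero>" "x \<in> carrier A \<Longrightarrow> x \<oplus> (- 1) \<odot> x = \<zero>"
  by (simp_all add: scal_minus_one l_neg r_neg)

lemmas smult_mult_left [simp] smult_mult_right [simp]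

lemma diff_eq_zero_iff:
  assumes "x \<in> carrier A" "y \<in> carrier A"
  shows "x \<ominus> y = \<zero> \<longleftrightarrow> x = y"
proof
  assume "x \<ominus> y = \<zero>"
  moreover have "x = (x \<ominus> y) \<oplus> y"
    using assms by (simp add: a_minus_def a_assoc l_neg)
  ultimately show "x = y" using assms by simp
qed (use assms in \<open>simp add: a_minus_def r_neg\<close>)

end

lemma lin_mapI:
  assumes "\<And>x. x \<in> carrier V \<Longrightarrow> f x \<in> carrier W"
    and "\<And>x y. x \<in> carrier V \<Longrightarrow> y \<in> carrier V \<Longrightarrow> f (x \<oplus>\<^bsub>V\<^esub> y) = f x \<oplus>\<^bsub>W\<^esub> f y"
    and "\<And>c x. x \<in> carrier V \<Longrightarrow> f (c \<odot>\<^bsub>V\<^esub> x) = c \<odot>\<^bsub>W\<^esub> f x"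
  shows "f \<in> lin_map V W"
  using assms by (auto simp: lin_map_def)

lemma lin_map_closed: "f \<in> lin_map V W \<Longrightarrow> x \<in> carrier V \<Longrightarrow> f x \<in> carrier W"
  by (auto simp: lin_map_def)

lemma lin_map_add:
  "f \<in> lin_map V W \<Longrightarrow> x \<in> carrier V \<Longrightarrow> y \<in> carrier V \<Longrightarrow> f (x \<oplus>\<^bsub>V\<^esub> y) = f x \<oplus>\<^bsub>W\<^esub> f y"
  by (auto simp: lin_map_def)

lemma lin_map_smult: "f \<in> lin_map V W \<Longrightarrow> x \<in> carrier V \<Longrightarrow> f (c \<odot>\<^bsub>V\<^esub> x) = c \<odot>\<^bsub>W\<^esub> f x"
  by (auto simp: lin_map_def)

lemma lin_map_comp: "f \<in> lin_map U V \<Longrightarrow> g \<in> lin_map V W \<Longrightarrow> (\<lambda>x. g (f x)) \<in> lin_map U W"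
  by (rule lin_mapI) (auto simp: lin_map_closed lin_map_add lin_map_smult)

lemma lin_map_zero:
  assumes "k_algebra V" "k_algebra W" "f \<in> lin_map V W"
  shows "f \<zero>\<^bsub>V\<^esub> = \<zero>\<^bsub>W\<^esub>"
proof -
  interpret V: k_algebra V by fact
  interpret W: k_algebra W by fact
  have "f (0 \<odot>\<^bsub>V\<^esub> \<zero>\<^bsub>V\<^esub>) = 0 \<odot>\<^bsub>W\<^esub> f \<zero>\<^bsub>V\<^esub>"
    using assms by (intro lin_map_smult) auto
  then show ?thesis
    using lin_map_closed[OF assms(3)] by simp
qed

lemma lin_map_minus:
  assumes "k_algebra V" "k_algebra W" "f \<in> lin_map V W" "x \<in> carrier V"
  shows "f (\<ominus>\<^bsub>V\<^esub> x) = \<ominus>\<^bsub>W\<^esub> f x"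
proof -
  interpret V: k_algebra V by fact
  interpret W: k_algebra W by fact
  have "f ((-1) \<odot>\<^bsub>V\<^esub> x) = (-1) \<odot>\<^bsub>W\<^esub> f x"
    using assms by (intro lin_map_smult) auto
  then show ?thesis
    using assms lin_map_closed[OF assms(3)] by (simp add: V.scal_minus_one W.scal_minus_one)
qed

lemma lin_map_finsum:
  assumes "k_algebra V" "k_algebra W" "f \<in> lin_map V W" "h \<in> I \<rightarrow> carrier V"
  shows "f (finsum V h I) = (\<Oplus>\<^bsub>W\<^esub>i\<in>I. f (h i))"
proof -
  interpret V: k_algebra V by fact
  interpret W: k_algebra W by fact
  show ?thesis
    using assms(4)
  proof (induction I rule: infinite_finite_induct)
    case (insert i I)
    then have "finsum V h I \<in> carrier V" by auto
    with insert show ?case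
      using lin_map_closed[OF assms(3)]
      by (subst V.finsum_insert, simp_all, subst W.finsum_insert)
         (auto simp: lin_map_add[OF assms(3)])
  qed (auto simp: lin_map_zero[OF assms(1-3)] V.finsum_infinite W.finsum_infinite)
qed

lemma (in k_algebra) lin_map_left_mult: "a \<in> carrier A \<Longrightarrow> (\<lambda>x. a \<otimes> x) \<in> lin_map A A"
  by (rule lin_mapI) (auto simp: r_distr)

lemma (in k_algebra) lin_map_right_mult: "a \<in> carrier A \<Longrightarrow> (\<lambda>x. x \<otimes> a) \<in> lin_map A A"
  by (rule lin_mapI) (auto simp: l_distr)

lemma lin_map_id: "(\<lambda>x. x) \<in> lin_map V V" "id \<in> lin_map V V"
  by (auto intro: lin_mapI)

lemma (in k_algebra) lin_map_plus:
  "f \<in> lin_map V A \<Longrightarrow> g \<in> lin_map V A \<Longrightarrow> (\<lambda>x. f x \<oplus> g x) \<in> lin_map V A"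
  by (rule lin_mapI) (auto simp: lin_map_closed lin_map_add lin_map_smult scal_add_right
      add.m_assoc add.m_lcomm)

lemma (in k_algebra) lin_map_scal:
  "f \<in> lin_map V A \<Longrightarrow> (\<lambda>x. c \<odot> f x) \<in> lin_map V A"
  by (rule lin_mapI) (auto simp: lin_map_closed lin_map_add lin_map_smult scal_add_right
      mult.commute)


lemma alg_homI:
  assumes "\<And>x. x \<in> carrier A \<Longrightarrow> f x \<in> carrier B"
    and "\<And>x y. x \<in> carrier A \<Longrightarrow> y \<in> carrier A \<Longrightarrow> f (x \<oplus>\<^bsub>A\<^esub> y) = f x \<oplus>\<^bsub>B\<^esub> f y"
    and "\<And>c x. x \<in> carrier A \<Longrightarrow> f (c \<odot>\<^bsub>A\<^esub> x) = c \<odot>\<^bsub>B\<^esub> f x"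
    and "\<And>x y. x \<in> carrier A \<Longrightarrow> y \<in> carrier A \<Longrightarrow> f (x \<otimes>\<^bsub>A\<^esub> y) = f x \<otimes>\<^bsub>B\<^esub> f y"
    and "f \<one>\<^bsub>A\<^esub> = \<one>\<^bsub>B\<^esub>"
  shows "f \<in> alg_hom A B"
  using assms by (auto simp: alg_hom_def ring_hom_def lin_map_def)

lemma alg_hom_lin: "f \<in> alg_hom A B \<Longrightarrow> f \<in> lin_map A B"
  by (simp add: alg_hom_def)

lemma alg_hom_closed: "f \<in> alg_hom A B \<Longrightarrow> x \<in> carrier A \<Longrightarrow> f x \<in> carrier B"
  by (auto simp: alg_hom_def lin_map_def)

lemma alg_hom_mult:
  "f \<in> alg_hom A B \<Longrightarrow> x \<in> carrier A \<Longrightarrow> y \<in> carrier A \<Longrightarrow> f (x \<otimes>\<^bsub>A\<^esub> y) = f x \<otimes>\<^bsub>B\<^esub> f y"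
  by (auto simp: alg_hom_def ring_hom_def)

lemma alg_hom_one: "f \<in> alg_hom A B \<Longrightarrow> f \<one>\<^bsub>A\<^esub> = \<one>\<^bsub>B\<^esub>"
  by (auto simp: alg_hom_def ring_hom_def)

lemma alg_hom_lin_mult_one:
  assumes "f \<in> lin_map A B"
    and "\<And>x y. x \<in> carrier A \<Longrightarrow> y \<in> carrier A \<Longrightarrow> f (x \<otimes>\<^bsub>A\<^esub> y) = f x \<otimes>\<^bsub>B\<^esub> f y"
    and "f \<one>\<^bsub>A\<^esub> = \<one>\<^bsub>B\<^esub>"
  shows "f \<in> alg_hom A B"
  using assms by (auto simp: alg_hom_def ring_hom_def lin_map_def)

lemmas alg_hom_add = lin_map_add[OF alg_hom_lin]
  and alg_hom_smult = lin_map_smult[OF alg_hom_lin]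

lemma alg_hom_comp: "f \<in> alg_hom A B \<Longrightarrow> g \<in> alg_hom B C \<Longrightarrow> (\<lambda>x. g (f x)) \<in> alg_hom A C"
  by (rule alg_homI)
     (auto simp: alg_hom_closed alg_hom_mult alg_hom_one alg_hom_add alg_hom_smult)

lemma alg_hom_id: "(\<lambda>x. x) \<in> alg_hom A A" "id \<in> alg_hom A A"
  by (auto intro: alg_homI)

lemma alg_hom_pow:
  assumes "k_algebra A" "k_algebra B" "f \<in> alg_hom A B" "x \<in> carrier A"
  shows "f (x [^]\<^bsub>A\<^esub> (k::nat)) = f x [^]\<^bsub>B\<^esub> k"
proof -
  interpret A: k_algebra A by fact
  interpret B: k_algebra B by fact
  show ?thesis
    by (induction k) (use assms in \<open>auto simp: alg_hom_one alg_hom_mult\<close>)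
qed


subsection \<open>Spanning sets\<close>

text \<open>An inductive span turns linear extension arguments into rule inductions, without
  coordinates.\<close>

inductive_set lspan :: "('k::field, 'a) module \<Rightarrow> 'a set \<Rightarrow> 'a set"
  for V :: "('k::field, 'a) module" and T :: "'a set" where
  zero: "\<zero>\<^bsub>V\<^esub> \<in> lspan V T"
| base: "x \<in> T \<Longrightarrow> x \<in> lspan V T"
| add: "x \<in> lspan V T \<Longrightarrow> y \<in> lspan V T \<Longrightarrow> x \<oplus>\<^bsub>V\<^esub> y \<in> lspan V T"
| smult: "x \<in> lspan V T \<Longrightarrow> c \<odot>\<^bsub>V\<^esub> x \<in> lspan V T"

definition spanning :: "('k::field, 'a) module \<Rightarrow> 'a set \<Rightarrow> bool" where
  "spanning V T \<longleftrightarrow> T \<subseteq> carrier V \<and> carrier V \<subseteq> lspan V T"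

lemma lspan_closed:
  assumes "k_algebra V" "T \<subseteq> carrier V" "x \<in> lspan V T"
  shows "x \<in> carrier V"
proof -
  interpret V: k_algebra V by fact
  show ?thesis
    using assms(3,2) by induction auto
qed

lemma spanning_induct [consumes 3, case_names zero base add smult]:
  assumes "k_algebra V" "spanning V T" "x \<in> carrier V"
    and "P \<zero>\<^bsub>V\<^esub>" "\<And>x. x \<in> T \<Longrightarrow> P x"
    and "\<And>x y. x \<in> carrier V \<Longrightarrow> y \<in> carrier V \<Longrightarrow> P x \<Longrightarrow> P y \<Longrightarrow> P (x \<oplus>\<^bsub>V\<^esub> y)"
    and "\<And>c x. x \<in> carrier V \<Longrightarrow> P x \<Longrightarrow> P (c \<odot>\<^bsub>V\<^esub> x)"
  shows "P x"
proof -
  have T: "T \<subseteq> carrier V" and "x \<in> lspan V T"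
    using assms by (auto simp: spanning_def)
  from this(2) show ?thesis
  proof (induction rule: lspan.induct)
    case (add x y) then show ?case
      using lspan_closed[OF assms(1) T] assms(6) by blast
  next
    case (smult x c) then show ?case
      using lspan_closed[OF assms(1) T] assms(7) by blast
  qed (use assms in auto)
qed

lemma lin_map_eq_on_spanning:
  assumes "k_algebra V" "k_algebra W" "spanning V T" "f \<in> lin_map V W" "g \<in> lin_map V W"
    and "\<And>t. t \<in> T \<Longrightarrow> f t = g t" and "x \<in> carrier V"
  shows "f x = g x"
  using assms(1,3,7)
  by (induction rule: spanning_induct)
     (use assms in \<open>auto simp: lin_map_zero[of V W] lin_map_add lin_map_smult\<close>)

text \<open>Both sides of the multiplicativity identity are bilinear.\<close>

lemma alg_homI_spanning:
  assumes V: "k_algebra V" and W: "k_algebra W" and T: "spanning V T" and f: "f \<in> lin_map V W"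
    and mult: "\<And>s t. s \<in> T \<Longrightarrow> t \<in> T \<Longrightarrow> f (s \<otimes>\<^bsub>V\<^esub> t) = f s \<otimes>\<^bsub>W\<^esub> f t"
    and one: "f \<one>\<^bsub>V\<^esub> = \<one>\<^bsub>W\<^esub>"
  shows "f \<in> alg_hom V W"
proof -
  interpret V: k_algebra V by fact
  interpret W: k_algebra W by fact
  have sub: "T \<subseteq> carrier V" using T by (simp add: spanning_def)
  note fc = lin_map_closed[OF f]
  have 1: "f (s \<otimes>\<^bsub>V\<^esub> y) = f s \<otimes>\<^bsub>W\<^esub> f y" if s: "s \<in> T" and y: "y \<in> carrier V" for s y
  proof (rule lin_map_eq_on_spanning[OF V W T _ _ _ y])
    show "(\<lambda>y. f (s \<otimes>\<^bsub>V\<^esub> y)) \<in> lin_map V W"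
      using s sub by (intro lin_map_comp[OF V.lin_map_left_mult f]) auto
    show "(\<lambda>y. f s \<otimes>\<^bsub>W\<^esub> f y) \<in> lin_map V W"
      using s sub fc by (intro lin_map_comp[OF f W.lin_map_left_mult]) auto
  qed (use s mult in auto)
  have 2: "f (x \<otimes>\<^bsub>V\<^esub> y) = f x \<otimes>\<^bsub>W\<^esub> f y" if x: "x \<in> carrier V" and y: "y \<in> carrier V" for x y
  proof (rule lin_map_eq_on_spanning[OF V W T _ _ _ x])
    show "(\<lambda>x. f (x \<otimes>\<^bsub>V\<^esub> y)) \<in> lin_map V W"
      using y by (intro lin_map_comp[OF V.lin_map_right_mult f]) auto
    show "(\<lambda>x. f x \<otimes>\<^bsub>W\<^esub> f y) \<in> lin_map V W"
      using y fc by (intro lin_map_comp[OF f W.lin_map_right_mult]) auto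
  qed (use 1 y in auto)
  show ?thesis
    using f 2 one by (intro alg_hom_lin_mult_one) auto
qed

lemma spanning_image:
  assumes V: "k_algebra V" and W: "k_algebra W" and T: "spanning V T" and f: "f \<in> lin_map V W"
    and surj: "carrier W \<subseteq> f ` carrier V"
  shows "spanning W (f ` T)"
  unfolding spanning_def
proof
  show "f ` T \<subseteq> carrier W"
    using T lin_map_closed[OF f] by (auto simp: spanning_def)
  have "f x \<in> lspan W (f ` T)" if "x \<in> carrier V" for x
    using V T that
  proof (induction rule: spanning_induct)
    case zero then show ?case by (simp add: lin_map_zero[OF V W f] lspan.zero)
  next
    case (base x) then show ?case by (auto intro: lspan.base)
  next
    case (add x y) then show ?case by (simp add: lin_map_add[OF f] lspan.add)
  next
    case (smult c x) then show ?case by (simp add: lin_map_smult[OF f] lspan.smult)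
  qed
  then show "carrier W \<subseteq> lspan W (f ` T)"
    using surj by auto
qed


subsection \<open>Quotient algebras\<close>

locale alg_ideal = F: k_algebra F + I: ideal I F
  for F :: "('k::field, 'a) module" and I
begin

abbreviation proj where "proj p \<equiv> I +>\<^bsub>F\<^esub> p"

lemma quot_simps:
  "carrier (quot_alg F I) = proj ` carrier F"
  "\<one>\<^bsub>quot_alg F I\<^esub> = proj \<one>\<^bsub>F\<^esub>"
  "\<zero>\<^bsub>quot_alg F I\<^esub> = I"
  unfolding quot_alg_def ring.defs FactRing_def by (simp_all add: A_RCOSETS_def' UNION_singleton_eq_range)

lemma quot_mult: "x \<in> carrier F \<Longrightarrow> y \<in> carrier F \<Longrightarrow>
    proj x \<otimes>\<^bsub>quot_alg F I\<^esub> proj y = proj (x \<otimes>\<^bsub>F\<^esub> y)"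
  by (simp add: quot_alg_def ring.defs FactRing_def I.rcoset_mult_add)

lemma quot_add: "x \<in> carrier F \<Longrightarrow> y \<in> carrier F \<Longrightarrow>
    proj x \<oplus>\<^bsub>quot_alg F I\<^esub> proj y = proj (x \<oplus>\<^bsub>F\<^esub> y)"
  by (simp add: quot_alg_def ring.defs FactRing_def I.a_rcos_sum)

lemma ideal_scal: "p \<in> I \<Longrightarrow> c \<odot>\<^bsub>F\<^esub> p \<in> I"
proof -
  assume p: "p \<in> I"
  then have "c \<odot>\<^bsub>F\<^esub> p = (c \<odot>\<^bsub>F\<^esub> \<one>\<^bsub>F\<^esub>) \<otimes>\<^bsub>F\<^esub> p"
    using I.a_Hcarr by simp
  moreover have "(c \<odot>\<^bsub>F\<^esub> \<one>\<^bsub>F\<^esub>) \<otimes>\<^bsub>F\<^esub> p \<in> I"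
    using p by (intro I.I_l_closed) auto
  ultimately show ?thesis by simp
qed

lemma proj_eq_iff:
  assumes "x \<in> carrier F" "y \<in> carrier F"
  shows "proj x = proj y \<longleftrightarrow> x \<ominus>\<^bsub>F\<^esub> y \<in> I"
proof
  assume "proj x = proj y"
  then have "x \<in> proj y" using I.a_rcos_self[OF assms(1)] by simp
  then show "x \<ominus>\<^bsub>F\<^esub> y \<in> I"
    using assms I.a_rcos_module_minus F.ring_axioms by blast
next
  assume "x \<ominus>\<^bsub>F\<^esub> y \<in> I"
  then have "x \<in> proj y"
    using assms I.a_rcos_module_minus F.ring_axioms by blast
  then show "proj x = proj y"
    using assms I.a_repr_independence' by metis
qed

lemma proj_repr:
  assumes "p \<in> proj x" "x \<in> carrier F"
  shows "p \<in> carrier F" "proj p = proj x"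
proof -
  show "p \<in> carrier F" using I.a_elemrcos_carrier assms by blast
  show "proj p = proj x" using I.a_repr_independence' assms by metis
qed

lemma quot_scal:
  assumes "x \<in> carrier F"
  shows "c \<odot>\<^bsub>quot_alg F I\<^esub> proj x = proj (c \<odot>\<^bsub>F\<^esub> x)"
proof -
  have "proj (c \<odot>\<^bsub>F\<^esub> p) = proj (c \<odot>\<^bsub>F\<^esub> x)" if "p \<in> proj x" for p
  proof -
    note p = proj_repr[OF that assms]
    then have "p \<ominus>\<^bsub>F\<^esub> x \<in> I" using proj_eq_iff assms by blast
    then have "c \<odot>\<^bsub>F\<^esub> (p \<ominus>\<^bsub>F\<^esub> x) \<in> I" by (rule ideal_scal)
    moreover have "c \<odot>\<^bsub>F\<^esub> (p \<ominus>\<^bsub>F\<^esub> x) = c \<odot>\<^bsub>F\<^esub> p \<ominus>\<^bsub>F\<^esub> c \<odot>\<^bsub>F\<^esub> x"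
      using p assms
      by (simp add: a_minus_def F.scal_add_right F.scal_minus_one[symmetric] mult.commute)
    ultimately show ?thesis using p assms by (simp add: proj_eq_iff)
  qed
  moreover have "x \<in> proj x" using I.a_rcos_self assms by blast
  ultimately have "(\<Union>p\<in>proj x. proj (c \<odot>\<^bsub>F\<^esub> p)) = proj (c \<odot>\<^bsub>F\<^esub> x)"
    by (intro UN_constant_eq ballI)
  then show ?thesis
    by (simp add: quot_alg_def ring.defs module.defs)
qed

lemma quot_ring: "ring (quot_alg F I)"
proof -
  interpret Q: ring "F Quot I" by (rule I.quotient_is_ring)
  have s: "carrier (quot_alg F I) = carrier (F Quot I)"
      "mult (quot_alg F I) = mult (F Quot I)" "one (quot_alg F I) = one (F Quot I)"
      "zero (quot_alg F I) = zero (F Quot I)" "add (quot_alg F I) = add (F Quot I)"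
    by (auto simp: quot_alg_def ring.defs)
  show ?thesis
  proof (rule ringI)
    show "abelian_group (quot_alg F I)"
    proof (rule abelian_groupI)
      show "\<exists>y\<in>carrier (quot_alg F I). y \<oplus>\<^bsub>quot_alg F I\<^esub> x = \<zero>\<^bsub>quot_alg F I\<^esub>"
        if "x \<in> carrier (quot_alg F I)" for x
        using that by (intro bexI[of _ "\<ominus>\<^bsub>F Quot I\<^esub> x"]) (simp_all add: s Q.l_neg)
    qed (simp_all add: s Q.a_ac)
    show "Group.monoid (quot_alg F I)"
      by (rule monoidI) (simp_all add: s Q.m_assoc)
  qed (simp_all add: s Q.l_distr Q.r_distr)
qed

lemma quot_k_algebra: "k_algebra (quot_alg F I)"
proof (rule k_algebraI[OF quot_ring])
  fix c d X Y
  assume X: "X \<in> carrier (quot_alg F I)"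
  then obtain x where x: "x \<in> carrier F" "X = proj x" by (auto simp: quot_simps)
  show "c \<odot>\<^bsub>quot_alg F I\<^esub> X \<in> carrier (quot_alg F I)"
    using x by (simp add: quot_scal quot_simps)
  show "(c + d) \<odot>\<^bsub>quot_alg F I\<^esub> X = c \<odot>\<^bsub>quot_alg F I\<^esub> X \<oplus>\<^bsub>quot_alg F I\<^esub> d \<odot>\<^bsub>quot_alg F I\<^esub> X"
    using x by (simp add: quot_scal quot_add F.scal_add_left)
  show "(c * d) \<odot>\<^bsub>quot_alg F I\<^esub> X = c \<odot>\<^bsub>quot_alg F I\<^esub> (d \<odot>\<^bsub>quot_alg F I\<^esub> X)"
    using x by (simp add: quot_scal)
  show "1 \<odot>\<^bsub>quot_alg F I\<^esub> X = X"
    using x by (simp add: quot_scal)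
  assume Y: "Y \<in> carrier (quot_alg F I)"
  then obtain y where y: "y \<in> carrier F" "Y = proj y" by (auto simp: quot_simps)
  show "c \<odot>\<^bsub>quot_alg F I\<^esub> (X \<oplus>\<^bsub>quot_alg F I\<^esub> Y) = c \<odot>\<^bsub>quot_alg F I\<^esub> X \<oplus>\<^bsub>quot_alg F I\<^esub> c \<odot>\<^bsub>quot_alg F I\<^esub> Y"
    using x y by (simp add: quot_scal quot_add F.scal_add_right)
  show "(c \<odot>\<^bsub>quot_alg F I\<^esub> X) \<otimes>\<^bsub>quot_alg F I\<^esub> Y = c \<odot>\<^bsub>quot_alg F I\<^esub> (X \<otimes>\<^bsub>quot_alg F I\<^esub> Y)"
    using x y by (simp add: quot_scal quot_mult)
  show "X \<otimes>\<^bsub>quot_alg F I\<^esub> (c \<odot>\<^bsub>quot_alg F I\<^esub> Y) = c \<odot>\<^bsub>quot_alg F I\<^esub> (X \<otimes>\<^bsub>quot_alg F I\<^esub> Y)"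
    using x y by (simp add: quot_scal quot_mult)
qed

lemma proj_alg_hom: "proj \<in> alg_hom F (quot_alg F I)"
  by (rule alg_homI) (simp_all only: quot_simps quot_scal quot_add quot_mult imageI)

lemma quot_spanning: "spanning F T \<Longrightarrow> spanning (quot_alg F I) (proj ` T)"
  by (rule spanning_image[OF F.k_algebra_axioms quot_k_algebra _ alg_hom_lin[OF proj_alg_hom]])
     (auto simp: quot_simps)

lemma lin_map_const_on_coset:
  assumes "k_algebra M" "f \<in> lin_map F M" "\<And>p. p \<in> I \<Longrightarrow> f p = \<zero>\<^bsub>M\<^esub>"
    and "p \<in> proj x" "x \<in> carrier F"
  shows "f p = f x"
proof -
  interpret M: k_algebra M by (rule assms(1))
  note p = proj_repr[OF assms(4,5)]
  have "p \<ominus>\<^bsub>F\<^esub> x \<in> I"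
    by (rule iffD1[OF proj_eq_iff[OF p(1) assms(5)] p(2)])
  then have "f (p \<ominus>\<^bsub>F\<^esub> x) = \<zero>\<^bsub>M\<^esub>"
    by (rule assms(3))
  moreover have "f (p \<ominus>\<^bsub>F\<^esub> x) = f p \<ominus>\<^bsub>M\<^esub> f x"
    using p(1) assms(5) lin_map_minus[OF F.k_algebra_axioms assms(1,2), of x]
    by (simp add: a_minus_def lin_map_add[OF assms(2)])
  ultimately show ?thesis
    using lin_map_closed[OF assms(2)] p(1) assms(5) M.diff_eq_zero_iff by simp
qed

text \<open>The maps induced on a tensor product are defined by a description of this form.\<close>

lemma quot_the_value:
  assumes "k_algebra M" "f \<in> lin_map F M" "\<And>p. p \<in> I \<Longrightarrow> f p = \<zero>\<^bsub>M\<^esub>" "x \<in> carrier F"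
  shows "(THE v. \<forall>t\<in>proj x. v = f t) = f x"
proof (rule the_equality)
  show "\<forall>t\<in>proj x. f x = f t"
  proof
    fix t assume "t \<in> proj x"
    from lin_map_const_on_coset[OF assms(1,2) _ this assms(4)] assms(3)
    show "f x = f t" by metis
  qed
next
  fix v assume "\<forall>t\<in>proj x. v = f t"
  then show "v = f x" using I.a_rcos_self[OF assms(4)] by blast
qed

lemma quot_lin_mapI:
  assumes "f \<in> lin_map F M" "\<And>x. x \<in> carrier F \<Longrightarrow> h (proj x) = f x"
  shows "h \<in> lin_map (quot_alg F I) M"
  by (rule lin_mapI; unfold quot_simps; clarify)
     (simp_all add: assms(2) quot_add quot_scal lin_map_closed[OF assms(1)]
       lin_map_add[OF assms(1)] lin_map_smult[OF assms(1)])

lemma quot_alg_homI: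
  assumes "f \<in> alg_hom F M" "\<And>x. x \<in> carrier F \<Longrightarrow> h (proj x) = f x"
  shows "h \<in> alg_hom (quot_alg F I) M"
  by (rule alg_homI; unfold quot_simps; clarify?)
     (simp_all add: assms(2) quot_add quot_scal quot_mult alg_hom_closed[OF assms(1)]
       alg_hom_add[OF assms(1)] alg_hom_smult[OF assms(1)] alg_hom_mult[OF assms(1)]
       alg_hom_one[OF assms(1)])

end

section \<open>Free vector spaces\<close>

lemma lookup_scale [simp]: "Poly_Mapping.lookup (scale c t) p = c * Poly_Mapping.lookup t p"
  by (simp add: scale_def Poly_Mapping.map.rep_eq when_def)

lemma scale_simps:
  "scale c (s + t) = scale c s + scale c t" "scale (c + d) t = scale c t + scale d t"
  "scale (c * d) t = scale c (scale d t)" "scale 1 t = t" "scale c (s - t) = scale c s - scale c t"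
  "scale c 0 = 0" "scale 0 t = 0"
  by (rule poly_mapping_eqI, simp add: lookup_add lookup_minus algebra_simps)+

lemma scale_single [simp]: "scale c (Poly_Mapping.single p d) = Poly_Mapping.single p (c * d)"
  by (rule poly_mapping_eqI) (simp add: lookup_single when_def)

lemma module_scale: "Modules.module (scale :: 'k::field \<Rightarrow> ('b \<Rightarrow>\<^sub>0 'k) \<Rightarrow> _)"
  by (simp add: Modules.module_def scale_simps)

definition fsupp :: "'b set \<Rightarrow> ('b \<Rightarrow>\<^sub>0 'k::zero) set" where
  "fsupp P = {t. Poly_Mapping.keys t \<subseteq> P}"

lemma fsupp_simps [simp]:
  "0 \<in> fsupp P" "p \<in> P \<Longrightarrow> Poly_Mapping.single p c \<in> fsupp P"
  by (auto simp: fsupp_def)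

lemma fsupp_add: "s \<in> fsupp P \<Longrightarrow> t \<in> fsupp P \<Longrightarrow> s + t \<in> fsupp P"
  using keys_add[of s t] by (auto simp: fsupp_def)

lemma fsupp_diff:
  fixes s t :: "'b \<Rightarrow>\<^sub>0 'k::ab_group_add"
  shows "s \<in> fsupp P \<Longrightarrow> t \<in> fsupp P \<Longrightarrow> s - t \<in> fsupp P"
  using keys_diff[of s t] by (auto simp: fsupp_def)

lemma keys_scale: "Poly_Mapping.keys (scale c t) \<subseteq> Poly_Mapping.keys t"
  by (auto simp: in_keys_iff)

lemma fsupp_scale: "t \<in> fsupp P \<Longrightarrow> scale c t \<in> fsupp P"
  using keys_scale[of c t] by (auto simp: fsupp_def)

lemma fsupp_sum: "(\<And>i. i \<in> I \<Longrightarrow> f i \<in> fsupp P) \<Longrightarrow> sum f I \<in> fsupp P"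
  by (induction I rule: infinite_finite_induct) (auto intro: fsupp_add)

lemma sum_singles:
  fixes t :: "'b \<Rightarrow>\<^sub>0 'k::comm_monoid_add"
  shows "(\<Sum>p\<in>Poly_Mapping.keys t. Poly_Mapping.single p (Poly_Mapping.lookup t p)) = t"
proof (rule poly_mapping_eqI)
  fix k
  have "Poly_Mapping.lookup (\<Sum>p\<in>Poly_Mapping.keys t. Poly_Mapping.single p (Poly_Mapping.lookup t p)) k
      = (\<Sum>p\<in>Poly_Mapping.keys t. Poly_Mapping.lookup t p when p = k)"
    by (simp add: lookup_sum lookup_single)
  also have "\<dots> = Poly_Mapping.lookup t k"
    by (simp add: when_def in_keys_iff)
  finally show "Poly_Mapping.lookup (\<Sum>p\<in>Poly_Mapping.keys t.
      Poly_Mapping.single p (Poly_Mapping.lookup t p)) k = Poly_Mapping.lookup t k" .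
qed

lemma fsupp_induct [consumes 1, case_names zero add]:
  fixes t :: "'b \<Rightarrow>\<^sub>0 'k::comm_monoid_add"
  assumes t: "t \<in> fsupp P" and "Q 0"
    and "\<And>p c s. p \<in> P \<Longrightarrow> s \<in> fsupp P \<Longrightarrow> Q s \<Longrightarrow> Q (Poly_Mapping.single p c + s)"
  shows "Q t"
proof -
  have "Q (\<Sum>p\<in>K. Poly_Mapping.single p (f p))" if "finite K" "K \<subseteq> P" for K f
    using that
  proof (induction K rule: finite_induct)
    case (insert p K)
    have "(\<Sum>p\<in>K. Poly_Mapping.single p (f p)) \<in> fsupp P"
      using insert.prems by (intro fsupp_sum) auto
    with insert show ?case
      by (simp add: assms(3))
  qed (simp add: assms(2))
  from this[of "Poly_Mapping.keys t" "Poly_Mapping.lookup t"] show ?thesis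
    using t by (simp add: sum_singles fsupp_def)
qed

definition lin_ext :: "('k::field, 'c) module \<Rightarrow> ('b \<Rightarrow> 'c) \<Rightarrow> ('b \<Rightarrow>\<^sub>0 'k) \<Rightarrow> 'c" where
  "lin_ext M f t = (\<Oplus>\<^bsub>M\<^esub>p\<in>Poly_Mapping.keys t. Poly_Mapping.lookup t p \<odot>\<^bsub>M\<^esub> f p)"

context k_algebra
begin

lemma lin_ext_superset:
  assumes "f \<in> P \<rightarrow> carrier A" "finite K" "Poly_Mapping.keys t \<subseteq> K" "K \<subseteq> P"
  shows "lin_ext A f t = (\<Oplus>p\<in>K. Poly_Mapping.lookup t p \<odot> f p)"
  unfolding lin_ext_def
proof (rule add.finprod_mono_neutral_cong_left)
  fix p assume "p \<in> K - Poly_Mapping.keys t"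
  then show "Poly_Mapping.lookup t p \<odot> f p = \<zero>"
    using assms by (auto simp: in_keys_iff Pi_iff subset_iff)
qed (use assms in \<open>auto simp: Pi_iff subset_iff\<close>)

lemma lin_ext_single [simp]:
  assumes "f p \<in> carrier A"
  shows "lin_ext A f (Poly_Mapping.single p c) = c \<odot> f p"
proof -
  have "lin_ext A f (Poly_Mapping.single p c) = (\<Oplus>q\<in>{p}. Poly_Mapping.lookup (Poly_Mapping.single p c) q \<odot> f q)"
    by (rule lin_ext_superset[of _ "{p}"]) (use assms in auto)
  then show ?thesis using assms by simp
qed

end

text \<open>The multiplication of the record is left open, so that the locale covers the free algebra as well as
  the free vector space underlying a tensor product.\<close>

locale free_space =
  fixes V :: "('k::field, 'b \<Rightarrow>\<^sub>0 'k) module" and P :: "'b set"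
  assumes free_simps: "carrier V = fsupp P" "x \<oplus>\<^bsub>V\<^esub> y = x + y" "\<zero>\<^bsub>V\<^esub> = 0" "c \<odot>\<^bsub>V\<^esub> x = scale c x"
begin

lemma lin_ext_lin_map:
  assumes "k_algebra M" and f: "f \<in> P \<rightarrow> carrier M"
  shows "lin_ext M f \<in> lin_map V M"
proof -
  interpret M: k_algebra M by fact
  show ?thesis
  proof (rule lin_mapI, unfold free_simps)
    fix s t :: "'b \<Rightarrow>\<^sub>0 'k" and c
    assume s: "s \<in> fsupp P"
    let ?L = Poly_Mapping.lookup
    note ext = M.lin_ext_superset[OF f]
    have cl: "(\<lambda>p. ?L u p \<odot>\<^bsub>M\<^esub> f p) \<in> K \<rightarrow> carrier M" if "K \<subseteq> P" for u K
      using f that by auto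
    show "lin_ext M f s \<in> carrier M"
      using s cl unfolding lin_ext_def fsupp_def by (intro M.finsum_closed) auto
    have k: "finite (Poly_Mapping.keys s)" "Poly_Mapping.keys s \<subseteq> P"
        "Poly_Mapping.keys (scale c s) \<subseteq> Poly_Mapping.keys s"
      using s keys_scale[of c s] by (auto simp: fsupp_def)
    have "c \<odot>\<^bsub>M\<^esub> (\<Oplus>\<^bsub>M\<^esub>p\<in>Poly_Mapping.keys s. ?L s p \<odot>\<^bsub>M\<^esub> f p)
        = (\<Oplus>\<^bsub>M\<^esub>p\<in>Poly_Mapping.keys s. c \<odot>\<^bsub>M\<^esub> (?L s p \<odot>\<^bsub>M\<^esub> f p))"
      using cl[OF k(2)] M.lin_map_scal[OF lin_map_id(1), of c]
      by (intro lin_map_finsum[OF assms(1) assms(1)]) auto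
    also have "\<dots> = (\<Oplus>\<^bsub>M\<^esub>p\<in>Poly_Mapping.keys s. ?L (scale c s) p \<odot>\<^bsub>M\<^esub> f p)"
      using f k(2) by (intro M.finsum_cong') (auto simp: Pi_iff subset_iff)
    finally show "lin_ext M f (scale c s) = c \<odot>\<^bsub>M\<^esub> lin_ext M f s"
      using ext[OF k(1) k(3) k(2)] by (simp add: lin_ext_def)
    assume t: "t \<in> fsupp P"
    define K where "K = Poly_Mapping.keys s \<union> Poly_Mapping.keys t"
    have K: "finite K" "K \<subseteq> P" "Poly_Mapping.keys s \<subseteq> K" "Poly_Mapping.keys t \<subseteq> K"
        "Poly_Mapping.keys (s + t) \<subseteq> K"
      using s t keys_add[of s t] by (auto simp: K_def fsupp_def)
    have "(\<Oplus>\<^bsub>M\<^esub>p\<in>K. ?L (s + t) p \<odot>\<^bsub>M\<^esub> f p) = (\<Oplus>\<^bsub>M\<^esub>p\<in>K. ?L s p \<odot>\<^bsub>M\<^esub> f p \<oplus>\<^bsub>M\<^esub> ?L t p \<odot>\<^bsub>M\<^esub> f p)"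
      using f K(2) by (intro M.finsum_cong') (auto simp: lookup_add M.scal_add_left Pi_iff subset_iff)
    also have "\<dots> = (\<Oplus>\<^bsub>M\<^esub>p\<in>K. ?L s p \<odot>\<^bsub>M\<^esub> f p) \<oplus>\<^bsub>M\<^esub> (\<Oplus>\<^bsub>M\<^esub>p\<in>K. ?L t p \<odot>\<^bsub>M\<^esub> f p)"
      using cl[OF K(2)] by (intro M.finsum_addf) auto
    finally show "lin_ext M f (s + t) = lin_ext M f s \<oplus>\<^bsub>M\<^esub> lin_ext M f t"
      using K by (simp add: ext[of K])
  qed
qed

lemma free_spanning: "spanning V ((\<lambda>p. Poly_Mapping.single p 1) ` P)"
  unfolding spanning_def free_simps
proof
  show "fsupp P \<subseteq> lspan V ((\<lambda>p. Poly_Mapping.single p 1) ` P)"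
  proof
    fix t :: "'b \<Rightarrow>\<^sub>0 'k" assume "t \<in> fsupp P"
    then show "t \<in> lspan V ((\<lambda>p. Poly_Mapping.single p 1) ` P)"
    proof (induction rule: fsupp_induct)
      case zero
      show ?case using lspan.zero[of V] by (simp add: free_simps)
    next
      case (add p c s)
      have "c \<odot>\<^bsub>V\<^esub> Poly_Mapping.single p 1 \<in> lspan V ((\<lambda>p. Poly_Mapping.single p 1) ` P)"
        using add by (intro lspan.smult lspan.base) auto
      from lspan.add[OF this add.IH] show ?case
        by (simp add: free_simps)
    qed
  qed
qed auto

end


subsection \<open>The free algebra\<close>

lemma free_algebra_simps [simp]:
  "carrier free_algebra = UNIV" "x \<oplus>\<^bsub>free_algebra\<^esub> y = x + y" "x \<otimes>\<^bsub>free_algebra\<^esub> y = x * y"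
  "\<zero>\<^bsub>free_algebra\<^esub> = 0" "\<one>\<^bsub>free_algebra\<^esub> = 1" "c \<odot>\<^bsub>free_algebra\<^esub> x = scale c x"
  by (simp_all add: free_algebra_def ring.defs module.defs class_ring_def)

lemma free_space_free_algebra: "free_space free_algebra UNIV"
  by standard (auto simp: fsupp_def)

text \<open>Scalar multiples are products with a multiple of the empty word, which is central; hence
  scalars commute with the product of the free algebra.\<close>

lemma scale_eq_mult:
  fixes t :: "('k::field, 'g) free_alg"
  shows "scale c t = Poly_Mapping.single 0 c * t" "scale c t = t * Poly_Mapping.single 0 c"
proof -
  have t: "t \<in> fsupp UNIV" by (simp add: fsupp_def)
  then show "scale c t = Poly_Mapping.single 0 c * t"
    by (induction rule: fsupp_induct) (simp_all add: scale_simps distrib_left mult_single)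
  from t show "scale c t = t * Poly_Mapping.single 0 c"
    by (induction rule: fsupp_induct)
       (simp_all add: scale_simps distrib_right mult_single mult.commute)
qed

lemma k_algebra_free_algebra: "k_algebra (free_algebra :: ('k::field, ('k, 'g) free_alg) module)"
proof (rule k_algebraI)
  show "ring (free_algebra :: ('k, ('k, 'g) free_alg) module)"
  proof (rule ringI)
    show "abelian_group (free_algebra :: ('k, ('k, 'g) free_alg) module)"
      by (rule abelian_groupI) (auto simp: add_ac intro: exI[of _ "- _"])
    show "Group.monoid (free_algebra :: ('k, ('k, 'g) free_alg) module)"
      by (rule monoidI) (auto simp: mult.assoc)
  qed (auto simp: distrib_left distrib_right)
  fix c :: 'k and x y :: "('k, 'g) free_alg"
  show "(c \<odot>\<^bsub>free_algebra\<^esub> x) \<otimes>\<^bsub>free_algebra\<^esub> y = c \<odot>\<^bsub>free_algebra\<^esub> (x \<otimes>\<^bsub>free_algebra\<^esub> y)"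
    by (simp add: scale_eq_mult(1) mult.assoc)
  show "x \<otimes>\<^bsub>free_algebra\<^esub> (c \<odot>\<^bsub>free_algebra\<^esub> y) = c \<odot>\<^bsub>free_algebra\<^esub> (x \<otimes>\<^bsub>free_algebra\<^esub> y)"
    by (simp add: scale_eq_mult(2) mult.assoc)
qed (simp_all add: scale_simps)


section \<open>Tensor products\<close>

subsection \<open>The product on the free vector space over pairs\<close>

text \<open>The operation \<open>f\<close> on the basis is a parameter, because the products of two algebras are operations
  on carriers, associative only there.\<close>

definition conv :: "('b \<Rightarrow> 'b \<Rightarrow> 'b) \<Rightarrow> ('b \<Rightarrow>\<^sub>0 'k::field) \<Rightarrow> ('b \<Rightarrow>\<^sub>0 'k) \<Rightarrow> ('b \<Rightarrow>\<^sub>0 'k)" where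
  "conv f s t = (\<Sum>p\<in>Poly_Mapping.keys s. \<Sum>q\<in>Poly_Mapping.keys t.
     Poly_Mapping.single (f p q) (Poly_Mapping.lookup s p * Poly_Mapping.lookup t q))"

lemma conv_superset:
  assumes "finite K" "Poly_Mapping.keys s \<subseteq> K" "finite L" "Poly_Mapping.keys t \<subseteq> L"
  shows "conv f s t = (\<Sum>p\<in>K. \<Sum>q\<in>L.
     Poly_Mapping.single (f p q) (Poly_Mapping.lookup s p * Poly_Mapping.lookup t q))"
proof -
  have "conv f s t = (\<Sum>p\<in>K. \<Sum>q\<in>Poly_Mapping.keys t.
     Poly_Mapping.single (f p q) (Poly_Mapping.lookup s p * Poly_Mapping.lookup t q))"
    unfolding conv_def using assms by (intro sum.mono_neutral_left) (auto simp: in_keys_iff)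
  also have "\<dots> = (\<Sum>p\<in>K. \<Sum>q\<in>L.
     Poly_Mapping.single (f p q) (Poly_Mapping.lookup s p * Poly_Mapping.lookup t q))"
    using assms by (intro sum.cong refl sum.mono_neutral_left) (auto simp: in_keys_iff)
  finally show ?thesis .
qed

lemma conv_single [simp]:
  "conv f (Poly_Mapping.single p c) (Poly_Mapping.single q d) = Poly_Mapping.single (f p q) (c * d)"
  by (subst conv_superset[of "{p}" _ "{q}"]) auto

lemma conv_add_left: "conv f (s + s') t = conv f s t + conv f s' t"
proof -
  let ?K = "Poly_Mapping.keys s \<union> Poly_Mapping.keys s'"
  have "Poly_Mapping.keys (s + s') \<subseteq> ?K" by (rule keys_add)
  then show ?thesis
    by (simp add: conv_superset[of ?K _ "Poly_Mapping.keys t"] lookup_add distrib_right single_add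
        sum.distrib)
qed

lemma conv_add_right: "conv f t (s + s') = conv f t s + conv f t s'"
proof -
  let ?K = "Poly_Mapping.keys s \<union> Poly_Mapping.keys s'"
  have "Poly_Mapping.keys (s + s') \<subseteq> ?K" by (rule keys_add)
  then show ?thesis
    by (simp add: conv_superset[of "Poly_Mapping.keys t" _ ?K] lookup_add distrib_left single_add
        sum.distrib)
qed

lemma conv_zero [simp]: "conv f 0 t = 0" "conv f t 0 = 0"
  by (simp_all add: conv_def)

lemma conv_diff_left: "conv f (s - s') t = conv f s t - conv f s' t"
  using conv_add_left[of f "s - s'" s' t] by (simp add: eq_diff_eq)

lemma conv_diff_right: "conv f t (s - s') = conv f t s - conv f t s'"
  using conv_add_right[of f t "s - s'" s'] by (simp add: eq_diff_eq)

lemma scale_sum: "scale c (sum g I) = (\<Sum>i\<in>I. scale c (g i))"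
  by (induction I rule: infinite_finite_induct) (simp_all add: scale_simps)

lemma conv_scale: "conv f (scale c s) t = scale c (conv f s t)" "conv f s (scale c t) = scale c (conv f s t)"
proof -
  show "conv f (scale c s) t = scale c (conv f s t)"
    using keys_scale[of c s]
    by (simp add: conv_superset[of "Poly_Mapping.keys s" _ "Poly_Mapping.keys t"] scale_sum mult.assoc)
  show "conv f s (scale c t) = scale c (conv f s t)"
    using keys_scale[of c t]
    by (simp add: conv_superset[of "Poly_Mapping.keys s" _ "Poly_Mapping.keys t"] scale_sum mult_ac)
qed

lemma conv_closed:
  assumes "s \<in> fsupp P" "t \<in> fsupp P" "\<And>p q. p \<in> P \<Longrightarrow> q \<in> P \<Longrightarrow> f p q \<in> P"
  shows "conv f s t \<in> fsupp P"
  unfolding conv_def using assms by (intro fsupp_sum fsupp_simps(2)) (auto simp: fsupp_def)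

lemma conv_assoc:
  assumes "s \<in> fsupp P" "t \<in> fsupp P" "u \<in> fsupp P"
    and "\<And>p q r. p \<in> P \<Longrightarrow> q \<in> P \<Longrightarrow> r \<in> P \<Longrightarrow> f (f p q) r = f p (f q r)"
  shows "conv f (conv f s t) u = conv f s (conv f t u)"
proof -
  have 1: "conv f (conv f (Poly_Mapping.single p c) (Poly_Mapping.single q d)) u
      = conv f (Poly_Mapping.single p c) (conv f (Poly_Mapping.single q d) u)"
    if "p \<in> P" "q \<in> P" for p q c d
    using assms(3) by (induction rule: fsupp_induct)
      (use that assms(4) in \<open>simp_all add: conv_add_right mult.assoc\<close>)
  have 2: "conv f (conv f (Poly_Mapping.single p c) t) u
      = conv f (Poly_Mapping.single p c) (conv f t u)" if "p \<in> P" for p c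
    using assms(2) by (induction rule: fsupp_induct)
      (use that 1 in \<open>simp_all add: conv_add_right conv_add_left del: conv_single\<close>)
  show ?thesis
    using assms(1) by (induction rule: fsupp_induct)
      (use 2 in \<open>simp_all add: conv_add_left\<close>)
qed

subsection \<open>Tensor products of algebras\<close>

definition bilin :: "('k::field, 'a) module \<Rightarrow> ('k, 'b) module \<Rightarrow> ('k, 'c) module \<Rightarrow>
    ('a \<Rightarrow> 'b \<Rightarrow> 'c) \<Rightarrow> bool" where
  "bilin A B M \<beta> \<longleftrightarrow> (\<forall>b\<in>carrier B. (\<lambda>a. \<beta> a b) \<in> lin_map A M) \<and>
     (\<forall>a\<in>carrier A. (\<lambda>b. \<beta> a b) \<in> lin_map B M)"

lemma bilinI:
  assumes "\<And>b. b \<in> carrier B \<Longrightarrow> (\<lambda>a. \<beta> a b) \<in> lin_map A M"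
    and "\<And>a. a \<in> carrier A \<Longrightarrow> (\<lambda>b. \<beta> a b) \<in> lin_map B M"
  shows "bilin A B M \<beta>"
  using assms by (auto simp: bilin_def)

lemma bilinear_relators_cases:
  assumes "r \<in> bilinear_relators A B"
  obtains
    (1) a a' b where "r = Poly_Mapping.single (a \<oplus>\<^bsub>A\<^esub> a', b) 1
        - Poly_Mapping.single (a, b) 1 - Poly_Mapping.single (a', b) 1"
        "a \<in> carrier A" "a' \<in> carrier A" "b \<in> carrier B"
  | (2) a b b' where "r = Poly_Mapping.single (a, b \<oplus>\<^bsub>B\<^esub> b') 1
        - Poly_Mapping.single (a, b) 1 - Poly_Mapping.single (a, b') 1"
        "a \<in> carrier A" "b \<in> carrier B" "b' \<in> carrier B"
  | (3) c a b where "r = Poly_Mapping.single (c \<odot>\<^bsub>A\<^esub> a, b) 1 - Poly_Mapping.single (a, b) c"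
        "a \<in> carrier A" "b \<in> carrier B"
  | (4) c a b where "r = Poly_Mapping.single (a, c \<odot>\<^bsub>B\<^esub> b) 1 - Poly_Mapping.single (a, b) c"
        "a \<in> carrier A" "b \<in> carrier B"
  using assms unfolding bilinear_relators_def
  by (elim UnE CollectE exE conjE) (rule that(1) that(2) that(3) that(4), assumption+)+

locale alg_pair = A: k_algebra A + B: k_algebra B
  for A :: "('k::field, 'a) module" and B :: "('k, 'b) module"
begin

abbreviation pair_mult :: "'a \<times> 'b \<Rightarrow> 'a \<times> 'b \<Rightarrow> 'a \<times> 'b" where
  "pair_mult p q \<equiv> (fst p \<otimes>\<^bsub>A\<^esub> fst q, snd p \<otimes>\<^bsub>B\<^esub> snd q)"

lemma free_tensor_simps:
  "carrier (free_tensor A B) = fsupp (carrier A \<times> carrier B)"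
  "s \<oplus>\<^bsub>free_tensor A B\<^esub> t = s + t"
  "s \<otimes>\<^bsub>free_tensor A B\<^esub> t = conv pair_mult s t"
  "\<zero>\<^bsub>free_tensor A B\<^esub> = 0"
  "\<one>\<^bsub>free_tensor A B\<^esub> = Poly_Mapping.single (\<one>\<^bsub>A\<^esub>, \<one>\<^bsub>B\<^esub>) 1"
  "c \<odot>\<^bsub>free_tensor A B\<^esub> t = scale c t"
  by (simp_all add: free_tensor_def fsupp_def conv_def)

lemma free_space: "free_space (free_tensor A B) (carrier A \<times> carrier B)"
  by standard (simp_all add: free_tensor_simps)

lemma k_algebra_free_tensor: "k_algebra (free_tensor A B)"
proof (rule k_algebraI)
  let ?P = "carrier A \<times> carrier B"
  have unit: "conv pair_mult (Poly_Mapping.single (\<one>\<^bsub>A\<^esub>, \<one>\<^bsub>B\<^esub>) 1) t = t"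
      "conv pair_mult t (Poly_Mapping.single (\<one>\<^bsub>A\<^esub>, \<one>\<^bsub>B\<^esub>) 1) = t"
    if t: "t \<in> fsupp ?P" for t :: "('a \<times> 'b) \<Rightarrow>\<^sub>0 'k"
    using t by (induction rule: fsupp_induct) (auto simp: conv_add_left conv_add_right)
  show "ring (free_tensor A B)"
  proof (rule ringI)
    show "abelian_group (free_tensor A B)"
    proof (rule abelian_groupI, unfold free_tensor_simps)
      fix x :: "('a \<times> 'b) \<Rightarrow>\<^sub>0 'k" assume "x \<in> fsupp ?P"
      then show "\<exists>y\<in>fsupp ?P. y + x = 0"
        using fsupp_diff[of 0 ?P x] by (intro bexI[of _ "- x"]) auto
    qed (simp_all add: fsupp_add add_ac)
    show "Group.monoid (free_tensor A B)"
    proof (rule monoidI, unfold free_tensor_simps)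
      fix x y z :: "('a \<times> 'b) \<Rightarrow>\<^sub>0 'k"
      assume x: "x \<in> fsupp ?P" and y: "y \<in> fsupp ?P"
      then show "conv pair_mult x y \<in> fsupp ?P" by (rule conv_closed) auto
      assume "z \<in> fsupp ?P"
      with x y show "conv pair_mult (conv pair_mult x y) z = conv pair_mult x (conv pair_mult y z)"
        by (rule conv_assoc) (auto simp: A.m_assoc B.m_assoc)
    qed (simp_all add: unit)
  qed (simp_all add: free_tensor_simps conv_add_left conv_add_right)
qed (simp_all add: free_tensor_simps fsupp_scale scale_simps conv_scale)

lemma relators_closed: "bilinear_relators A B \<subseteq> fsupp (carrier A \<times> carrier B)"
  unfolding bilinear_relators_def by (auto intro!: fsupp_diff)

text \<open>Multiplying a bilinearity relator by a pure tensor only changes the elements in it, so the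
  result is a multiple of another relator of the same kind; this makes the relators span an ideal.\<close>

lemma relators_mult:
  assumes r: "r \<in> bilinear_relators A B" and p: "p \<in> carrier A \<times> carrier B"
  shows "conv pair_mult (Poly_Mapping.single p c) r \<in> scale c ` bilinear_relators A B"
    and "conv pair_mult r (Poly_Mapping.single p c) \<in> scale c ` bilinear_relators A B"
proof -
  let ?s = "Poly_Mapping.single"
  let ?R = "bilinear_relators A B"
  have rel:
    "a \<in> carrier A \<Longrightarrow> a' \<in> carrier A \<Longrightarrow> b \<in> carrier B \<Longrightarrow>
       ?s (a \<oplus>\<^bsub>A\<^esub> a', b) 1 - ?s (a, b) 1 - ?s (a', b) 1 \<in> ?R"
    "a \<in> carrier A \<Longrightarrow> b \<in> carrier B \<Longrightarrow> b' \<in> carrier B \<Longrightarrow>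
       ?s (a, b \<oplus>\<^bsub>B\<^esub> b') 1 - ?s (a, b) 1 - ?s (a, b') 1 \<in> ?R"
    "a \<in> carrier A \<Longrightarrow> b \<in> carrier B \<Longrightarrow> ?s (d \<odot>\<^bsub>A\<^esub> a, b) 1 - ?s (a, b) d \<in> ?R"
    "a \<in> carrier A \<Longrightarrow> b \<in> carrier B \<Longrightarrow> ?s (a, d \<odot>\<^bsub>B\<^esub> b) 1 - ?s (a, b) d \<in> ?R"
    for a a' b b' d
    unfolding bilinear_relators_def by (intro UnI1 UnI2 CollectI; blast)+
  obtain x y where xy: "p = (x, y)" "x \<in> carrier A" "y \<in> carrier B" using p by auto
  from r have "\<exists>r'\<in>?R. conv pair_mult (?s p c) r = scale c r'"
  proof (cases rule: bilinear_relators_cases)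
    case (1 a a' b) then show ?thesis using xy
      by (intro bexI[OF _ rel(1)[of "x \<otimes>\<^bsub>A\<^esub> a" "x \<otimes>\<^bsub>A\<^esub> a'" "y \<otimes>\<^bsub>B\<^esub> b"]])
         (simp_all add: conv_diff_right scale_simps A.r_distr)
  next
    case (2 a b b') then show ?thesis using xy
      by (intro bexI[OF _ rel(2)[of "x \<otimes>\<^bsub>A\<^esub> a" "y \<otimes>\<^bsub>B\<^esub> b" "y \<otimes>\<^bsub>B\<^esub> b'"]])
         (simp_all add: conv_diff_right scale_simps B.r_distr)
  next
    case (3 d a b) then show ?thesis using xy
      by (intro bexI[OF _ rel(3)[of "x \<otimes>\<^bsub>A\<^esub> a" "y \<otimes>\<^bsub>B\<^esub> b" d]])
         (simp_all add: conv_diff_right scale_simps)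
  next
    case (4 d a b) then show ?thesis using xy
      by (intro bexI[OF _ rel(4)[of "x \<otimes>\<^bsub>A\<^esub> a" "y \<otimes>\<^bsub>B\<^esub> b" d]])
         (simp_all add: conv_diff_right scale_simps)
  qed
  then show "conv pair_mult (?s p c) r \<in> scale c ` ?R" by blast
  from r have "\<exists>r'\<in>?R. conv pair_mult r (?s p c) = scale c r'"
  proof (cases rule: bilinear_relators_cases)
    case (1 a a' b) then show ?thesis using xy
      by (intro bexI[OF _ rel(1)[of "a \<otimes>\<^bsub>A\<^esub> x" "a' \<otimes>\<^bsub>A\<^esub> x" "b \<otimes>\<^bsub>B\<^esub> y"]])
         (simp_all add: conv_diff_left scale_simps A.l_distr)
  next
    case (2 a b b') then show ?thesis using xy
      by (intro bexI[OF _ rel(2)[of "a \<otimes>\<^bsub>A\<^esub> x" "b \<otimes>\<^bsub>B\<^esub> y" "b' \<otimes>\<^bsub>B\<^esub> y"]])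
         (simp_all add: conv_diff_left scale_simps B.l_distr)
  next
    case (3 d a b) then show ?thesis using xy
      by (intro bexI[OF _ rel(3)[of "a \<otimes>\<^bsub>A\<^esub> x" "b \<otimes>\<^bsub>B\<^esub> y" d]])
         (simp_all add: conv_diff_left scale_simps mult.commute)
  next
    case (4 d a b) then show ?thesis using xy
      by (intro bexI[OF _ rel(4)[of "a \<otimes>\<^bsub>A\<^esub> x" "b \<otimes>\<^bsub>B\<^esub> y" d]])
         (simp_all add: conv_diff_left scale_simps mult.commute)
  qed
  then show "conv pair_mult r (?s p c) \<in> scale c ` ?R" by blast
qed

interpretation scale_module: Modules.module "scale :: 'k \<Rightarrow> (('a \<times> 'b) \<Rightarrow>\<^sub>0 'k) \<Rightarrow> _"
  by (rule module_scale)

lemma span_closed: "bilinear_span A B \<subseteq> fsupp (carrier A \<times> carrier B)"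
  unfolding bilinear_span_def
  by (intro scale_module.span_minimal relators_closed scale_module.subspaceI)
     (auto intro: fsupp_add fsupp_scale)

lemma span_ideal_mult:
  assumes s: "s \<in> bilinear_span A B" and t: "t \<in> fsupp (carrier A \<times> carrier B)"
  shows "conv pair_mult t s \<in> bilinear_span A B" and "conv pair_mult s t \<in> bilinear_span A B"
proof -
  let ?S = "bilinear_span A B"
  have sub: "0 \<in> ?S" "\<And>x y. x \<in> ?S \<Longrightarrow> y \<in> ?S \<Longrightarrow> x + y \<in> ?S" "\<And>c x. x \<in> ?S \<Longrightarrow> scale c x \<in> ?S"
    "bilinear_relators A B \<subseteq> ?S"
    unfolding bilinear_span_def
    by (auto intro: scale_module.span_zero scale_module.span_add scale_module.span_scale
        scale_module.span_base)
  have 1: "conv pair_mult t r \<in> ?S" "conv pair_mult r t \<in> ?S" if "r \<in> bilinear_relators A B" for r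
    using t
  proof (induction rule: fsupp_induct)
    case (add p c t)
    { case 1 then show ?case
        using add relators_mult(1)[OF that add(1), of c] sub by (auto simp: conv_add_left) }
    { case 2 then show ?case
        using add relators_mult(2)[OF that add(1), of c] sub by (auto simp: conv_add_right) }
  qed (simp_all add: sub)
  from s show "conv pair_mult t s \<in> ?S"
    unfolding bilinear_span_def
    by (rule scale_module.span_induct)
       (use 1 sub in \<open>auto simp: scale_module.subspace_def conv_add_right conv_scale bilinear_span_def[symmetric]\<close>)
  from s show "conv pair_mult s t \<in> ?S"
    unfolding bilinear_span_def
    by (rule scale_module.span_induct)
       (use 1 sub in \<open>auto simp: scale_module.subspace_def conv_add_left conv_scale bilinear_span_def[symmetric]\<close>)
qed

lemma tensor_ideal: "alg_ideal (free_tensor A B) (bilinear_span A B)"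
proof -
  interpret F: k_algebra "free_tensor A B" by (rule k_algebra_free_tensor)
  have "ideal (bilinear_span A B) (free_tensor A B)"
  proof (rule idealI[OF F.ring_axioms])
    show "subgroup (bilinear_span A B) (add_monoid (free_tensor A B))"
    proof (rule group.subgroupI[OF F.add.is_group])
      show "bilinear_span A B \<subseteq> carrier (add_monoid (free_tensor A B))"
        using span_closed by (simp add: free_tensor_simps)
      show "bilinear_span A B \<noteq> {}"
        unfolding bilinear_span_def using scale_module.span_zero by blast
    next
      fix a assume a: "a \<in> bilinear_span A B"
      then have a': "a \<in> carrier (free_tensor A B)" using span_closed by (auto simp: free_tensor_simps)
      have "scale (-1) a \<in> bilinear_span A B"
        using a unfolding bilinear_span_def by (rule scale_module.span_scale)
      then show "inv\<^bsub>add_monoid (free_tensor A B)\<^esub> a \<in> bilinear_span A B"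
        using F.scal_minus_one[OF a'] by (simp add: free_tensor_simps a_inv_def)
    next
      fix a b assume "a \<in> bilinear_span A B" "b \<in> bilinear_span A B"
      then show "a \<otimes>\<^bsub>add_monoid (free_tensor A B)\<^esub> b \<in> bilinear_span A B"
        unfolding bilinear_span_def by (simp add: free_tensor_simps scale_module.span_add)
    qed
  qed (simp_all add: free_tensor_simps span_ideal_mult)
  then show ?thesis
    by (simp add: alg_ideal_def F.k_algebra_axioms)
qed

sublocale T: alg_ideal "free_tensor A B" "bilinear_span A B"
  by (rule tensor_ideal)

lemma k_algebra_tensor: "k_algebra (A \<boxtimes> B)"
  unfolding tensor_def by (rule T.quot_k_algebra)

sublocale AB: k_algebra "A \<boxtimes> B"
  by (rule k_algebra_tensor)

lemma ptensor_closed [simp]: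
  "a \<in> carrier A \<Longrightarrow> b \<in> carrier B \<Longrightarrow> ptensor A B a b \<in> carrier (A \<boxtimes> B)"
  by (simp add: tensor_def ptensor_def T.quot_simps free_tensor_simps)

lemma proj_diff_zero:
  assumes "s - t \<in> bilinear_relators A B"
    and "s \<in> fsupp (carrier A \<times> carrier B)" "t \<in> fsupp (carrier A \<times> carrier B)"
  shows "T.proj s = T.proj t"
proof -
  have "s \<ominus>\<^bsub>free_tensor A B\<^esub> t = s - t"
  proof -
    have "\<ominus>\<^bsub>free_tensor A B\<^esub> t = - t"
      by (rule T.F.minus_equality)
         (use assms(3) fsupp_diff[of 0 _ t] in \<open>auto simp: free_tensor_simps\<close>)
    then show ?thesis by (simp add: a_minus_def free_tensor_simps)
  qed
  moreover have "s - t \<in> bilinear_span A B"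
    using assms(1) unfolding bilinear_span_def by (rule scale_module.span_base)
  ultimately show ?thesis
    using assms by (simp add: T.proj_eq_iff free_tensor_simps)
qed

lemma ptensor_add_left:
  assumes "a \<in> carrier A" "a' \<in> carrier A" "b \<in> carrier B"
  shows "ptensor A B (a \<oplus>\<^bsub>A\<^esub> a') b = ptensor A B a b \<oplus>\<^bsub>A \<boxtimes> B\<^esub> ptensor A B a' b"
proof -
  let ?s = "Poly_Mapping.single"
  have "T.proj (?s (a \<oplus>\<^bsub>A\<^esub> a', b) 1) = T.proj (?s (a, b) 1 + ?s (a', b) 1)"
    using assms unfolding bilinear_relators_def
    by (intro proj_diff_zero) (auto simp: algebra_simps bilinear_relators_def intro!: fsupp_add)
  then show ?thesis
    using assms by (simp add: ptensor_def tensor_def T.quot_add free_tensor_simps)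
qed

lemma ptensor_add_right:
  assumes "a \<in> carrier A" "b \<in> carrier B" "b' \<in> carrier B"
  shows "ptensor A B a (b \<oplus>\<^bsub>B\<^esub> b') = ptensor A B a b \<oplus>\<^bsub>A \<boxtimes> B\<^esub> ptensor A B a b'"
proof -
  let ?s = "Poly_Mapping.single"
  have "?s (a, b \<oplus>\<^bsub>B\<^esub> b') 1 - (?s (a, b) 1 + ?s (a, b') 1) \<in> bilinear_relators A B"
    using assms unfolding bilinear_relators_def diff_diff_eq[symmetric] by blast
  then have "T.proj (?s (a, b \<oplus>\<^bsub>B\<^esub> b') 1) = T.proj (?s (a, b) 1 + ?s (a, b') 1)"
    using assms by (intro proj_diff_zero) (auto intro!: fsupp_add)
  then show ?thesis
    using assms by (simp add: ptensor_def tensor_def T.quot_add free_tensor_simps)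
qed

lemma proj_single:
  assumes "a \<in> carrier A" "b \<in> carrier B"
  shows "T.proj (Poly_Mapping.single (a, b) c) = c \<odot>\<^bsub>A \<boxtimes> B\<^esub> ptensor A B a b"
  using assms by (simp add: ptensor_def tensor_def T.quot_scal free_tensor_simps)

lemma ptensor_smult_left:
  assumes "a \<in> carrier A" "b \<in> carrier B"
  shows "ptensor A B (c \<odot>\<^bsub>A\<^esub> a) b = c \<odot>\<^bsub>A \<boxtimes> B\<^esub> ptensor A B a b"
proof -
  let ?s = "Poly_Mapping.single"
  have "?s (c \<odot>\<^bsub>A\<^esub> a, b) 1 - ?s (a, b) c \<in> bilinear_relators A B"
    using assms unfolding bilinear_relators_def by blast
  then have "T.proj (?s (c \<odot>\<^bsub>A\<^esub> a, b) 1) = T.proj (?s (a, b) c)"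
    using assms by (intro proj_diff_zero) auto
  then show ?thesis
    using assms by (simp add: proj_single)
qed

lemma ptensor_smult_right:
  assumes "a \<in> carrier A" "b \<in> carrier B"
  shows "ptensor A B a (c \<odot>\<^bsub>B\<^esub> b) = c \<odot>\<^bsub>A \<boxtimes> B\<^esub> ptensor A B a b"
proof -
  let ?s = "Poly_Mapping.single"
  have "?s (a, c \<odot>\<^bsub>B\<^esub> b) 1 - ?s (a, b) c \<in> bilinear_relators A B"
    using assms unfolding bilinear_relators_def by blast
  then have "T.proj (?s (a, c \<odot>\<^bsub>B\<^esub> b) 1) = T.proj (?s (a, b) c)"
    using assms by (intro proj_diff_zero) auto
  then show ?thesis
    using assms by (simp add: proj_single)
qed

lemma ptensor_mult:
  assumes "a \<in> carrier A" "b \<in> carrier B" "a' \<in> carrier A" "b' \<in> carrier B"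
  shows "ptensor A B a b \<otimes>\<^bsub>A \<boxtimes> B\<^esub> ptensor A B a' b' = ptensor A B (a \<otimes>\<^bsub>A\<^esub> a') (b \<otimes>\<^bsub>B\<^esub> b')"
  using assms by (simp add: ptensor_def tensor_def T.quot_mult free_tensor_simps)

lemma tensor_one: "\<one>\<^bsub>A \<boxtimes> B\<^esub> = ptensor A B \<one>\<^bsub>A\<^esub> \<one>\<^bsub>B\<^esub>"
  by (simp add: ptensor_def tensor_def T.quot_simps free_tensor_simps)

lemma ptensor_pow:
  assumes "a \<in> carrier A" "b \<in> carrier B"
  shows "ptensor A B a b [^]\<^bsub>A \<boxtimes> B\<^esub> (k::nat) = ptensor A B (a [^]\<^bsub>A\<^esub> k) (b [^]\<^bsub>B\<^esub> k)"
  by (induction k) (use assms in \<open>simp_all add: tensor_one ptensor_mult\<close>)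

lemma lin_map_ptensor_left: "b \<in> carrier B \<Longrightarrow> (\<lambda>a. ptensor A B a b) \<in> lin_map A (A \<boxtimes> B)"
  by (rule lin_mapI) (auto simp: ptensor_add_left ptensor_smult_left)

lemma lin_map_ptensor_right: "a \<in> carrier A \<Longrightarrow> (\<lambda>b. ptensor A B a b) \<in> lin_map B (A \<boxtimes> B)"
  by (rule lin_mapI) (auto simp: ptensor_add_right ptensor_smult_right)

lemma tensor_spanning:
  "spanning (A \<boxtimes> B) ((\<lambda>(a, b). ptensor A B a b) ` (carrier A \<times> carrier B))"
proof -
  interpret free_space "free_tensor A B" "carrier A \<times> carrier B" by (rule free_space)
  have "(\<lambda>(a, b). ptensor A B a b) ` (carrier A \<times> carrier B)
      = T.proj ` ((\<lambda>p. Poly_Mapping.single p 1) ` (carrier A \<times> carrier B))"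
    by (auto simp: ptensor_def image_image intro!: image_cong)
  then show ?thesis
    unfolding tensor_def using T.quot_spanning[OF free_spanning] by simp
qed

lemma tensor_lin_map_eqI:
  assumes "k_algebra M" "f \<in> lin_map (A \<boxtimes> B) M" "g \<in> lin_map (A \<boxtimes> B) M"
    and "\<And>a b. a \<in> carrier A \<Longrightarrow> b \<in> carrier B \<Longrightarrow> f (ptensor A B a b) = g (ptensor A B a b)"
    and "t \<in> carrier (A \<boxtimes> B)"
  shows "f t = g t"
  by (rule lin_map_eq_on_spanning[OF k_algebra_tensor assms(1) tensor_spanning assms(2,3) _ assms(5)])
     (use assms(4) in auto)

context
  fixes M :: "('k, 'c) module" and \<beta>
  assumes M: "k_algebra M" and \<beta>: "bilin A B M \<beta>"
begin

private abbreviation ext where "ext \<equiv> lin_ext M (\<lambda>p. \<beta> (fst p) (snd p))"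

interpretation M: k_algebra M by (rule M)

private lemma bilin_closed: "a \<in> carrier A \<Longrightarrow> b \<in> carrier B \<Longrightarrow> \<beta> a b \<in> carrier M"
  using \<beta> by (auto simp: bilin_def intro: lin_map_closed)

private lemma ext_lin: "ext \<in> lin_map (free_tensor A B) M"
proof -
  interpret free_space "free_tensor A B" "carrier A \<times> carrier B" by (rule free_space)
  show ?thesis
    by (rule lin_ext_lin_map) (auto simp: M bilin_closed)
qed

private lemma ext_zero_on_relators:
  assumes "r \<in> bilinear_relators A B"
  shows "ext r = \<zero>\<^bsub>M\<^esub>"
proof -
  have L: "(\<lambda>a. \<beta> a b) \<in> lin_map A M" if "b \<in> carrier B" for b
    using \<beta> that by (simp add: bilin_def)
  have R: "\<beta> a \<in> lin_map B M" if "a \<in> carrier A" for a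
    using \<beta> that by (simp add: bilin_def)
  have eq: "s - t \<in> fsupp (carrier A \<times> carrier B) \<Longrightarrow> t \<in> fsupp (carrier A \<times> carrier B) \<Longrightarrow>
      ext s = ext (s - t) \<oplus>\<^bsub>M\<^esub> ext t" for s t
    using lin_map_add[OF ext_lin, of "s - t" t] by (simp add: free_tensor_simps)
  have diff: "ext (s - t) = ext s \<ominus>\<^bsub>M\<^esub> ext t"
    if "s \<in> fsupp (carrier A \<times> carrier B)" "t \<in> fsupp (carrier A \<times> carrier B)" for s t
  proof -
    have c: "ext (s - t) \<in> carrier M" "ext t \<in> carrier M"
      using lin_map_closed[OF ext_lin] that by (auto simp: free_tensor_simps fsupp_diff)
    then have "(ext (s - t) \<oplus>\<^bsub>M\<^esub> ext t) \<ominus>\<^bsub>M\<^esub> ext t = ext (s - t)"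
      by (simp add: a_minus_def M.a_assoc M.r_neg)
    then show ?thesis using eq[of s t] that by (simp add: fsupp_diff)
  qed
  have cancel: "(x \<oplus>\<^bsub>M\<^esub> y) \<ominus>\<^bsub>M\<^esub> x \<ominus>\<^bsub>M\<^esub> y = \<zero>\<^bsub>M\<^esub>" if "x \<in> carrier M" "y \<in> carrier M" for x y
  proof -
    have "(x \<oplus>\<^bsub>M\<^esub> y) \<ominus>\<^bsub>M\<^esub> x \<ominus>\<^bsub>M\<^esub> y = (x \<oplus>\<^bsub>M\<^esub> y) \<oplus>\<^bsub>M\<^esub> \<ominus>\<^bsub>M\<^esub> (x \<oplus>\<^bsub>M\<^esub> y)"
      using that by (simp add: a_minus_def M.minus_add M.a_assoc)
    then show ?thesis using that by (simp add: M.r_neg)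
  qed
  from assms show ?thesis
    by (cases rule: bilinear_relators_cases)
       (simp_all add: diff fsupp_diff bilin_closed lin_map_add[OF L] lin_map_add[OF R]
          lin_map_smult[OF L] lin_map_smult[OF R] cancel M.diff_eq_zero_iff)
qed

private lemma ext_zero_on_span: "r \<in> bilinear_span A B \<Longrightarrow> ext r = \<zero>\<^bsub>M\<^esub>"
proof -
  assume r: "r \<in> bilinear_span A B"
  let ?K = "{t \<in> fsupp (carrier A \<times> carrier B). ext t = \<zero>\<^bsub>M\<^esub>}"
  have "bilinear_span A B \<subseteq> ?K"
    unfolding bilinear_span_def
  proof (intro scale_module.span_minimal scale_module.subspaceI)
    show "bilinear_relators A B \<subseteq> ?K" using relators_closed ext_zero_on_relators by blast
    show "0 \<in> ?K" by (simp add: lin_ext_def)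
    show "x + y \<in> ?K" if "x \<in> ?K" "y \<in> ?K" for x y
      using that lin_map_add[OF ext_lin, of x y] by (simp add: free_tensor_simps fsupp_add)
    show "scale c x \<in> ?K" if "x \<in> ?K" for x c
      using that lin_map_smult[OF ext_lin, of x c] by (simp add: free_tensor_simps fsupp_scale)
  qed
  with r show ?thesis by blast
qed

private lemma tensor_lift_proj:
  "s \<in> fsupp (carrier A \<times> carrier B) \<Longrightarrow> tensor_lift M \<beta> (T.proj s) = ext s"
  using T.quot_the_value[OF M ext_lin ext_zero_on_span, of s]
  by (simp add: tensor_lift_def lin_ext_def free_tensor_simps)

lemma tensor_lift_lin: "tensor_lift M \<beta> \<in> lin_map (A \<boxtimes> B) M"
  unfolding tensor_def
  by (rule T.quot_lin_mapI[OF ext_lin]) (simp add: tensor_lift_proj free_tensor_simps)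

lemma tensor_lift_ptensor:
  "a \<in> carrier A \<Longrightarrow> b \<in> carrier B \<Longrightarrow> tensor_lift M \<beta> (ptensor A B a b) = \<beta> a b"
  by (simp add: ptensor_def tensor_lift_proj M.lin_ext_single bilin_closed)

lemma tensor_lift_alg_hom:
  assumes "\<And>a b a' b'. a \<in> carrier A \<Longrightarrow> b \<in> carrier B \<Longrightarrow> a' \<in> carrier A \<Longrightarrow> b' \<in> carrier B \<Longrightarrow>
      \<beta> (a \<otimes>\<^bsub>A\<^esub> a') (b \<otimes>\<^bsub>B\<^esub> b') = \<beta> a b \<otimes>\<^bsub>M\<^esub> \<beta> a' b'"
    and "\<beta> \<one>\<^bsub>A\<^esub> \<one>\<^bsub>B\<^esub> = \<one>\<^bsub>M\<^esub>"
  shows "tensor_lift M \<beta> \<in> alg_hom (A \<boxtimes> B) M"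
  by (rule alg_homI_spanning[OF k_algebra_tensor M tensor_spanning tensor_lift_lin])
     (auto simp: ptensor_mult tensor_one tensor_lift_ptensor assms)

end

end

lemmas k_algebra_tensor [simp] = alg_pair.k_algebra_tensor[OF alg_pair.intro]
  and ptensor_closed [simp] = alg_pair.ptensor_closed[OF alg_pair.intro]
  and ptensor_add_left = alg_pair.ptensor_add_left[OF alg_pair.intro]
  and ptensor_add_right = alg_pair.ptensor_add_right[OF alg_pair.intro]
  and ptensor_smult_left = alg_pair.ptensor_smult_left[OF alg_pair.intro]
  and ptensor_smult_right = alg_pair.ptensor_smult_right[OF alg_pair.intro]
  and ptensor_mult = alg_pair.ptensor_mult[OF alg_pair.intro]
  and ptensor_pow = alg_pair.ptensor_pow[OF alg_pair.intro]
  and tensor_one = alg_pair.tensor_one[OF alg_pair.intro]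
  and lin_map_ptensor_left = alg_pair.lin_map_ptensor_left[OF alg_pair.intro]
  and lin_map_ptensor_right = alg_pair.lin_map_ptensor_right[OF alg_pair.intro]
  and tensor_spanning = alg_pair.tensor_spanning[OF alg_pair.intro]
  and tensor_lin_map_eqI = alg_pair.tensor_lin_map_eqI[OF alg_pair.intro]
  and tensor_lift_lin = alg_pair.tensor_lift_lin[OF alg_pair.intro]
  and tensor_lift_ptensor = alg_pair.tensor_lift_ptensor[OF alg_pair.intro]
  and tensor_lift_alg_hom = alg_pair.tensor_lift_alg_hom[OF alg_pair.intro]

lemma bilin_ptensor:
  assumes "k_algebra A'" "k_algebra B'" "f \<in> lin_map A A'" "g \<in> lin_map B B'"
  shows "bilin A B (A' \<boxtimes> B') (\<lambda>a b. ptensor A' B' (f a) (g b))"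
  by (rule bilinI)
     (use assms in \<open>auto intro: lin_map_comp[OF _ lin_map_ptensor_left]
        lin_map_comp[OF _ lin_map_ptensor_right] lin_map_closed\<close>)

text \<open>Allows the comparison of maps on iterated tensor products on nested pure tensors.\<close>

lemma spanning_tensor:
  assumes A: "k_algebra A" and B: "k_algebra B" and T: "spanning A T" "spanning B U"
  shows "spanning (A \<boxtimes> B) ((\<lambda>(a, b). ptensor A B a b) ` (T \<times> U))"
proof -
  let ?T = "(\<lambda>(a, b). ptensor A B a b) ` (T \<times> U)"
  interpret A: k_algebra A by fact
  interpret B: k_algebra B by fact
  interpret AB: k_algebra "A \<boxtimes> B" using A B by (rule k_algebra_tensor)
  have sub: "T \<subseteq> carrier A" "U \<subseteq> carrier B" using T by (auto simp: spanning_def)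
  have 1: "ptensor A B a b \<in> lspan (A \<boxtimes> B) ?T" if a: "a \<in> T" and b: "b \<in> carrier B" for a b
    using B T(2) b
  proof (induction rule: spanning_induct)
    case zero
    have "ptensor A B a \<zero>\<^bsub>B\<^esub> = \<zero>\<^bsub>A \<boxtimes> B\<^esub>"
      using a sub by (intro lin_map_zero[OF B AB.k_algebra_axioms lin_map_ptensor_right[OF A B]]) auto
    then show ?case by (simp add: lspan.zero)
  qed (use a sub A B in \<open>auto intro: lspan.base lspan.add lspan.smult
        simp: ptensor_add_right ptensor_smult_right subset_iff\<close>)
  have 2: "ptensor A B a b \<in> lspan (A \<boxtimes> B) ?T" if a: "a \<in> carrier A" and b: "b \<in> carrier B" for a b
    using A T(1) a
  proof (induction rule: spanning_induct)
    case zero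
    have "ptensor A B \<zero>\<^bsub>A\<^esub> b = \<zero>\<^bsub>A \<boxtimes> B\<^esub>"
      by (rule lin_map_zero[OF A AB.k_algebra_axioms lin_map_ptensor_left[OF A B b]])
    then show ?case by (simp add: lspan.zero)
  qed (use 1 b A B in \<open>auto intro: lspan.add lspan.smult
        simp: ptensor_add_left ptensor_smult_left\<close>)
  have 3: "t \<in> lspan (A \<boxtimes> B) ?T" if "t \<in> carrier (A \<boxtimes> B)" for t
    using AB.k_algebra_axioms tensor_spanning[OF A B] that
    by (induction rule: spanning_induct) (use 2 in \<open>auto intro: lspan.intros\<close>)
  have "?T \<subseteq> carrier (A \<boxtimes> B)" using sub A B by (auto simp: subset_iff)
  with 3 show ?thesis by (auto simp: spanning_def)
qed


subsection \<open>Functoriality and associativity\<close>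

context
  fixes A :: "('k::field, 'a) module" and B :: "('k, 'b) module"
    and A' :: "('k, 'c) module" and B' :: "('k, 'd) module" and f g
  assumes alg: "k_algebra A" "k_algebra B" "k_algebra A'" "k_algebra B'"
    and fg: "f \<in> lin_map A A'" "g \<in> lin_map B B'"
begin

lemma tensor_map_lin: "tensor_map A' B' f g \<in> lin_map (A \<boxtimes> B) (A' \<boxtimes> B')"
  unfolding tensor_map_def using alg fg by (intro tensor_lift_lin bilin_ptensor) auto

lemma tensor_map_ptensor:
  "a \<in> carrier A \<Longrightarrow> b \<in> carrier B \<Longrightarrow>
    tensor_map A' B' f g (ptensor A B a b) = ptensor A' B' (f a) (g b)"
  unfolding tensor_map_def using alg fg
  by (subst tensor_lift_ptensor) (auto intro: bilin_ptensor)

end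

lemma tensor_map_alg_hom:
  assumes "k_algebra A" "k_algebra B" "k_algebra A'" "k_algebra B'"
    and "f \<in> alg_hom A A'" "g \<in> alg_hom B B'"
  shows "tensor_map A' B' f g \<in> alg_hom (A \<boxtimes> B) (A' \<boxtimes> B')"
  unfolding tensor_map_def using assms
  by (intro tensor_lift_alg_hom bilin_ptensor alg_hom_lin)
     (auto simp: alg_hom_mult alg_hom_one ptensor_mult tensor_one alg_hom_closed)

context
  fixes A :: "('k::field, 'a) module" and B :: "('k, 'b) module" and C :: "('k, 'c) module"
  assumes alg: "k_algebra A" "k_algebra B" "k_algebra C"
begin

text \<open>The re-association map is a lift of lifts: for fixed \<open>c\<close> the inner one is linear in the first
  two factors, and the outer one needs it to be linear in \<open>c\<close> as well.\<close>

private abbreviation assoc_at where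
  "assoc_at c \<equiv> tensor_lift (A \<boxtimes> (B \<boxtimes> C)) (\<lambda>a b. ptensor A (B \<boxtimes> C) a (ptensor B C b c))"

interpretation ABC: k_algebra "A \<boxtimes> (B \<boxtimes> C)" using alg by simp

private lemma bilin_inner:
  "c \<in> carrier C \<Longrightarrow> bilin A B (A \<boxtimes> (B \<boxtimes> C)) (\<lambda>a b. ptensor A (B \<boxtimes> C) a (ptensor B C b c))"
  using alg by (intro bilin_ptensor lin_map_id lin_map_ptensor_left) auto

private lemma assoc_at_ptensor:
  "a \<in> carrier A \<Longrightarrow> b \<in> carrier B \<Longrightarrow> c \<in> carrier C \<Longrightarrow>
    assoc_at c (ptensor A B a b) = ptensor A (B \<boxtimes> C) a (ptensor B C b c)"
  using alg bilin_inner by (subst tensor_lift_ptensor) auto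

private lemma assoc_at_lin: "c \<in> carrier C \<Longrightarrow> assoc_at c \<in> lin_map (A \<boxtimes> B) (A \<boxtimes> (B \<boxtimes> C))"
  using alg bilin_inner by (intro tensor_lift_lin) auto

private lemma bilin_outer: "bilin (A \<boxtimes> B) C (A \<boxtimes> (B \<boxtimes> C)) (\<lambda>t c. assoc_at c t)"
proof (rule bilinI)
  interpret C: k_algebra C by (rule alg)
  fix t assume t: "t \<in> carrier (A \<boxtimes> B)"
  show "(\<lambda>c. assoc_at c t) \<in> lin_map C (A \<boxtimes> (B \<boxtimes> C))"
  proof (rule lin_mapI)
    fix c d assume c: "c \<in> carrier C"
    show "assoc_at c t \<in> carrier (A \<boxtimes> (B \<boxtimes> C))"
      using assoc_at_lin[OF c] t by (rule lin_map_closed)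
    show "assoc_at (k \<odot>\<^bsub>C\<^esub> c) t = k \<odot>\<^bsub>A \<boxtimes> (B \<boxtimes> C)\<^esub> assoc_at c t" for k
    proof (rule tensor_lin_map_eqI[OF alg(1,2) ABC.k_algebra_axioms _ _ _ t])
      show "assoc_at (k \<odot>\<^bsub>C\<^esub> c) \<in> lin_map (A \<boxtimes> B) (A \<boxtimes> (B \<boxtimes> C))"
        using c by (intro assoc_at_lin) auto
      show "(\<lambda>t. k \<odot>\<^bsub>A \<boxtimes> (B \<boxtimes> C)\<^esub> assoc_at c t) \<in> lin_map (A \<boxtimes> B) (A \<boxtimes> (B \<boxtimes> C))"
        using c by (intro ABC.lin_map_scal assoc_at_lin) auto
    qed (use alg c in \<open>simp add: assoc_at_ptensor ptensor_smult_right\<close>)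
    assume d: "d \<in> carrier C"
    show "assoc_at (c \<oplus>\<^bsub>C\<^esub> d) t = assoc_at c t \<oplus>\<^bsub>A \<boxtimes> (B \<boxtimes> C)\<^esub> assoc_at d t"
    proof (rule tensor_lin_map_eqI[OF alg(1,2) ABC.k_algebra_axioms _ _ _ t])
      show "assoc_at (c \<oplus>\<^bsub>C\<^esub> d) \<in> lin_map (A \<boxtimes> B) (A \<boxtimes> (B \<boxtimes> C))"
        using c d by (intro assoc_at_lin) auto
      show "(\<lambda>t. assoc_at c t \<oplus>\<^bsub>A \<boxtimes> (B \<boxtimes> C)\<^esub> assoc_at d t) \<in> lin_map (A \<boxtimes> B) (A \<boxtimes> (B \<boxtimes> C))"
        using c d by (intro ABC.lin_map_plus assoc_at_lin) auto
    qed (use alg c d in \<open>simp add: assoc_at_ptensor ptensor_add_right\<close>)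
  qed
qed (rule assoc_at_lin)

lemma tensor_assoc_lin: "tensor_assoc A B C \<in> lin_map ((A \<boxtimes> B) \<boxtimes> C) (A \<boxtimes> (B \<boxtimes> C))"
  unfolding tensor_assoc_def using alg bilin_outer by (intro tensor_lift_lin) auto

lemma tensor_assoc_ptensor:
  "a \<in> carrier A \<Longrightarrow> b \<in> carrier B \<Longrightarrow> c \<in> carrier C \<Longrightarrow>
    tensor_assoc A B C (ptensor (A \<boxtimes> B) C (ptensor A B a b) c) = ptensor A (B \<boxtimes> C) a (ptensor B C b c)"
  unfolding tensor_assoc_def using alg bilin_outer
  by (subst tensor_lift_ptensor) (auto simp: assoc_at_ptensor)

lemma spanning_tensor_triple:
  "spanning ((A \<boxtimes> B) \<boxtimes> C)
     {ptensor (A \<boxtimes> B) C (ptensor A B a b) c |a b c. a \<in> carrier A \<and> b \<in> carrier B \<and> c \<in> carrier C}"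
proof -
  interpret C: k_algebra C by (rule alg)
  have "spanning C (carrier C)"
    by (auto simp: spanning_def intro: lspan.base)
  then have "spanning ((A \<boxtimes> B) \<boxtimes> C) ((\<lambda>(t, c). ptensor (A \<boxtimes> B) C t c) `
      ((\<lambda>(a, b). ptensor A B a b) ` (carrier A \<times> carrier B) \<times> carrier C))"
    using alg by (intro spanning_tensor tensor_spanning) auto
  moreover have "(\<lambda>(t, c). ptensor (A \<boxtimes> B) C t c) `
      ((\<lambda>(a, b). ptensor A B a b) ` (carrier A \<times> carrier B) \<times> carrier C) =
     {ptensor (A \<boxtimes> B) C (ptensor A B a b) c |a b c. a \<in> carrier A \<and> b \<in> carrier B \<and> c \<in> carrier C}"
    by (auto simp: image_iff)
  ultimately show ?thesis by simp
qed

lemma tensor_assoc_alg_hom: "tensor_assoc A B C \<in> alg_hom ((A \<boxtimes> B) \<boxtimes> C) (A \<boxtimes> (B \<boxtimes> C))"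
proof -
  interpret A: k_algebra A by (rule alg)
  interpret B: k_algebra B by (rule alg)
  interpret C: k_algebra C by (rule alg)
  show ?thesis
    by (rule alg_homI_spanning[OF _ _ spanning_tensor_triple tensor_assoc_lin])
       (use alg in \<open>auto simp: ptensor_mult tensor_one tensor_assoc_ptensor\<close>)
qed

lemma tensor_triple_eqI:
  assumes "k_algebra M" "f \<in> lin_map ((A \<boxtimes> B) \<boxtimes> C) M" "g \<in> lin_map ((A \<boxtimes> B) \<boxtimes> C) M"
    and "\<And>a b c. a \<in> carrier A \<Longrightarrow> b \<in> carrier B \<Longrightarrow> c \<in> carrier C \<Longrightarrow>
      f (ptensor (A \<boxtimes> B) C (ptensor A B a b) c) = g (ptensor (A \<boxtimes> B) C (ptensor A B a b) c)"
    and "t \<in> carrier ((A \<boxtimes> B) \<boxtimes> C)"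
  shows "f t = g t"
  by (rule lin_map_eq_on_spanning[OF _ assms(1) spanning_tensor_triple assms(2,3) _ assms(5)])
     (use alg assms(4) in auto)

end

section \<open>Cogroupoids and bi-Galois objects\<close>

lemma scalars_simps [simp]:
  "carrier scalars = UNIV" "x \<oplus>\<^bsub>scalars\<^esub> y = x + y" "x \<otimes>\<^bsub>scalars\<^esub> y = x * y"
  "\<zero>\<^bsub>scalars\<^esub> = 0" "\<one>\<^bsub>scalars\<^esub> = 1" "c \<odot>\<^bsub>scalars\<^esub> x = c * x"
  by (simp_all add: scalars_def ring.defs module.defs class_ring_def)

lemma k_algebra_scalars [simp]: "k_algebra (scalars :: ('k::field, 'k) module)"
proof (rule k_algebraI)
  show "ring (scalars :: ('k, 'k) module)"
  proof (rule ringI)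
    show "abelian_group (scalars :: ('k, 'k) module)"
      by (rule abelian_groupI) (auto simp: add_ac intro: exI[of _ "- _"])
    show "Group.monoid (scalars :: ('k, 'k) module)"
      by (rule monoidI) (auto simp: mult.assoc)
  qed (auto simp: distrib_left distrib_right)
qed (simp_all add: algebra_simps)

lemma bilin_mult:
  assumes "k_algebra M" "f \<in> lin_map A M" "g \<in> lin_map B M"
  shows "bilin A B M (\<lambda>a b. f a \<otimes>\<^bsub>M\<^esub> g b)"
proof -
  interpret M: k_algebra M by fact
  show ?thesis
    by (rule bilinI)
       (use assms in \<open>auto intro: lin_map_comp[OF _ M.lin_map_left_mult]
          lin_map_comp[OF _ M.lin_map_right_mult] lin_map_closed\<close>)
qed

lemma bilin_scal_left:
  assumes "k_algebra M" "f \<in> lin_map A scalars" "g \<in> lin_map B M"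
  shows "bilin A B M (\<lambda>a b. f a \<odot>\<^bsub>M\<^esub> g b)"
proof -
  interpret M: k_algebra M by fact
  show ?thesis
    by (intro bilinI lin_mapI)
       (simp_all add: lin_map_closed[OF assms(3)] lin_map_add[OF assms(2)] lin_map_add[OF assms(3)]
          lin_map_smult[OF assms(2)] lin_map_smult[OF assms(3)] M.scal_add_left M.scal_add_right
          mult.commute)
qed

lemma bilin_scal_right:
  assumes "k_algebra M" "f \<in> lin_map A M" "g \<in> lin_map B scalars"
  shows "bilin A B M (\<lambda>a b. g b \<odot>\<^bsub>M\<^esub> f a)"
proof -
  interpret M: k_algebra M by fact
  show ?thesis
    by (intro bilinI lin_mapI)
       (simp_all add: lin_map_closed[OF assms(2)] lin_map_add[OF assms(2)] lin_map_add[OF assms(3)]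
          lin_map_smult[OF assms(2)] lin_map_smult[OF assms(3)] M.scal_add_left M.scal_add_right
          mult.commute)
qed

text \<open>The Galois maps, their inverses and the two sides of the antipode axioms all have this
  shape.\<close>

abbreviation mult_lift :: "('k::field, 'c) module \<Rightarrow> ('a \<Rightarrow> 'c) \<Rightarrow> ('b \<Rightarrow> 'c) \<Rightarrow>
    (('a \<times> 'b) \<Rightarrow>\<^sub>0 'k) set \<Rightarrow> 'c" where
  "mult_lift M f g \<equiv> tensor_lift M (\<lambda>a b. f a \<otimes>\<^bsub>M\<^esub> g b)"

context
  fixes A :: "('k::field, 'a) module" and B :: "('k, 'b) module" and M :: "('k, 'c) module" and f g
  assumes alg: "k_algebra A" "k_algebra B" "k_algebra M"
    and fg: "f \<in> lin_map A M" "g \<in> lin_map B M"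
begin

lemma mult_lift_lin: "mult_lift M f g \<in> lin_map (A \<boxtimes> B) M"
  using alg fg by (intro tensor_lift_lin bilin_mult)

lemma mult_lift_ptensor:
  "a \<in> carrier A \<Longrightarrow> b \<in> carrier B \<Longrightarrow> mult_lift M f g (ptensor A B a b) = f a \<otimes>\<^bsub>M\<^esub> g b"
  using alg fg by (intro tensor_lift_ptensor bilin_mult)

text \<open>If \<open>f\<close> intertwines left multiplication by \<open>a\<close> with left multiplication by \<open>h\<close>, so does the
  combined map. With this, composing a Galois map with its inverse reduces to elements \<open>1 \<otimes> a\<close>.\<close>

lemma mult_lift_left:
  assumes "a \<in> carrier A" "t \<in> carrier (A \<boxtimes> B)"
    and "\<And>x. x \<in> carrier A \<Longrightarrow> f (a \<otimes>\<^bsub>A\<^esub> x) = h \<otimes>\<^bsub>M\<^esub> f x" and "h \<in> carrier M"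
  shows "mult_lift M f g (ptensor A B a \<one>\<^bsub>B\<^esub> \<otimes>\<^bsub>A \<boxtimes> B\<^esub> t) = h \<otimes>\<^bsub>M\<^esub> mult_lift M f g t"
proof -
  interpret A: k_algebra A by (rule alg)
  interpret B: k_algebra B by (rule alg)
  interpret M: k_algebra M by (rule alg)
  interpret AB: k_algebra "A \<boxtimes> B" using alg by simp
  show ?thesis
  proof (rule tensor_lin_map_eqI[OF alg _ _ _ assms(2)])
    show "(\<lambda>t. mult_lift M f g (ptensor A B a \<one>\<^bsub>B\<^esub> \<otimes>\<^bsub>A \<boxtimes> B\<^esub> t)) \<in> lin_map (A \<boxtimes> B) M"
      using alg assms by (intro lin_map_comp[OF AB.lin_map_left_mult mult_lift_lin]) auto
    show "(\<lambda>t. h \<otimes>\<^bsub>M\<^esub> mult_lift M f g t) \<in> lin_map (A \<boxtimes> B) M"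
      using assms by (intro lin_map_comp[OF mult_lift_lin M.lin_map_left_mult])
  qed (use alg assms fg in \<open>simp add: ptensor_mult mult_lift_ptensor M.m_assoc lin_map_closed\<close>)
qed

lemma mult_lift_right:
  assumes "b \<in> carrier B" "t \<in> carrier (A \<boxtimes> B)"
    and "\<And>y. y \<in> carrier B \<Longrightarrow> g (y \<otimes>\<^bsub>B\<^esub> b) = g y \<otimes>\<^bsub>M\<^esub> h" and "h \<in> carrier M"
  shows "mult_lift M f g (t \<otimes>\<^bsub>A \<boxtimes> B\<^esub> ptensor A B \<one>\<^bsub>A\<^esub> b) = mult_lift M f g t \<otimes>\<^bsub>M\<^esub> h"
proof -
  interpret A: k_algebra A by (rule alg)
  interpret B: k_algebra B by (rule alg)
  interpret M: k_algebra M by (rule alg)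
  interpret AB: k_algebra "A \<boxtimes> B" using alg by simp
  show ?thesis
  proof (rule tensor_lin_map_eqI[OF alg _ _ _ assms(2)])
    show "(\<lambda>t. mult_lift M f g (t \<otimes>\<^bsub>A \<boxtimes> B\<^esub> ptensor A B \<one>\<^bsub>A\<^esub> b)) \<in> lin_map (A \<boxtimes> B) M"
      using alg assms by (intro lin_map_comp[OF AB.lin_map_right_mult mult_lift_lin]) auto
    show "(\<lambda>t. mult_lift M f g t \<otimes>\<^bsub>M\<^esub> h) \<in> lin_map (A \<boxtimes> B) M"
      using assms by (intro lin_map_comp[OF mult_lift_lin M.lin_map_right_mult])
  qed (use alg assms fg in \<open>simp add: ptensor_mult mult_lift_ptensor M.m_assoc lin_map_closed\<close>)
qed

end

lemma bij_betw_lin_inverse: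
  assumes V: "k_algebra A" "k_algebra B" and W: "k_algebra A'" "k_algebra B'"
    and f: "f \<in> lin_map (A \<boxtimes> B) (A' \<boxtimes> B')" and g: "g \<in> lin_map (A' \<boxtimes> B') (A \<boxtimes> B)"
    and gf: "\<And>a b. a \<in> carrier A \<Longrightarrow> b \<in> carrier B \<Longrightarrow> g (f (ptensor A B a b)) = ptensor A B a b"
    and fg: "\<And>a b. a \<in> carrier A' \<Longrightarrow> b \<in> carrier B' \<Longrightarrow> f (g (ptensor A' B' a b)) = ptensor A' B' a b"
  shows "bij_betw f (carrier (A \<boxtimes> B)) (carrier (A' \<boxtimes> B'))"
proof (rule bij_betw_byWitness[where f' = g])
  show "\<forall>t\<in>carrier (A \<boxtimes> B). g (f t) = t"
    using tensor_lin_map_eqI[OF V _ lin_map_comp[OF f g] lin_map_id(1)] V gf by auto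
  show "\<forall>t\<in>carrier (A' \<boxtimes> B'). f (g t) = t"
    using tensor_lin_map_eqI[OF W _ lin_map_comp[OF g f] lin_map_id(1)] W fg by auto
qed (use lin_map_closed[OF f] lin_map_closed[OF g] in auto)

text \<open>The axioms are those of a Hopf algebra, with the comultiplication spread over several algebras:
  every \<open>E s s\<close> is a Hopf algebra, and \<open>E s t\<close> is coacted on by \<open>E s s\<close> from the left and by \<open>E t t\<close> from
  the right. In the antipode axioms the two legs of \<open>D s t s c\<close> live in different algebras, and the
  antipode moves one of them to the algebra of the other.\<close>

locale cogroupoid =
  fixes E :: "'i \<Rightarrow> 'i \<Rightarrow> ('k::field, 'a) module"
    and D :: "'i \<Rightarrow> 'i \<Rightarrow> 'i \<Rightarrow> 'a \<Rightarrow> (('a \<times> 'a) \<Rightarrow>\<^sub>0 'k) set"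
    and eps :: "'i \<Rightarrow> 'a \<Rightarrow> 'k"
    and S :: "'i \<Rightarrow> 'i \<Rightarrow> 'a \<Rightarrow> 'a"
  assumes alg [simp]: "k_algebra (E s t)"
    and D_hom: "D s r t \<in> alg_hom (E s t) (E s r \<boxtimes> E r t)"
    and D_assoc: "c \<in> carrier (E s t) \<Longrightarrow>
      tensor_assoc (E s p) (E p r) (E r t)
        (tensor_map (E s p \<boxtimes> E p r) (E r t) (D s p r) id (D s r t c)) =
      tensor_map (E s p) (E p r \<boxtimes> E r t) id (D p r t) (D s p t c)"
    and eps_hom: "eps s \<in> alg_hom (E s s) scalars"
    and eps_left: "c \<in> carrier (E s t) \<Longrightarrow>
      tensor_lift (E s t) (\<lambda>x y. eps s x \<odot>\<^bsub>E s t\<^esub> y) (D s s t c) = c"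
    and eps_right: "c \<in> carrier (E s t) \<Longrightarrow>
      tensor_lift (E s t) (\<lambda>x y. eps t y \<odot>\<^bsub>E s t\<^esub> x) (D s t t c) = c"
    and S_lin: "S s t \<in> lin_map (E s t) (E t s)"
    and S_one: "S s t \<one>\<^bsub>E s t\<^esub> = \<one>\<^bsub>E t s\<^esub>"
    and S_left: "c \<in> carrier (E s s) \<Longrightarrow>
      tensor_lift (E t s) (\<lambda>x y. S s t x \<otimes>\<^bsub>E t s\<^esub> y) (D s t s c) = eps s c \<odot>\<^bsub>E t s\<^esub> \<one>\<^bsub>E t s\<^esub>"
    and S_right: "c \<in> carrier (E s s) \<Longrightarrow>
      tensor_lift (E s t) (\<lambda>x y. x \<otimes>\<^bsub>E s t\<^esub> S t s y) (D s t s c) = eps s c \<odot>\<^bsub>E s t\<^esub> \<one>\<^bsub>E s t\<^esub>"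
begin

lemma hopf_algebra: "hopf_algebra (E s s) (D s s s) (eps s) (S s s)"
  by (intro hopf_algebra.intro hopf_algebra_axioms.intro alg D_hom D_assoc eps_hom eps_left
      eps_right S_lin S_left S_right)

lemmas D_lin = alg_hom_lin[OF D_hom]
  and eps_lin = alg_hom_lin[OF eps_hom]
  and D_closed = alg_hom_closed[OF D_hom]
  and S_closed = lin_map_closed[OF S_lin]

sublocale E: k_algebra "E s t" for s t
  by (rule alg)

lemma id_lin: "id \<in> lin_map (E s t) (E s t)"
  by (rule lin_map_id)

lemma iterated_comult_closed_left:
  "z \<in> carrier (E s t) \<Longrightarrow> tensor_map (E s p \<boxtimes> E p r) (E r t) (D s p r) id (D s r t z)
     \<in> carrier ((E s p \<boxtimes> E p r) \<boxtimes> E r t)"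
  by (rule lin_map_closed[OF tensor_map_lin[OF alg alg k_algebra_tensor alg D_lin id_lin] D_closed])
     auto

lemma translation_closed_right:
  "a \<in> carrier (E t r) \<Longrightarrow>
    tensor_map (E s t) (E s r) (S t s) id (D t s r a) \<in> carrier (E s t \<boxtimes> E s r)"
  by (rule lin_map_closed[OF tensor_map_lin[OF alg alg alg alg S_lin id_lin] D_closed])

lemma translation_closed_left:
  "c \<in> carrier (E r s) \<Longrightarrow>
    tensor_map (E r t) (E s t) id (S t s) (D r t s c) \<in> carrier (E r t \<boxtimes> E s t)"
  by (rule lin_map_closed[OF tensor_map_lin[OF alg alg alg alg id_lin S_lin] D_closed])

text \<open>In Sweedler notation: a map \<open>L\<close> that contracts \<open>c\<^sub>1 \<otimes> c\<^sub>2\<close> to \<open>\<epsilon>(c) 1\<close> contracts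
  \<open>z\<^sub>1 \<otimes> z\<^sub>2 \<otimes> z\<^sub>3\<close> to \<open>1 \<otimes> z\<close>, by the counit axiom. Every cancellation in the Galois maps is an
  instance of this or of its mirror image, with \<open>L\<close> coming from an antipode axiom.\<close>

lemma counit_contract_left:
  assumes M: "k_algebra M" and L: "L \<in> lin_map (E s p \<boxtimes> E p s) M"
    and eps: "\<And>c. c \<in> carrier (E s s) \<Longrightarrow> L (D s p s c) = eps s c \<odot>\<^bsub>M\<^esub> \<one>\<^bsub>M\<^esub>"
    and z: "z \<in> carrier (E s t)"
  shows "tensor_map M (E s t) L id
      (tensor_map (E s p \<boxtimes> E p s) (E s t) (D s p s) id (D s s t z)) = ptensor M (E s t) \<one>\<^bsub>M\<^esub> z"
proof -
  interpret M: k_algebra M by fact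
  let ?e = "tensor_lift (E s t) (\<lambda>x y. eps s x \<odot>\<^bsub>E s t\<^esub> y)"
  have be: "bilin (E s s) (E s t) (E s t) (\<lambda>x y. eps s x \<odot>\<^bsub>E s t\<^esub> y)"
    using lin_map_id by (intro bilin_scal_left eps_lin alg)
  have "tensor_map M (E s t) L id (tensor_map (E s p \<boxtimes> E p s) (E s t) (D s p s) id w)
      = ptensor M (E s t) \<one>\<^bsub>M\<^esub> (?e w)" if "w \<in> carrier (E s s \<boxtimes> E s t)" for w
  proof (rule tensor_lin_map_eqI[OF alg alg k_algebra_tensor[OF M alg] _ _ _ that])
    show "(\<lambda>w. tensor_map M (E s t) L id (tensor_map (E s p \<boxtimes> E p s) (E s t) (D s p s) id w))
        \<in> lin_map (E s s \<boxtimes> E s t) (M \<boxtimes> E s t)"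
      using M L by (intro lin_map_comp[OF tensor_map_lin tensor_map_lin] D_lin id_lin) auto
    show "(\<lambda>w. ptensor M (E s t) \<one>\<^bsub>M\<^esub> (?e w)) \<in> lin_map (E s s \<boxtimes> E s t) (M \<boxtimes> E s t)"
      using M be by (intro lin_map_comp[OF tensor_lift_lin lin_map_ptensor_right]) auto
  next
    fix a b assume "a \<in> carrier (E s s)" "b \<in> carrier (E s t)"
    then show "tensor_map M (E s t) L id
         (tensor_map (E s p \<boxtimes> E p s) (E s t) (D s p s) id (ptensor (E s s) (E s t) a b)) =
        ptensor M (E s t) \<one>\<^bsub>M\<^esub> (?e (ptensor (E s s) (E s t) a b))"
      using M L be
      by (simp add: tensor_map_ptensor D_lin id_lin D_closed eps tensor_lift_ptensor
          ptensor_smult_left ptensor_smult_right)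
  qed
  then show ?thesis
    using z by (simp add: D_closed eps_left)
qed

lemma counit_contract_right:
  assumes M: "k_algebra M" and L: "L \<in> lin_map (E t p \<boxtimes> E p t) M"
    and eps: "\<And>c. c \<in> carrier (E t t) \<Longrightarrow> L (D t p t c) = eps t c \<odot>\<^bsub>M\<^esub> \<one>\<^bsub>M\<^esub>"
    and z: "z \<in> carrier (E s t)"
  shows "tensor_map (E s t) M id L
      (tensor_map (E s t) (E t p \<boxtimes> E p t) id (D t p t) (D s t t z)) = ptensor (E s t) M z \<one>\<^bsub>M\<^esub>"
proof -
  interpret M: k_algebra M by fact
  let ?e = "tensor_lift (E s t) (\<lambda>x y. eps t y \<odot>\<^bsub>E s t\<^esub> x)"
  have be: "bilin (E s t) (E t t) (E s t) (\<lambda>x y. eps t y \<odot>\<^bsub>E s t\<^esub> x)"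
    using lin_map_id by (intro bilin_scal_right eps_lin alg)
  have "tensor_map (E s t) M id L (tensor_map (E s t) (E t p \<boxtimes> E p t) id (D t p t) w)
      = ptensor (E s t) M (?e w) \<one>\<^bsub>M\<^esub>" if "w \<in> carrier (E s t \<boxtimes> E t t)" for w
  proof (rule tensor_lin_map_eqI[OF alg alg k_algebra_tensor[OF alg M] _ _ _ that])
    show "(\<lambda>w. tensor_map (E s t) M id L (tensor_map (E s t) (E t p \<boxtimes> E p t) id (D t p t) w))
        \<in> lin_map (E s t \<boxtimes> E t t) (E s t \<boxtimes> M)"
      using M L by (intro lin_map_comp[OF tensor_map_lin tensor_map_lin] D_lin id_lin) auto
    show "(\<lambda>w. ptensor (E s t) M (?e w) \<one>\<^bsub>M\<^esub>) \<in> lin_map (E s t \<boxtimes> E t t) (E s t \<boxtimes> M)"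
      using M be by (intro lin_map_comp[OF tensor_lift_lin lin_map_ptensor_left]) auto
  next
    fix a b assume "a \<in> carrier (E s t)" "b \<in> carrier (E t t)"
    then show "tensor_map (E s t) M id L
         (tensor_map (E s t) (E t p \<boxtimes> E p t) id (D t p t) (ptensor (E s t) (E t t) a b)) =
        ptensor (E s t) M (?e (ptensor (E s t) (E t t) a b)) \<one>\<^bsub>M\<^esub>"
      using M L be
      by (simp add: tensor_map_ptensor D_lin id_lin D_closed eps tensor_lift_ptensor
          ptensor_smult_left ptensor_smult_right)
  qed
  then show ?thesis
    using z by (simp add: D_closed eps_right)
qed

lemma antipode_left_lin:
  "mult_lift (E t s) (S s t) (\<lambda>y. y) \<in> lin_map (E s t \<boxtimes> E t s) (E t s)"
  by (intro mult_lift_lin alg S_lin lin_map_id)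

lemma antipode_right_lin:
  "mult_lift (E s t) (\<lambda>x. x) (S t s) \<in> lin_map (E s t \<boxtimes> E t s) (E s t)"
  by (intro mult_lift_lin alg S_lin lin_map_id)

lemma ptensor_one_right_lin: "(\<lambda>z. ptensor (E s t) (E p r) z \<one>\<^bsub>E p r\<^esub>) \<in> lin_map (E s t) (E s t \<boxtimes> E p r)"
  by (rule lin_map_ptensor_left) auto

lemma ptensor_one_left_lin: "(\<lambda>z. ptensor (E s t) (E p r) \<one>\<^bsub>E s t\<^esub> z) \<in> lin_map (E p r) (E s t \<boxtimes> E p r)"
  by (rule lin_map_ptensor_right) auto


subsection \<open>The right coaction\<close>

abbreviation right_can where
  "right_can s t \<equiv> mult_lift (E s t \<boxtimes> E t t) (\<lambda>z. ptensor (E s t) (E t t) z \<one>\<^bsub>E t t\<^esub>) (D s t t)"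

text \<open>The map \<open>z \<otimes> a \<mapsto> z S(a\<^sub>1) \<otimes> a\<^sub>2\<close>. It first applies \<open>D\<close> to the second factor and leaves the three legs
  apart, because that is the form to which coassociativity applies.\<close>

definition right_can_inv where
  "right_can_inv s t u = mult_lift (E s t \<boxtimes> E s t) (\<lambda>z. ptensor (E s t) (E s t) z \<one>\<^bsub>E s t\<^esub>)
     (tensor_map (E s t) (E s t) (S t s) id)
     (tensor_map (E s t) (E t s \<boxtimes> E s t) id (D t s t) u)"

lemma right_can_lin: "right_can s t \<in> lin_map (E s t \<boxtimes> E s t) (E s t \<boxtimes> E t t)"
  by (intro mult_lift_lin ptensor_one_right_lin D_lin) auto

lemma right_expand_lin:
  "mult_lift (E s t \<boxtimes> E s t) (\<lambda>z. ptensor (E s t) (E s t) z \<one>\<^bsub>E s t\<^esub>)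
     (tensor_map (E s t) (E s t) (S t s) id) \<in> lin_map (E s t \<boxtimes> (E t s \<boxtimes> E s t)) (E s t \<boxtimes> E s t)"
  by (intro mult_lift_lin ptensor_one_right_lin tensor_map_lin S_lin id_lin) auto

lemma right_can_inv_lin: "right_can_inv s t \<in> lin_map (E s t \<boxtimes> E t t) (E s t \<boxtimes> E s t)"
  unfolding right_can_inv_def
  by (intro lin_map_comp[OF tensor_map_lin right_expand_lin] D_lin id_lin) auto

lemma right_can_inv_ptensor:
  assumes "z \<in> carrier (E s t)" "a \<in> carrier (E t t)"
  shows "right_can_inv s t (ptensor (E s t) (E t t) z a) =
    ptensor (E s t) (E s t) z \<one>\<^bsub>E s t\<^esub> \<otimes>\<^bsub>E s t \<boxtimes> E s t\<^esub>
      tensor_map (E s t) (E s t) (S t s) id (D t s t a)"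
  using assms unfolding right_can_inv_def
  by (simp add: tensor_map_ptensor D_lin id_lin)
     (subst mult_lift_ptensor; simp add: ptensor_one_right_lin tensor_map_lin S_lin id_lin D_closed)

text \<open>In Sweedler notation, \<open>z\<^sub>1 S(z\<^sub>2) \<otimes> z\<^sub>3 = 1 \<otimes> z\<close>: coassociativity regroups the legs so that the antipode
  axiom of \<open>E s s\<close> contracts the first two.\<close>

lemma right_can_inv_coaction:
  assumes z: "z \<in> carrier (E s t)"
  shows "right_can_inv s t (D s t t z) = ptensor (E s t) (E s t) \<one>\<^bsub>E s t\<^esub> z"
proof -
  let ?X = "E s t"
  let ?w = "tensor_map (?X \<boxtimes> E t s) ?X (D s t s) id (D s s t z)"
  let ?M = "mult_lift (?X \<boxtimes> ?X) (\<lambda>z. ptensor ?X ?X z \<one>\<^bsub>?X\<^esub>) (tensor_map ?X ?X (S t s) id)"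
  let ?L = "mult_lift ?X (\<lambda>x. x) (S t s)"
  have w: "?w \<in> carrier ((?X \<boxtimes> E t s) \<boxtimes> ?X)"
    using z by (intro iterated_comult_closed_left)
  have "?M (tensor_assoc ?X (E t s) ?X u) = tensor_map ?X ?X ?L id u"
    if "u \<in> carrier ((?X \<boxtimes> E t s) \<boxtimes> ?X)" for u
  proof (rule tensor_triple_eqI[OF alg alg alg _ _ _ _ that])
    show "(\<lambda>u. ?M (tensor_assoc ?X (E t s) ?X u)) \<in> lin_map ((?X \<boxtimes> E t s) \<boxtimes> ?X) (?X \<boxtimes> ?X)"
      by (intro lin_map_comp[OF tensor_assoc_lin right_expand_lin] alg)
    show "tensor_map ?X ?X ?L id \<in> lin_map ((?X \<boxtimes> E t s) \<boxtimes> ?X) (?X \<boxtimes> ?X)"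
      by (intro tensor_map_lin antipode_right_lin id_lin) auto
  next
    fix a b c assume "a \<in> carrier ?X" "b \<in> carrier (E t s)" "c \<in> carrier ?X"
    then show "?M (tensor_assoc ?X (E t s) ?X (ptensor (?X \<boxtimes> E t s) ?X (ptensor ?X (E t s) a b) c))
        = tensor_map ?X ?X ?L id (ptensor (?X \<boxtimes> E t s) ?X (ptensor ?X (E t s) a b) c)"
      by (simp add: tensor_assoc_ptensor mult_lift_ptensor ptensor_one_right_lin tensor_map_lin
          S_lin id_lin tensor_map_ptensor S_closed ptensor_mult antipode_right_lin lin_map_id)
  qed simp
  then have "?M (tensor_assoc ?X (E t s) ?X ?w) = tensor_map ?X ?X ?L id ?w"
    using w by simp
  also have "\<dots> = ptensor ?X ?X \<one>\<^bsub>?X\<^esub> z"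
    by (intro counit_contract_left antipode_right_lin alg S_right z)
  finally show ?thesis
    using z by (simp add: right_can_inv_def D_assoc)
qed

text \<open>In Sweedler notation, \<open>S(a\<^sub>1) a\<^sub>2 \<otimes> a\<^sub>3 = 1 \<otimes> a\<close>: the coaction splits the second leg of the translated
  element, and after regrouping the antipode axiom of \<open>E t t\<close> contracts the first two legs.\<close>

lemma right_can_translation:
  assumes a: "a \<in> carrier (E t t)"
  shows "right_can s t (tensor_map (E s t) (E s t) (S t s) id (D t s t a)) =
    ptensor (E s t) (E t t) \<one>\<^bsub>E s t\<^esub> a"
proof -
  let ?X = "E s t" and ?A = "E t t"
  let ?w = "tensor_map (E t s \<boxtimes> ?X) ?A (D t s t) id (D t t t a)"
  let ?M = "mult_lift (?X \<boxtimes> ?A) (\<lambda>x. ptensor ?X ?A (S t s x) \<one>\<^bsub>?A\<^esub>) (\<lambda>u. u)"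
  let ?L = "mult_lift ?X (S t s) (\<lambda>x. x)"
  have p_lin: "(\<lambda>x. ptensor ?X ?A (S t s x) \<one>\<^bsub>?A\<^esub>) \<in> lin_map (E t s) (?X \<boxtimes> ?A)"
    by (rule lin_map_comp[OF S_lin ptensor_one_right_lin])
  have M_lin: "?M \<in> lin_map (E t s \<boxtimes> (?X \<boxtimes> ?A)) (?X \<boxtimes> ?A)"
    by (intro mult_lift_lin p_lin lin_map_id) auto
  have w: "?w \<in> carrier ((E t s \<boxtimes> ?X) \<boxtimes> ?A)"
    using a by (intro iterated_comult_closed_left)
  have "right_can s t (tensor_map ?X ?X (S t s) id u)
      = ?M (tensor_map (E t s) (?X \<boxtimes> ?A) id (D s t t) u)" if "u \<in> carrier (E t s \<boxtimes> ?X)" for u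
  proof (rule tensor_lin_map_eqI[OF alg alg _ _ _ _ that])
    show "(\<lambda>u. right_can s t (tensor_map ?X ?X (S t s) id u)) \<in> lin_map (E t s \<boxtimes> ?X) (?X \<boxtimes> ?A)"
      by (intro lin_map_comp[OF tensor_map_lin right_can_lin] alg S_lin id_lin)
    show "(\<lambda>u. ?M (tensor_map (E t s) (?X \<boxtimes> ?A) id (D s t t) u)) \<in> lin_map (E t s \<boxtimes> ?X) (?X \<boxtimes> ?A)"
      by (intro lin_map_comp[OF tensor_map_lin M_lin] D_lin id_lin) auto
  next
    fix x y assume "x \<in> carrier (E t s)" "y \<in> carrier ?X"
    then show "right_can s t (tensor_map ?X ?X (S t s) id (ptensor (E t s) ?X x y))
      = ?M (tensor_map (E t s) (?X \<boxtimes> ?A) id (D s t t) (ptensor (E t s) ?X x y))"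
      by (simp add: tensor_map_ptensor S_lin id_lin D_lin S_closed D_closed mult_lift_ptensor
          ptensor_one_right_lin p_lin lin_map_id)
  qed simp
  then have "right_can s t (tensor_map ?X ?X (S t s) id (D t s t a))
      = ?M (tensor_map (E t s) (?X \<boxtimes> ?A) id (D s t t) (D t s t a))"
    using a by (simp add: D_closed)
  also have "\<dots> = ?M (tensor_assoc (E t s) ?X ?A ?w)"
    using a by (simp add: D_assoc)
  also have "\<dots> = tensor_map ?X ?A ?L id ?w"
  proof (rule tensor_triple_eqI[OF alg alg alg _ _ _ _ w])
    show "(\<lambda>u. ?M (tensor_assoc (E t s) ?X ?A u)) \<in> lin_map ((E t s \<boxtimes> ?X) \<boxtimes> ?A) (?X \<boxtimes> ?A)"
      by (intro lin_map_comp[OF tensor_assoc_lin M_lin] alg)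
    show "tensor_map ?X ?A ?L id \<in> lin_map ((E t s \<boxtimes> ?X) \<boxtimes> ?A) (?X \<boxtimes> ?A)"
      by (intro tensor_map_lin antipode_left_lin id_lin) auto
  next
    fix x y z assume "x \<in> carrier (E t s)" "y \<in> carrier ?X" "z \<in> carrier ?A"
    then show "?M (tensor_assoc (E t s) ?X ?A (ptensor (E t s \<boxtimes> ?X) ?A (ptensor (E t s) ?X x y) z))
        = tensor_map ?X ?A ?L id (ptensor (E t s \<boxtimes> ?X) ?A (ptensor (E t s) ?X x y) z)"
      by (simp add: tensor_assoc_ptensor mult_lift_ptensor p_lin lin_map_id S_lin
          id_lin tensor_map_ptensor S_closed ptensor_mult antipode_left_lin)
  qed simp
  also have "\<dots> = ptensor ?X ?A \<one>\<^bsub>?X\<^esub> a"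
    by (intro counit_contract_left antipode_left_lin alg S_left a)
  finally show ?thesis .
qed

lemma right_can_bij: "bij_betw (right_can s t) (carrier (E s t \<boxtimes> E s t)) (carrier (E s t \<boxtimes> E t t))"
proof (rule bij_betw_lin_inverse[OF alg alg alg alg right_can_lin right_can_inv_lin])
  let ?X = "E s t" and ?A = "E t t"
  interpret XX: k_algebra "?X \<boxtimes> ?X" by simp
  interpret XA: k_algebra "?X \<boxtimes> ?A" by simp
  have inv_left: "right_can_inv s t (ptensor ?X ?A z \<one>\<^bsub>?A\<^esub> \<otimes>\<^bsub>?X \<boxtimes> ?A\<^esub> u)
      = ptensor ?X ?X z \<one>\<^bsub>?X\<^esub> \<otimes>\<^bsub>?X \<boxtimes> ?X\<^esub> right_can_inv s t u"
    if z: "z \<in> carrier ?X" and u: "u \<in> carrier (?X \<boxtimes> ?A)" for z u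
  proof (rule tensor_lin_map_eqI[OF alg alg XX.k_algebra_axioms _ _ _ u])
    show "(\<lambda>u. right_can_inv s t (ptensor ?X ?A z \<one>\<^bsub>?A\<^esub> \<otimes>\<^bsub>?X \<boxtimes> ?A\<^esub> u)) \<in> lin_map (?X \<boxtimes> ?A) (?X \<boxtimes> ?X)"
      using z by (intro lin_map_comp[OF XA.lin_map_left_mult right_can_inv_lin]) auto
    show "(\<lambda>u. ptensor ?X ?X z \<one>\<^bsub>?X\<^esub> \<otimes>\<^bsub>?X \<boxtimes> ?X\<^esub> right_can_inv s t u) \<in> lin_map (?X \<boxtimes> ?A) (?X \<boxtimes> ?X)"
      using z by (intro lin_map_comp[OF right_can_inv_lin XX.lin_map_left_mult]) auto
  next
    fix x a assume xa: "x \<in> carrier ?X" "a \<in> carrier ?A"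
    then have "tensor_map ?X ?X (S t s) id (D t s t a) \<in> carrier (?X \<boxtimes> ?X)"
      by (intro translation_closed_right)
    with xa z show "right_can_inv s t (ptensor ?X ?A z \<one>\<^bsub>?A\<^esub> \<otimes>\<^bsub>?X \<boxtimes> ?A\<^esub> ptensor ?X ?A x a)
        = ptensor ?X ?X z \<one>\<^bsub>?X\<^esub> \<otimes>\<^bsub>?X \<boxtimes> ?X\<^esub> right_can_inv s t (ptensor ?X ?A x a)"
      by (simp add: ptensor_mult right_can_inv_ptensor XX.m_assoc[symmetric])
  qed
  show "right_can_inv s t (right_can s t (ptensor ?X ?X z z')) = ptensor ?X ?X z z'"
    if "z \<in> carrier ?X" "z' \<in> carrier ?X" for z z'
    using that
    by (simp add: mult_lift_ptensor ptensor_one_right_lin D_lin inv_left D_closed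
        right_can_inv_coaction ptensor_mult)
  show "right_can s t (right_can_inv s t (ptensor ?X ?A z a)) = ptensor ?X ?A z a"
    if z: "z \<in> carrier ?X" and a: "a \<in> carrier ?A" for z a
  proof -
    let ?T = "tensor_map ?X ?X (S t s) id (D t s t a)"
    have T: "?T \<in> carrier (?X \<boxtimes> ?X)"
      using a by (rule translation_closed_right)
    have "right_can s t (ptensor ?X ?X z \<one>\<^bsub>?X\<^esub> \<otimes>\<^bsub>?X \<boxtimes> ?X\<^esub> ?T)
        = ptensor ?X ?A z \<one>\<^bsub>?A\<^esub> \<otimes>\<^bsub>?X \<boxtimes> ?A\<^esub> right_can s t ?T"
      by (rule mult_lift_left) (use z T in \<open>auto simp: ptensor_one_right_lin D_lin ptensor_mult\<close>)
    then show ?thesis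
      using z a by (simp add: right_can_inv_ptensor right_can_translation ptensor_mult)
  qed
qed


subsection \<open>The left coaction\<close>

abbreviation left_can where
  "left_can s t \<equiv> mult_lift (E s s \<boxtimes> E s t) (D s s t) (\<lambda>z. ptensor (E s s) (E s t) \<one>\<^bsub>E s s\<^esub> z)"

text \<open>The mirror image \<open>c \<otimes> z \<mapsto> c\<^sub>1 \<otimes> S(c\<^sub>2) z\<close>.\<close>

definition left_can_inv where
  "left_can_inv s t u = mult_lift (E s t \<boxtimes> E s t)
     (tensor_map (E s t) (E s t) id (S t s)) (\<lambda>z. ptensor (E s t) (E s t) \<one>\<^bsub>E s t\<^esub> z)
     (tensor_map (E s t \<boxtimes> E t s) (E s t) (D s t s) id u)"

lemma left_can_lin: "left_can s t \<in> lin_map (E s t \<boxtimes> E s t) (E s s \<boxtimes> E s t)"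
  by (intro mult_lift_lin ptensor_one_left_lin D_lin) auto

lemma left_expand_lin:
  "mult_lift (E s t \<boxtimes> E s t) (tensor_map (E s t) (E s t) id (S t s))
     (\<lambda>z. ptensor (E s t) (E s t) \<one>\<^bsub>E s t\<^esub> z) \<in> lin_map ((E s t \<boxtimes> E t s) \<boxtimes> E s t) (E s t \<boxtimes> E s t)"
  by (intro mult_lift_lin ptensor_one_left_lin tensor_map_lin S_lin id_lin) auto

lemma left_can_inv_lin: "left_can_inv s t \<in> lin_map (E s s \<boxtimes> E s t) (E s t \<boxtimes> E s t)"
  unfolding left_can_inv_def
  by (intro lin_map_comp[OF tensor_map_lin left_expand_lin] D_lin id_lin) auto

lemma left_can_inv_ptensor:
  assumes "c \<in> carrier (E s s)" "z \<in> carrier (E s t)"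
  shows "left_can_inv s t (ptensor (E s s) (E s t) c z) =
    tensor_map (E s t) (E s t) id (S t s) (D s t s c) \<otimes>\<^bsub>E s t \<boxtimes> E s t\<^esub>
      ptensor (E s t) (E s t) \<one>\<^bsub>E s t\<^esub> z"
  using assms unfolding left_can_inv_def
  by (simp add: tensor_map_ptensor D_lin id_lin)
     (subst mult_lift_ptensor; simp add: ptensor_one_left_lin tensor_map_lin S_lin id_lin D_closed)

text \<open>In Sweedler notation, \<open>z\<^sub>1 \<otimes> S(z\<^sub>2) z\<^sub>3 = z \<otimes> 1\<close>: the antipode axiom of \<open>E t t\<close> contracts the last two
  legs.\<close>

lemma left_can_inv_coaction:
  assumes z: "z \<in> carrier (E s t)"
  shows "left_can_inv s t (D s s t z) = ptensor (E s t) (E s t) z \<one>\<^bsub>E s t\<^esub>"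
proof -
  let ?X = "E s t"
  let ?w = "tensor_map (?X \<boxtimes> E t s) ?X (D s t s) id (D s s t z)"
  let ?M = "mult_lift (?X \<boxtimes> ?X) (tensor_map ?X ?X id (S t s)) (\<lambda>z. ptensor ?X ?X \<one>\<^bsub>?X\<^esub> z)"
  let ?L = "mult_lift ?X (S t s) (\<lambda>x. x)"
  have w: "?w \<in> carrier ((?X \<boxtimes> E t s) \<boxtimes> ?X)"
    using z by (intro iterated_comult_closed_left)
  have "?M ?w = tensor_map ?X ?X id ?L (tensor_assoc ?X (E t s) ?X ?w)"
  proof (rule tensor_triple_eqI[OF alg alg alg _ left_expand_lin _ _ w])
    show "(\<lambda>u. tensor_map ?X ?X id ?L (tensor_assoc ?X (E t s) ?X u))
        \<in> lin_map ((?X \<boxtimes> E t s) \<boxtimes> ?X) (?X \<boxtimes> ?X)"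
      by (intro lin_map_comp[OF tensor_assoc_lin tensor_map_lin] antipode_left_lin id_lin) auto
  next
    fix a b c assume "a \<in> carrier ?X" "b \<in> carrier (E t s)" "c \<in> carrier ?X"
    then show "?M (ptensor (?X \<boxtimes> E t s) ?X (ptensor ?X (E t s) a b) c)
        = tensor_map ?X ?X id ?L
            (tensor_assoc ?X (E t s) ?X (ptensor (?X \<boxtimes> E t s) ?X (ptensor ?X (E t s) a b) c))"
      by (simp add: tensor_assoc_ptensor mult_lift_ptensor ptensor_one_left_lin tensor_map_lin
          S_lin id_lin tensor_map_ptensor S_closed ptensor_mult antipode_left_lin lin_map_id)
  qed simp
  also have "tensor_assoc ?X (E t s) ?X ?w = tensor_map ?X (E t s \<boxtimes> ?X) id (D t s t) (D s t t z)"
    using z by (rule D_assoc)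
  also have "tensor_map ?X ?X id ?L \<dots> = ptensor ?X ?X z \<one>\<^bsub>?X\<^esub>"
    by (intro counit_contract_right antipode_left_lin alg S_left z)
  finally show ?thesis
    by (simp only: left_can_inv_def)
qed

text \<open>In Sweedler notation, \<open>c\<^sub>1 \<otimes> c\<^sub>2 S(c\<^sub>3) = c \<otimes> 1\<close>: the antipode axiom of \<open>E s s\<close> contracts the last two
  legs.\<close>

lemma left_can_translation:
  assumes c: "c \<in> carrier (E s s)"
  shows "left_can s t (tensor_map (E s t) (E s t) id (S t s) (D s t s c)) =
    ptensor (E s s) (E s t) c \<one>\<^bsub>E s t\<^esub>"
proof -
  let ?X = "E s t" and ?C = "E s s"
  let ?w = "tensor_map (?C \<boxtimes> ?X) (E t s) (D s s t) id (D s t s c)"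
  let ?M = "mult_lift (?C \<boxtimes> ?X) (\<lambda>u. u) (\<lambda>x. ptensor ?C ?X \<one>\<^bsub>?C\<^esub> (S t s x))"
  let ?L = "mult_lift ?X (\<lambda>x. x) (S t s)"
  have p_lin: "(\<lambda>x. ptensor ?C ?X \<one>\<^bsub>?C\<^esub> (S t s x)) \<in> lin_map (E t s) (?C \<boxtimes> ?X)"
    by (rule lin_map_comp[OF S_lin ptensor_one_left_lin])
  have M_lin: "?M \<in> lin_map ((?C \<boxtimes> ?X) \<boxtimes> E t s) (?C \<boxtimes> ?X)"
    by (intro mult_lift_lin p_lin lin_map_id) auto
  have w: "?w \<in> carrier ((?C \<boxtimes> ?X) \<boxtimes> E t s)"
    using c by (intro iterated_comult_closed_left)
  have "left_can s t (tensor_map ?X ?X id (S t s) u)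
      = ?M (tensor_map (?C \<boxtimes> ?X) (E t s) (D s s t) id u)" if "u \<in> carrier (?X \<boxtimes> E t s)" for u
  proof (rule tensor_lin_map_eqI[OF alg alg _ _ _ _ that])
    show "(\<lambda>u. left_can s t (tensor_map ?X ?X id (S t s) u)) \<in> lin_map (?X \<boxtimes> E t s) (?C \<boxtimes> ?X)"
      by (intro lin_map_comp[OF tensor_map_lin left_can_lin] alg S_lin id_lin)
    show "(\<lambda>u. ?M (tensor_map (?C \<boxtimes> ?X) (E t s) (D s s t) id u)) \<in> lin_map (?X \<boxtimes> E t s) (?C \<boxtimes> ?X)"
      by (intro lin_map_comp[OF tensor_map_lin M_lin] D_lin id_lin) auto
  next
    fix x y assume "x \<in> carrier ?X" "y \<in> carrier (E t s)"
    then show "left_can s t (tensor_map ?X ?X id (S t s) (ptensor ?X (E t s) x y))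
      = ?M (tensor_map (?C \<boxtimes> ?X) (E t s) (D s s t) id (ptensor ?X (E t s) x y))"
      by (simp add: tensor_map_ptensor S_lin id_lin D_lin S_closed D_closed mult_lift_ptensor
          ptensor_one_left_lin p_lin lin_map_id)
  qed simp
  then have "left_can s t (tensor_map ?X ?X id (S t s) (D s t s c)) = ?M ?w"
    using c by (simp add: D_closed)
  also have "\<dots> = tensor_map ?C ?X id ?L (tensor_assoc ?C ?X (E t s) ?w)"
  proof (rule tensor_triple_eqI[OF alg alg alg _ M_lin _ _ w])
    show "(\<lambda>u. tensor_map ?C ?X id ?L (tensor_assoc ?C ?X (E t s) u))
        \<in> lin_map ((?C \<boxtimes> ?X) \<boxtimes> E t s) (?C \<boxtimes> ?X)"
      by (intro lin_map_comp[OF tensor_assoc_lin tensor_map_lin] antipode_right_lin id_lin) auto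
  next
    fix x y z assume "x \<in> carrier ?C" "y \<in> carrier ?X" "z \<in> carrier (E t s)"
    then show "?M (ptensor (?C \<boxtimes> ?X) (E t s) (ptensor ?C ?X x y) z) = tensor_map ?C ?X id ?L
        (tensor_assoc ?C ?X (E t s) (ptensor (?C \<boxtimes> ?X) (E t s) (ptensor ?C ?X x y) z))"
      by (simp add: tensor_assoc_ptensor mult_lift_ptensor p_lin lin_map_id S_lin
          id_lin tensor_map_ptensor S_closed ptensor_mult antipode_right_lin)
  qed simp
  also have "tensor_assoc ?C ?X (E t s) ?w = tensor_map ?C (?X \<boxtimes> E t s) id (D s t s) (D s s s c)"
    using c by (rule D_assoc)
  also have "tensor_map ?C ?X id ?L \<dots> = ptensor ?C ?X c \<one>\<^bsub>?X\<^esub>"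
    by (intro counit_contract_right antipode_right_lin alg S_right c)
  finally show ?thesis .
qed

lemma left_can_bij: "bij_betw (left_can s t) (carrier (E s t \<boxtimes> E s t)) (carrier (E s s \<boxtimes> E s t))"
proof (rule bij_betw_lin_inverse[OF alg alg alg alg left_can_lin left_can_inv_lin])
  let ?X = "E s t" and ?C = "E s s"
  interpret XX: k_algebra "?X \<boxtimes> ?X" by simp
  interpret CX: k_algebra "?C \<boxtimes> ?X" by simp
  have inv_right: "left_can_inv s t (u \<otimes>\<^bsub>?C \<boxtimes> ?X\<^esub> ptensor ?C ?X \<one>\<^bsub>?C\<^esub> z)
      = left_can_inv s t u \<otimes>\<^bsub>?X \<boxtimes> ?X\<^esub> ptensor ?X ?X \<one>\<^bsub>?X\<^esub> z"
    if z: "z \<in> carrier ?X" and u: "u \<in> carrier (?C \<boxtimes> ?X)" for z u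
  proof (rule tensor_lin_map_eqI[OF alg alg XX.k_algebra_axioms _ _ _ u])
    show "(\<lambda>u. left_can_inv s t (u \<otimes>\<^bsub>?C \<boxtimes> ?X\<^esub> ptensor ?C ?X \<one>\<^bsub>?C\<^esub> z)) \<in> lin_map (?C \<boxtimes> ?X) (?X \<boxtimes> ?X)"
      using z by (intro lin_map_comp[OF CX.lin_map_right_mult left_can_inv_lin]) auto
    show "(\<lambda>u. left_can_inv s t u \<otimes>\<^bsub>?X \<boxtimes> ?X\<^esub> ptensor ?X ?X \<one>\<^bsub>?X\<^esub> z) \<in> lin_map (?C \<boxtimes> ?X) (?X \<boxtimes> ?X)"
      using z by (intro lin_map_comp[OF left_can_inv_lin XX.lin_map_right_mult]) auto
  next
    fix c x assume cx: "c \<in> carrier ?C" "x \<in> carrier ?X"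
    then have "tensor_map ?X ?X id (S t s) (D s t s c) \<in> carrier (?X \<boxtimes> ?X)"
      by (intro translation_closed_left)
    with cx z show "left_can_inv s t (ptensor ?C ?X c x \<otimes>\<^bsub>?C \<boxtimes> ?X\<^esub> ptensor ?C ?X \<one>\<^bsub>?C\<^esub> z)
        = left_can_inv s t (ptensor ?C ?X c x) \<otimes>\<^bsub>?X \<boxtimes> ?X\<^esub> ptensor ?X ?X \<one>\<^bsub>?X\<^esub> z"
      by (simp add: ptensor_mult left_can_inv_ptensor XX.m_assoc)
  qed
  show "left_can_inv s t (left_can s t (ptensor ?X ?X z z')) = ptensor ?X ?X z z'"
    if "z \<in> carrier ?X" "z' \<in> carrier ?X" for z z'
    using that
    by (simp add: mult_lift_ptensor ptensor_one_left_lin D_lin inv_right D_closed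
        left_can_inv_coaction ptensor_mult)
  show "left_can s t (left_can_inv s t (ptensor ?C ?X c z)) = ptensor ?C ?X c z"
    if c: "c \<in> carrier ?C" and z: "z \<in> carrier ?X" for c z
  proof -
    let ?T = "tensor_map ?X ?X id (S t s) (D s t s c)"
    have T: "?T \<in> carrier (?X \<boxtimes> ?X)"
      using c by (rule translation_closed_left)
    have "left_can s t (?T \<otimes>\<^bsub>?X \<boxtimes> ?X\<^esub> ptensor ?X ?X \<one>\<^bsub>?X\<^esub> z)
        = left_can s t ?T \<otimes>\<^bsub>?C \<boxtimes> ?X\<^esub> ptensor ?C ?X \<one>\<^bsub>?C\<^esub> z"
      by (rule mult_lift_right) (use z T in \<open>auto simp: ptensor_one_left_lin D_lin ptensor_mult\<close>)
    then show ?thesis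
      using c z by (simp add: left_can_inv_ptensor left_can_translation ptensor_mult)
  qed
qed


subsection \<open>Coinvariants\<close>

text \<open>Contract the first leg of \<open>f \<otimes> 1 = 1 \<otimes> f\<close> with a functional that is \<open>1\<close> at the unit.\<close>

lemma scalar_if_flip_invariant:
  assumes \<psi>: "\<psi> \<in> lin_map (E s t) scalars" "\<psi> \<one>\<^bsub>E s t\<^esub> = 1" and f: "f \<in> carrier (E s t)"
    and flip: "ptensor (E s t) (E s t) f \<one>\<^bsub>E s t\<^esub> = ptensor (E s t) (E s t) \<one>\<^bsub>E s t\<^esub> f"
  shows "f = \<psi> f \<odot>\<^bsub>E s t\<^esub> \<one>\<^bsub>E s t\<^esub>"
proof -
  let ?p = "tensor_lift (E s t) (\<lambda>x y. \<psi> x \<odot>\<^bsub>E s t\<^esub> y)"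
  have b: "bilin (E s t) (E s t) (E s t) (\<lambda>x y. \<psi> x \<odot>\<^bsub>E s t\<^esub> y)"
    using \<psi>(1) lin_map_id(1) by (intro bilin_scal_left alg)
  have "?p (ptensor (E s t) (E s t) f \<one>\<^bsub>E s t\<^esub>) = \<psi> f \<odot>\<^bsub>E s t\<^esub> \<one>\<^bsub>E s t\<^esub>"
    using f by (simp add: tensor_lift_ptensor b)
  moreover have "?p (ptensor (E s t) (E s t) \<one>\<^bsub>E s t\<^esub> f) = f"
    using f \<psi>(2) by (simp add: tensor_lift_ptensor b)
  ultimately show ?thesis using flip by simp
qed

lemma D_scalar: "D s r t (c \<odot>\<^bsub>E s t\<^esub> \<one>\<^bsub>E s t\<^esub>) = c \<odot>\<^bsub>E s r \<boxtimes> E r t\<^esub> ptensor (E s r) (E r t) \<one>\<^bsub>E s r\<^esub> \<one>\<^bsub>E r t\<^esub>"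
  by (simp add: lin_map_smult[OF D_lin] alg_hom_one[OF D_hom] tensor_one)

context
  fixes s t \<psi>
  assumes \<psi>: "\<psi> \<in> lin_map (E s t) scalars" "\<psi> \<one>\<^bsub>E s t\<^esub> = 1"
begin

text \<open>The inverse Galois map sends the image of \<open>f\<close> under the coaction to \<open>1 \<otimes> f\<close>, but it fixes
  \<open>f \<otimes> 1\<close>; for a coinvariant \<open>f\<close> the two arguments agree.\<close>

lemma right_coinvariants_scalar:
  "{f \<in> carrier (E s t). D s t t f = ptensor (E s t) (E t t) f \<one>\<^bsub>E t t\<^esub>}
    = range (\<lambda>c. c \<odot>\<^bsub>E s t\<^esub> \<one>\<^bsub>E s t\<^esub>)"
proof (intro equalityI subsetI)
  fix f assume "f \<in> {f \<in> carrier (E s t). D s t t f = ptensor (E s t) (E t t) f \<one>\<^bsub>E t t\<^esub>}"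
  then have f: "f \<in> carrier (E s t)" "D s t t f = ptensor (E s t) (E t t) f \<one>\<^bsub>E t t\<^esub>" by auto
  have "tensor_map (E s t) (E s t) (S t s) id (D t s t \<one>\<^bsub>E t t\<^esub>)
      = ptensor (E s t) (E s t) \<one>\<^bsub>E s t\<^esub> \<one>\<^bsub>E s t\<^esub>"
    by (simp add: alg_hom_one[OF D_hom] tensor_one tensor_map_ptensor S_lin id_lin S_one)
  then have "right_can_inv s t (D s t t f) = ptensor (E s t) (E s t) f \<one>\<^bsub>E s t\<^esub>"
    using f by (simp add: right_can_inv_ptensor ptensor_mult)
  then have "ptensor (E s t) (E s t) f \<one>\<^bsub>E s t\<^esub> = ptensor (E s t) (E s t) \<one>\<^bsub>E s t\<^esub> f"
    using right_can_inv_coaction[OF f(1)] by simp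
  then have "f = \<psi> f \<odot>\<^bsub>E s t\<^esub> \<one>\<^bsub>E s t\<^esub>"
    using f(1) by (intro scalar_if_flip_invariant[OF \<psi>])
  then show "f \<in> range (\<lambda>c. c \<odot>\<^bsub>E s t\<^esub> \<one>\<^bsub>E s t\<^esub>)" by (rule range_eqI)
qed (auto simp: D_scalar ptensor_smult_left)

lemma left_coinvariants_scalar:
  "{f \<in> carrier (E s t). D s s t f = ptensor (E s s) (E s t) \<one>\<^bsub>E s s\<^esub> f}
    = range (\<lambda>c. c \<odot>\<^bsub>E s t\<^esub> \<one>\<^bsub>E s t\<^esub>)"
proof (intro equalityI subsetI)
  fix f assume "f \<in> {f \<in> carrier (E s t). D s s t f = ptensor (E s s) (E s t) \<one>\<^bsub>E s s\<^esub> f}"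
  then have f: "f \<in> carrier (E s t)" "D s s t f = ptensor (E s s) (E s t) \<one>\<^bsub>E s s\<^esub> f" by auto
  have "tensor_map (E s t) (E s t) id (S t s) (D s t s \<one>\<^bsub>E s s\<^esub>)
      = ptensor (E s t) (E s t) \<one>\<^bsub>E s t\<^esub> \<one>\<^bsub>E s t\<^esub>"
    by (simp add: alg_hom_one[OF D_hom] tensor_one tensor_map_ptensor S_lin id_lin S_one)
  then have "left_can_inv s t (D s s t f) = ptensor (E s t) (E s t) \<one>\<^bsub>E s t\<^esub> f"
    using f by (simp add: left_can_inv_ptensor ptensor_mult)
  then have "ptensor (E s t) (E s t) f \<one>\<^bsub>E s t\<^esub> = ptensor (E s t) (E s t) \<one>\<^bsub>E s t\<^esub> f"
    using left_can_inv_coaction[OF f(1)] by simp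
  then have "f = \<psi> f \<odot>\<^bsub>E s t\<^esub> \<one>\<^bsub>E s t\<^esub>"
    using f(1) by (intro scalar_if_flip_invariant[OF \<psi>])
  then show "f \<in> range (\<lambda>c. c \<odot>\<^bsub>E s t\<^esub> \<one>\<^bsub>E s t\<^esub>)" by (rule range_eqI)
qed (auto simp: D_scalar ptensor_smult_right)

theorem bi_galois:
  assumes "compact_type_aqg (E s s) (D s s s) (eps s) (S s s)"
    and "compact_type_aqg (E t t) (D t t t) (eps t) (S t t)"
    and nonzero: "\<one>\<^bsub>E s t\<^esub> \<noteq> \<zero>\<^bsub>E s t\<^esub>"
  shows "bi_galois_object (E s s) (D s s s) (eps s) (S s s) (E t t) (D t t t) (eps t) (S t t)
    (E s t) (D s s t) (D s t t)"
proof (intro bi_galois_object.intro left_galois_object.intro right_galois_object.intro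
    left_galois_object_axioms.intro right_galois_object_axioms.intro bi_galois_object_axioms.intro
    assms alg D_hom D_assoc eps_left eps_right right_can_bij left_can_bij
    right_coinvariants_scalar left_coinvariants_scalar)
  show "inj_on (D s s t) (carrier (E s t))"
    using eps_left by (rule inj_on_inverseI)
  show "inj_on (D s t t) (carrier (E s t))"
    using eps_right by (rule inj_on_inverseI)
qed

end

end

section \<open>Algebras given by generators and relations\<close>

text \<open>The left fold lets words grow on the right, as in \<open>presented_induct\<close>.\<close>

definition word_prod :: "('k::field, 'c) module \<Rightarrow> ('g \<Rightarrow> 'c) \<Rightarrow> 'g free_mon \<Rightarrow> 'c" where
  "word_prod B v w = foldl (\<lambda>x g. x \<otimes>\<^bsub>B\<^esub> v g) \<one>\<^bsub>B\<^esub> (letters w)"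

abbreviation free_lift :: "('k::field, 'c) module \<Rightarrow> ('g \<Rightarrow> 'c) \<Rightarrow> ('k, 'g) free_alg \<Rightarrow> 'c" where
  "free_lift B v \<equiv> lin_ext B (word_prod B v)"

lemma word_prod_snoc: "word_prod B v (Word (l @ [g])) = word_prod B v (Word l) \<otimes>\<^bsub>B\<^esub> v g"
  by (simp add: word_prod_def)

lemma word_prod_Nil: "word_prod B v (Word []) = \<one>\<^bsub>B\<^esub>"
  by (simp add: word_prod_def)

lemma one_eq_empty_word: "1 = Poly_Mapping.single (Word []) 1"
  by (simp add: zero_free_mon_def[symmetric])

context
  fixes B :: "('k::field, 'c) module" and v :: "'g \<Rightarrow> 'c"
  assumes B: "k_algebra B" and v: "\<And>g. v g \<in> carrier B"
begin

interpretation B: k_algebra B by (rule B)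

lemma word_prod_closed: "word_prod B v w \<in> carrier B"
proof (cases w)
  case (Word l)
  have "word_prod B v (Word l) \<in> carrier B"
    by (induction l rule: rev_induct) (simp_all add: word_prod_snoc word_prod_Nil v)
  then show ?thesis using Word by simp
qed

lemma word_prod_plus: "word_prod B v (u + w) = word_prod B v u \<otimes>\<^bsub>B\<^esub> word_prod B v w"
proof (cases w)
  case (Word l)
  have "word_prod B v (u + Word l) = word_prod B v u \<otimes>\<^bsub>B\<^esub> word_prod B v (Word l)"
  proof (induction l rule: rev_induct)
    case Nil
    then show ?case by (cases u) (simp add: plus_free_mon_def word_prod_Nil word_prod_closed)
  next
    case (snoc g l)
    have "u + Word (l @ [g]) = Word (letters (u + Word l) @ [g])"
      by (simp add: plus_free_mon_def)
    then have "word_prod B v (u + Word (l @ [g])) = word_prod B v (Word (letters (u + Word l))) \<otimes>\<^bsub>B\<^esub> v g"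
      by (simp only: word_prod_snoc)
    with snoc show ?case
      by (simp add: word_prod_snoc B.m_assoc word_prod_closed v)
  qed
  then show ?thesis using Word by simp
qed

lemma free_lift_alg_hom: "free_lift B v \<in> alg_hom free_algebra B"
proof (rule alg_homI_spanning[OF k_algebra_free_algebra B
      free_space.free_spanning[OF free_space_free_algebra]
      free_space.lin_ext_lin_map[OF free_space_free_algebra B]])
  show "free_lift B v \<one>\<^bsub>free_algebra\<^esub> = \<one>\<^bsub>B\<^esub>"
    by (simp add: one_eq_empty_word word_prod_Nil)
qed (auto simp: word_prod_closed mult_single word_prod_plus)

lemma free_lift_var: "free_lift B v (var g) = v g"
proof -
  have "word_prod B v (Word [g]) = v g"
    using word_prod_snoc[of B v "[]" g] v by (simp add: word_prod_Nil)
  then show ?thesis by (simp add: var_def word_prod_closed v)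
qed

lemma free_lift_simps:
  "free_lift B v (p + q) = free_lift B v p \<oplus>\<^bsub>B\<^esub> free_lift B v q"
  "free_lift B v (p * q) = free_lift B v p \<otimes>\<^bsub>B\<^esub> free_lift B v q"
  "free_lift B v (scale c p) = c \<odot>\<^bsub>B\<^esub> free_lift B v p"
  "free_lift B v 1 = \<one>\<^bsub>B\<^esub>"
  "free_lift B v (p ^ k) = free_lift B v p [^]\<^bsub>B\<^esub> k"
proof -
  note h = free_lift_alg_hom
  show mult: "free_lift B v (p * q) = free_lift B v p \<otimes>\<^bsub>B\<^esub> free_lift B v q" for p q
    using alg_hom_mult[OF h, of p q] by simp
  show "free_lift B v (p + q) = free_lift B v p \<oplus>\<^bsub>B\<^esub> free_lift B v q"
    using alg_hom_add[OF h, of p q] by simp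
  show "free_lift B v (scale c p) = c \<odot>\<^bsub>B\<^esub> free_lift B v p"
    using alg_hom_smult[OF h, of p c] by simp
  show one: "free_lift B v 1 = \<one>\<^bsub>B\<^esub>"
    using alg_hom_one[OF h] by simp
  show "free_lift B v (p ^ k) = free_lift B v p [^]\<^bsub>B\<^esub> k"
    by (induction k) (simp_all add: one mult power_Suc2 del: power_Suc)
qed

lemma free_lift_closed: "free_lift B v p \<in> carrier B"
  using alg_hom_closed[OF free_lift_alg_hom, of p] by simp

lemma free_lift_diff: "free_lift B v p = free_lift B v q \<Longrightarrow> free_lift B v (p - q) = \<zero>\<^bsub>B\<^esub>"
proof -
  assume eq: "free_lift B v p = free_lift B v q"
  have c: "free_lift B v (p - q) \<in> carrier B" "free_lift B v q \<in> carrier B"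
    by (rule free_lift_closed)+
  have "free_lift B v (p - q) \<oplus>\<^bsub>B\<^esub> free_lift B v q = free_lift B v q"
    using free_lift_simps(1)[of "p - q" q] eq by simp
  then have "(free_lift B v (p - q) \<oplus>\<^bsub>B\<^esub> free_lift B v q) \<oplus>\<^bsub>B\<^esub> \<ominus>\<^bsub>B\<^esub> free_lift B v q = \<zero>\<^bsub>B\<^esub>"
    using c by (simp add: B.r_neg)
  then show ?thesis
    using c by (simp add: B.a_assoc B.r_neg)
qed

end

lemma presented_ideal: "alg_ideal free_algebra (rel_ideal R)"
proof -
  interpret F: k_algebra free_algebra by (rule k_algebra_free_algebra)
  show ?thesis
    unfolding alg_ideal_def rel_ideal_def by (simp add: F.genideal_ideal F.k_algebra_axioms)
qed

context
  fixes R :: "(('k::field, 'g) free_alg \<times> ('k, 'g) free_alg) set"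
begin

interpretation pres: alg_ideal free_algebra "rel_ideal R"
  by (rule presented_ideal)

lemma k_algebra_presented: "k_algebra (presented R)"
  unfolding presented_def by (rule pres.quot_k_algebra)

lemma generator_closed: "generator R g \<in> carrier (presented R)"
  by (simp add: generator_def presented_def pres.quot_simps)

text \<open>Evaluating at the generators of the quotient is the quotient map, since the two agree on
  words.\<close>

lemma free_lift_presented: "free_lift (presented R) (generator R) p = pres.proj p"
proof (rule lin_map_eq_on_spanning[OF k_algebra_free_algebra k_algebra_presented
      free_space.free_spanning[OF free_space_free_algebra], where g = "pres.proj"])
  note P = k_algebra_presented generator_closed
  show "free_lift (presented R) (generator R) \<in> lin_map free_algebra (presented R)"
    by (rule alg_hom_lin[OF free_lift_alg_hom[OF P]])
  show proj: "pres.proj \<in> lin_map free_algebra (presented R)"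
    unfolding presented_def by (rule alg_hom_lin[OF pres.proj_alg_hom])
  have "word_prod (presented R) (generator R) (Word l) = pres.proj (Poly_Mapping.single (Word l) 1)" for l
  proof (induction l rule: rev_induct)
    case Nil
    then show ?case by (simp add: word_prod_Nil presented_def pres.quot_simps one_eq_empty_word)
  next
    case (snoc g l)
    have "Poly_Mapping.single (Word (l @ [g])) 1 = Poly_Mapping.single (Word l) 1 * (var g :: ('k, 'g) free_alg)"
      by (simp add: var_def mult_single plus_free_mon_def)
    with snoc show ?case
      by (simp add: word_prod_snoc generator_def) (simp add: presented_def pres.quot_mult)
  qed
  then have w: "word_prod (presented R) (generator R) w = pres.proj (Poly_Mapping.single w 1)" for w
    by (cases w) simp
  fix t :: "('k, 'g) free_alg" assume "t \<in> (\<lambda>p. Poly_Mapping.single p 1) ` UNIV"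
  then obtain u where t: "t = Poly_Mapping.single u 1" by auto
  have "free_lift (presented R) (generator R) t = 1 \<odot>\<^bsub>presented R\<^esub> word_prod (presented R) (generator R) u"
    unfolding t by (rule k_algebra.lin_ext_single[OF P(1)]) (rule word_prod_closed[OF P])
  then show "free_lift (presented R) (generator R) t = pres.proj t"
    using k_algebra.scal_one[OF P(1) word_prod_closed[OF P, of "\<lambda>x. x" u]] w t by simp
qed simp

lemma generator_relation:
  assumes "(p, q) \<in> R"
  shows "free_lift (presented R) (generator R) p = free_lift (presented R) (generator R) q"
proof -
  have "p - q \<in> rel_ideal R"
    unfolding rel_ideal_def using assms pres.F.genideal_self[of "(\<lambda>(p, q). p - q) ` R"] by force
  moreover have "p \<ominus>\<^bsub>free_algebra\<^esub> q = p - q"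
  proof -
    have "\<ominus>\<^bsub>free_algebra\<^esub> q = - q" by (rule pres.F.minus_equality) auto
    then show ?thesis by (simp add: a_minus_def)
  qed
  ultimately show ?thesis
    by (simp add: free_lift_presented pres.proj_eq_iff)
qed

text \<open>The kernel of the evaluation at \<open>v\<close> is an ideal that contains the relators, hence the ideal
  generated by them.\<close>

lemma presented_lift:
  assumes B: "k_algebra B" and v: "\<And>g. v g \<in> carrier B"
    and R: "\<And>p q. (p, q) \<in> R \<Longrightarrow> free_lift B v p = free_lift B v q"
  shows "\<exists>f\<in>alg_hom (presented R) B. \<forall>g. f (generator R g) = v g"
proof -
  interpret B: k_algebra B by (rule B)
  let ?L = "free_lift B v"
  have hom: "?L \<in> ring_hom free_algebra B"
    using free_lift_alg_hom[OF B, of v] v by (simp add: alg_hom_def)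
  interpret L: ring_hom_ring free_algebra B ?L
    by (rule ring_hom_ringI2[OF pres.F.ring_axioms B.ring_axioms hom])
  have "(\<lambda>(p, q). p - q) ` R \<subseteq> a_kernel free_algebra B ?L"
  proof
    fix r assume "r \<in> (\<lambda>(p, q). p - q) ` R"
    then obtain p q where pq: "(p, q) \<in> R" "r = p - q" by auto
    have "?L r = \<zero>\<^bsub>B\<^esub>"
      unfolding pq(2) by (rule free_lift_diff[OF B v R[OF pq(1)]])
    then show "r \<in> a_kernel free_algebra B ?L"
      unfolding a_kernel_def' by simp
  qed
  then have sub: "rel_ideal R \<subseteq> a_kernel free_algebra B ?L"
    unfolding rel_ideal_def by (rule pres.F.genideal_minimal[OF L.kernel_is_ideal])
  have zero: "\<And>p. p \<in> rel_ideal R \<Longrightarrow> ?L p = \<zero>\<^bsub>B\<^esub>"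
    using sub unfolding a_kernel_def' by blast
  define f where "f X = (THE u. \<forall>p\<in>X. u = ?L p)" for X
  have f: "f (pres.proj p) = ?L p" for p
    unfolding f_def
    by (rule pres.quot_the_value[OF B alg_hom_lin[OF free_lift_alg_hom[OF B v]] zero]) auto
  have "f \<in> alg_hom (presented R) B"
    unfolding presented_def by (rule pres.quot_alg_homI[OF free_lift_alg_hom[OF B v] f])
  moreover have "\<forall>g. f (generator R g) = v g"
    by (simp add: generator_def f free_lift_var[OF B v])
  ultimately show ?thesis by blast
qed

text \<open>Multiplying by one generator at a time suffices to reach every word.\<close>

lemma presented_induct [consumes 1, case_names one gen add smult]:
  assumes c: "c \<in> carrier (presented R)"
    and one: "P \<one>\<^bsub>presented R\<^esub>"
    and gen: "\<And>x g. x \<in> carrier (presented R) \<Longrightarrow> P x \<Longrightarrow> P (x \<otimes>\<^bsub>presented R\<^esub> generator R g)"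
    and add: "\<And>x y. x \<in> carrier (presented R) \<Longrightarrow> y \<in> carrier (presented R) \<Longrightarrow> P x \<Longrightarrow> P y \<Longrightarrow>
      P (x \<oplus>\<^bsub>presented R\<^esub> y)"
    and smult: "\<And>k x. x \<in> carrier (presented R) \<Longrightarrow> P x \<Longrightarrow> P (k \<odot>\<^bsub>presented R\<^esub> x)"
  shows "P c"
proof -
  note A = k_algebra_presented generator_closed
  interpret A: k_algebra "presented R" by (rule A)
  let ?w = "word_prod (presented R) (generator R)"
  have zero: "P \<zero>\<^bsub>presented R\<^esub>"
    using smult[OF A.one_closed one, of 0] by simp
  have word: "P (?w (Word l))" for l
    by (induction l rule: rev_induct)
       (auto simp: word_prod_snoc word_prod_Nil one gen word_prod_closed[OF A])
  have "P (free_lift (presented R) (generator R) p)" for p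
  proof -
    have "p \<in> fsupp UNIV" by (simp add: fsupp_def)
    then show ?thesis
    proof (induction rule: fsupp_induct)
      case zero
      then show ?case using \<open>P \<zero>\<^bsub>presented R\<^esub>\<close> by (simp add: lin_ext_def)
    next
      case (add w k s)
      have "free_lift (presented R) (generator R) (Poly_Mapping.single w k) = k \<odot>\<^bsub>presented R\<^esub> ?w w"
        by (rule A.lin_ext_single) (rule word_prod_closed[OF A])
      then have "free_lift (presented R) (generator R) (Poly_Mapping.single w k + s)
          = k \<odot>\<^bsub>presented R\<^esub> ?w w \<oplus>\<^bsub>presented R\<^esub> free_lift (presented R) (generator R) s"
        by (simp only: free_lift_simps(1)[OF A])
      moreover have "P (k \<odot>\<^bsub>presented R\<^esub> ?w w)"
        using word[of "letters w"] by (intro smult word_prod_closed[OF A]) simp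
      ultimately show ?case
        using add.IH by (simp add: assms(4) word_prod_closed[OF A] free_lift_closed[OF A])
    qed
  qed
  moreover obtain p where "c = pres.proj p"
    using c by (auto simp: presented_def pres.quot_simps)
  ultimately show ?thesis by (simp add: free_lift_presented)
qed

lemma presented_hom_eqI:
  assumes "k_algebra B" "f \<in> alg_hom (presented R) B" "g \<in> alg_hom (presented R) B"
    and "\<And>x. f (generator R x) = g (generator R x)" and c: "c \<in> carrier (presented R)"
  shows "f c = g c"
  using c
  by (induction rule: presented_induct)
     (simp_all add: alg_hom_one[OF assms(2)] alg_hom_one[OF assms(3)] alg_hom_mult[OF assms(2)]
       alg_hom_mult[OF assms(3)] alg_hom_add[OF assms(2)] alg_hom_add[OF assms(3)]
       alg_hom_smult[OF assms(2)] alg_hom_smult[OF assms(3)] assms(4) generator_closed)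

end

section \<open>Powers of skew-commuting elements\<close>

subsection \<open>Roots of unity\<close>

lemma primitive_root_power_eq_one:
  assumes "primitive_root_of_unity n z" "z ^ k = 1"
  shows "n dvd k"
proof (rule ccontr)
  assume "\<not> n dvd k"
  have z: "n > 0" "z ^ n = 1" "\<And>j. 0 < j \<Longrightarrow> j < n \<Longrightarrow> z ^ j \<noteq> 1"
    using assms(1) by (auto simp: primitive_root_of_unity_def)
  have "z ^ k = z ^ (n * (k div n) + k mod n)" by simp
  also have "\<dots> = z ^ (k mod n)" by (simp only: power_add power_mult z(2)) simp
  finally show False
    using z(3)[of "k mod n"] z(1) \<open>\<not> n dvd k\<close> assms(2) by (simp add: dvd_eq_mod_eq_0)
qed

lemma primitive_root_power:
  assumes "primitive_root_of_unity n z" "coprime n m"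
  shows "primitive_root_of_unity n (z ^ m)"
  unfolding primitive_root_of_unity_def
proof (intro conjI allI impI)
  have n: "n > 0" "z ^ n = 1" using assms(1) by (auto simp: primitive_root_of_unity_def)
  then show "n > 0" by simp
  have "(z ^ m) ^ n = (z ^ n) ^ m" by (simp add: power_mult[symmetric] mult.commute)
  then show "(z ^ m) ^ n = 1" by (simp add: n)
  fix j assume j: "0 < j \<and> j < n"
  show "(z ^ m) ^ j \<noteq> 1"
  proof
    assume "(z ^ m) ^ j = 1"
    then have "n dvd m * j"
      using primitive_root_power_eq_one[OF assms(1), of "m * j"] by (simp add: power_mult)
    then have "n dvd j" using assms(2) by (simp add: coprime_dvd_mult_right_iff)
    then show False using j by (simp add: nat_dvd_not_less)
  qed
qed

lemma primitive_root_inverse: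
  "primitive_root_of_unity n z \<Longrightarrow> primitive_root_of_unity n (inverse z)"
  by (simp add: primitive_root_of_unity_def power_inverse)

lemma primitive_root_nonzero: "primitive_root_of_unity n z \<Longrightarrow> z \<noteq> 0"
  by (auto simp: primitive_root_of_unity_def zero_power)

text \<open>This is the constant term of \<open>T\<^sup>n - 1 = \<Prod>\<^sub>i (T - z\<^sup>i)\<close>. A direct proof: for odd \<open>n\<close> the exponent is a
  multiple of \<open>n\<close>; for even \<open>n\<close> the power \<open>z\<^sup>n\<^sup>/\<^sup>2\<close> is a square root of \<open>1\<close> other than \<open>1\<close>, and it is raised
  to the odd power \<open>n - 1\<close>.\<close>

lemma primitive_root_product:
  assumes z: "primitive_root_of_unity n (z :: 'k::field)"
  shows "(- 1) ^ n * z ^ (\<Sum>i<n. i) = - 1"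
proof -
  have n: "n > 0" "z ^ n = 1" "\<And>j. 0 < j \<Longrightarrow> j < n \<Longrightarrow> z ^ j \<noteq> 1"
    using z by (auto simp: primitive_root_of_unity_def)
  have sum: "2 * (\<Sum>i<n. i) = n * (n - 1)"
  proof (induction n)
    case (Suc n) then show ?case by (cases n) (simp_all add: algebra_simps)
  qed simp
  show ?thesis
  proof (cases "even n")
    case True
    then obtain k where k: "n = 2 * k" by auto
    then have "0 < k" "k < n" using n by auto
    have "(\<Sum>i<n. i) = k * (n - 1)" using sum k by simp
    moreover have "z ^ k = - 1"
    proof -
      have "(z ^ k)\<^sup>2 = 1" using n(2) k by (simp add: power_mult[symmetric] mult.commute)
      then have "z ^ k = 1 \<or> z ^ k = - 1" by (simp add: power2_eq_1_iff)
      then show ?thesis using n(3)[OF \<open>0 < k\<close> \<open>k < n\<close>] by simp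
    qed
    moreover have "odd (n - 1)" using k \<open>0 < k\<close> by simp
    ultimately show ?thesis using True by (simp add: power_mult)
  next
    case False
    then obtain k where k: "n = 2 * k + 1" by (elim oddE)
    then have "(\<Sum>i<n. i) = n * k" using sum by simp
    then show ?thesis using False n(2) by (simp add: power_mult)
  qed
qed


subsection \<open>The quantum binomial theorem\<close>

fun qbinom :: "'k::field \<Rightarrow> nat \<Rightarrow> nat \<Rightarrow> 'k" where
  "qbinom q N 0 = 1"
| "qbinom q 0 (Suc k) = 0"
| "qbinom q (Suc N) (Suc k) = qbinom q N k + q ^ Suc k * qbinom q N (Suc k)"

lemma qbinom_eq_0: "N < k \<Longrightarrow> qbinom q N k = 0"
  by (induction q N k rule: qbinom.induct) auto

lemma qbinom_self [simp]: "qbinom q N N = 1"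
  by (induction N) (auto simp: qbinom_eq_0)

text \<open>The recursive form of the product formula for Gaussian binomial coefficients; it avoids dividing
  by factors \<open>1 - q\<^sup>i\<close>, which may be zero.\<close>

lemma qbinom_step:
  "k \<le> N \<Longrightarrow> (1 - q ^ Suc k) * qbinom q N (Suc k) = (1 - q ^ (N - k)) * qbinom q N k"
proof (induction N arbitrary: k)
  case (Suc N)
  show ?case
  proof (cases "k = Suc N")
    case False
    with Suc.prems have k: "k \<le> N" by simp
    have "(1 - q ^ Suc k) * qbinom q (Suc N) (Suc k)
        = (1 - q ^ Suc k) * qbinom q N k + q ^ Suc k * ((1 - q ^ Suc k) * qbinom q N (Suc k))"
      by (simp add: algebra_simps)
    also have "\<dots> = (1 - q ^ (Suc k + (N - k))) * qbinom q N k"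
      by (simp only: Suc.IH[OF k] power_add) (simp add: algebra_simps)
    also have "Suc k + (N - k) = Suc N" using k by simp
    finally have l: "(1 - q ^ Suc k) * qbinom q (Suc N) (Suc k) = (1 - q ^ Suc N) * qbinom q N k" .
    show ?thesis
    proof (cases k)
      case 0 then show ?thesis using l by simp
    next
      case (Suc k')
      then have k': "k' \<le> N" "N - k' = Suc N - k" using k by auto
      have "(1 - q ^ (Suc N - k)) * qbinom q (Suc N) k
          = (1 - q ^ (N - k')) * qbinom q N k' + q ^ k * ((1 - q ^ (Suc N - k)) * qbinom q N k)"
        using Suc k' by (simp add: algebra_simps)
      also have "(1 - q ^ (N - k')) * qbinom q N k' = (1 - q ^ k) * qbinom q N k"
        using Suc.IH[OF k'(1)] Suc by simp
      also have "(1 - q ^ k) * qbinom q N k + q ^ k * ((1 - q ^ (Suc N - k)) * qbinom q N k)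
          = (1 - q ^ (k + (Suc N - k))) * qbinom q N k"
        by (simp only: power_add) (simp add: algebra_simps)
      also have "k + (Suc N - k) = Suc N" using k by simp
      finally show ?thesis using l by simp
    qed
  qed (simp add: qbinom_eq_0)
qed simp

text \<open>The factor \<open>1 - q\<^sup>n\<close> vanishes at \<open>k = 0\<close>, and the factors \<open>1 - q\<^sup>k\<close> to be cancelled do not as long as
  \<open>k < n\<close>.\<close>

lemma qbinom_root_of_unity:
  assumes "primitive_root_of_unity n q" "0 < k" "k < n"
  shows "qbinom q n k = 0"
  using assms(2,3)
proof (induction k)
  case (Suc k)
  have "(1 - q ^ Suc k) * qbinom q n (Suc k) = (1 - q ^ (n - k)) * qbinom q n k"
    using Suc.prems by (intro qbinom_step) simp
  also have "\<dots> = 0"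
    using Suc assms(1) by (cases "k = 0") (auto simp: primitive_root_of_unity_def)
  finally show ?case
    using Suc.prems assms(1) by (auto simp: primitive_root_of_unity_def simp del: power_Suc)
qed simp

context k_algebra
begin

lemma skew_pow_left:
  assumes "P \<in> carrier A" "Q \<in> carrier A" "P \<otimes> Q = q \<odot> (Q \<otimes> P)"
  shows "P [^] (k::nat) \<otimes> Q = q ^ k \<odot> (Q \<otimes> P [^] k)"
proof (induction k)
  case (Suc k)
  have "P [^] Suc k \<otimes> Q = P [^] k \<otimes> (P \<otimes> Q)"
    using assms by (simp add: m_assoc)
  also have "\<dots> = q \<odot> ((P [^] k \<otimes> Q) \<otimes> P)"
    using assms by (simp add: m_assoc)
  also have "\<dots> = q ^ Suc k \<odot> (Q \<otimes> P [^] Suc k)"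
    using assms by (simp add: Suc m_assoc)
  finally show ?case .
qed (use assms in simp)

lemma skew_pow_right:
  assumes "P \<in> carrier A" "Q \<in> carrier A" "P \<otimes> Q = q \<odot> (Q \<otimes> P)"
  shows "P \<otimes> Q [^] (k::nat) = q ^ k \<odot> (Q [^] k \<otimes> P)"
proof (induction k)
  case (Suc k)
  have "P \<otimes> Q [^] Suc k = (P \<otimes> Q [^] k) \<otimes> Q"
    using assms by (simp add: m_assoc)
  also have "\<dots> = q ^ k \<odot> (Q [^] k \<otimes> (P \<otimes> Q))"
    using assms by (simp add: Suc m_assoc)
  also have "\<dots> = q ^ Suc k \<odot> (Q [^] Suc k \<otimes> P)"
    using assms by (simp add: m_assoc mult.commute)
  finally show ?case .
qed (use assms in simp)

lemma skew_mult_pow: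
  assumes "P \<in> carrier A" "Q \<in> carrier A" "P \<otimes> Q = q \<odot> (Q \<otimes> P)"
  shows "(Q \<otimes> P) [^] (k::nat) = q ^ (\<Sum>i<k. i) \<odot> (Q [^] k \<otimes> P [^] k)"
proof (induction k)
  case (Suc k)
  have "(Q \<otimes> P) [^] Suc k = q ^ (\<Sum>i<k. i) \<odot> (Q [^] k \<otimes> (P [^] k \<otimes> Q) \<otimes> P)"
    using assms by (simp add: Suc m_assoc)
  also have "\<dots> = q ^ (\<Sum>i<Suc k. i) \<odot> (Q [^] Suc k \<otimes> P [^] Suc k)"
    using assms by (simp add: skew_pow_left m_assoc power_add)
  finally show ?case .
qed (use assms in simp)

text \<open>Multiply from the left by \<open>P + Q\<close>: moving \<open>P\<close> past \<open>Q\<^sup>k\<close> produces the factor \<open>q\<^sup>k\<close> in the Pascal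
  recursion of \<open>qbinom\<close>.\<close>

theorem skew_binomial:
  assumes P: "P \<in> carrier A" and Q: "Q \<in> carrier A" and PQ: "P \<otimes> Q = q \<odot> (Q \<otimes> P)"
  shows "(P \<oplus> Q) [^] (N::nat) = (\<Oplus>k\<in>{..N}. qbinom q N k \<odot> (Q [^] k \<otimes> P [^] (N - k)))"
proof (induction N)
  case (Suc N)
  let ?t = "\<lambda>k. Q [^] k \<otimes> P [^] (Suc N - k)"
  let ?f = "\<lambda>k. qbinom q N k \<odot> (Q [^] k \<otimes> P [^] (N - k))"
  have f: "?f \<in> {..N} \<rightarrow> carrier A" using P Q by auto
  have "(P \<oplus> Q) [^] Suc N = (P \<oplus> Q) \<otimes> (P \<oplus> Q) [^] N"
    using P Q by (intro nat_pow_Suc2) auto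
  also have "\<dots> = P \<otimes> finsum A ?f {..N} \<oplus> Q \<otimes> finsum A ?f {..N}"
    using P Q f by (simp add: Suc l_distr finsum_closed)
  also have "P \<otimes> finsum A ?f {..N} = (\<Oplus>k\<in>{..N}. P \<otimes> ?f k)"
    using P f by (intro finsum_rdistr) auto
  also have "\<dots> = (\<Oplus>k\<in>{..N}. (q ^ k * qbinom q N k) \<odot> ?t k)"
  proof (rule finsum_cong')
    fix k assume "k \<in> {..N}"
    then have k: "Suc N - k = Suc (N - k)" by auto
    have "P \<otimes> ?f k = qbinom q N k \<odot> ((P \<otimes> Q [^] k) \<otimes> P [^] (N - k))"
      using P Q by (simp add: m_assoc)
    also have "\<dots> = (q ^ k * qbinom q N k) \<odot> (Q [^] k \<otimes> (P \<otimes> P [^] (N - k)))"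
      using P Q by (simp add: skew_pow_right[OF P Q PQ] m_assoc mult.commute)
    also have "P \<otimes> P [^] (N - k) = P [^] (Suc N - k)"
      using P by (simp only: k nat_pow_Suc2)
    finally show "P \<otimes> ?f k = (q ^ k * qbinom q N k) \<odot> ?t k" .
  qed (use P Q in auto)
  also have "\<dots> = (\<Oplus>k\<in>{..Suc N}. (q ^ k * qbinom q N k) \<odot> ?t k)"
    using P Q by (simp add: qbinom_eq_0 Pi_iff)
  also have "\<dots> = (\<Oplus>k\<in>{..N}. (q ^ Suc k * qbinom q N (Suc k)) \<odot> ?t (Suc k)) \<oplus> ?t 0"
    using P Q by (subst finsum_Suc2) (auto simp del: power_Suc)
  also have "Q \<otimes> finsum A ?f {..N} = (\<Oplus>k\<in>{..N}. Q \<otimes> ?f k)"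
    using Q f by (intro finsum_rdistr) auto
  also have "\<dots> = (\<Oplus>k\<in>{..N}. qbinom q N k \<odot> ?t (Suc k))"
    using P Q by (intro finsum_cong') (auto simp: m_assoc[symmetric] nat_pow_Suc2[symmetric] simp del: nat_pow_Suc)
  also have "(\<Oplus>k\<in>{..N}. (q ^ Suc k * qbinom q N (Suc k)) \<odot> ?t (Suc k)) \<oplus> ?t 0
      \<oplus> (\<Oplus>k\<in>{..N}. qbinom q N k \<odot> ?t (Suc k))
    = ((\<Oplus>k\<in>{..N}. qbinom q N k \<odot> ?t (Suc k)) \<oplus>
        (\<Oplus>k\<in>{..N}. (q ^ Suc k * qbinom q N (Suc k)) \<odot> ?t (Suc k))) \<oplus> ?t 0"
    using P Q by (simp add: a_ac finsum_closed Pi_iff del: power_Suc)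
  also have "(\<Oplus>k\<in>{..N}. qbinom q N k \<odot> ?t (Suc k)) \<oplus>
        (\<Oplus>k\<in>{..N}. (q ^ Suc k * qbinom q N (Suc k)) \<odot> ?t (Suc k))
      = (\<Oplus>k\<in>{..N}. qbinom q N k \<odot> ?t (Suc k) \<oplus> (q ^ Suc k * qbinom q N (Suc k)) \<odot> ?t (Suc k))"
    using P Q by (intro finsum_addf[symmetric]) auto
  also have "\<dots> = (\<Oplus>k\<in>{..N}. qbinom q (Suc N) (Suc k) \<odot> ?t (Suc k))"
    using P Q by (intro finsum_cong') (auto simp: scal_add_left)
  also have "\<dots> \<oplus> ?t 0 = (\<Oplus>k\<in>{..Suc N}. qbinom q (Suc N) k \<odot> ?t k)"
    using P Q by (subst finsum_Suc2) (auto simp del: qbinom.simps(3))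
  finally show ?case .
qed (use assms in simp)

lemma finsum_single_index:
  assumes "finite I" "i \<in> I" "f \<in> I \<rightarrow> carrier A" "\<And>j. j \<in> I \<Longrightarrow> j \<noteq> i \<Longrightarrow> f j = \<zero>"
  shows "finsum A f I = f i"
proof -
  have "finsum A f I = finsum A f {i}"
    using assms by (intro add.finprod_mono_neutral_cong_left[symmetric]) auto
  then show ?thesis using assms by (auto simp: Pi_iff)
qed

corollary skew_power_of_sum:
  assumes "primitive_root_of_unity n q" "n > 1"
    and P: "P \<in> carrier A" and Q: "Q \<in> carrier A" and PQ: "P \<otimes> Q = q \<odot> (Q \<otimes> P)"
  shows "(P \<oplus> Q) [^] n = P [^] n \<oplus> Q [^] n"
proof -
  obtain N where N: "n = Suc N" using assms(2) by (cases n) auto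
  let ?f = "\<lambda>k. qbinom q n k \<odot> (Q [^] k \<otimes> P [^] (n - k))"
  have f: "?f \<in> I \<rightarrow> carrier A" for I using P Q by auto
  have "(P \<oplus> Q) [^] n = finsum A ?f {..n}"
    by (rule skew_binomial[OF P Q PQ])
  also have "\<dots> = ?f n \<oplus> finsum A ?f {..N}"
    unfolding N using f[of "{..Suc N}"] by (intro finsum_Suc) (simp add: N)
  also have "finsum A ?f {..N} = ?f 0"
    by (rule finsum_single_index) (use f P Q N qbinom_root_of_unity[OF assms(1)] in auto)
  finally show ?thesis
    using P Q by (simp add: a_comm)
qed

end

section \<open>The opposite algebra\<close>

text \<open>Antipodes reverse products; as homomorphisms into the opposite algebra they can be obtained from
  the universal property.\<close>

definition opp :: "('k::field, 'a) module \<Rightarrow> ('k, 'a) module" where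
  "opp A = A\<lparr>monoid.mult := \<lambda>x y. y \<otimes>\<^bsub>A\<^esub> x\<rparr>"

lemma opp_simps [simp]:
  "carrier (opp A) = carrier A" "x \<otimes>\<^bsub>opp A\<^esub> y = y \<otimes>\<^bsub>A\<^esub> x" "\<one>\<^bsub>opp A\<^esub> = \<one>\<^bsub>A\<^esub>"
  "\<zero>\<^bsub>opp A\<^esub> = \<zero>\<^bsub>A\<^esub>" "x \<oplus>\<^bsub>opp A\<^esub> y = x \<oplus>\<^bsub>A\<^esub> y" "c \<odot>\<^bsub>opp A\<^esub> x = c \<odot>\<^bsub>A\<^esub> x"
  by (simp_all add: opp_def)

lemma lin_map_opp: "lin_map V (opp A) = lin_map V A"
  by (simp add: lin_map_def)

lemma (in k_algebra) k_algebra_opp: "k_algebra (opp A)"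
proof (rule k_algebraI)
  show "ring (opp A)"
  proof (rule ringI)
    show "abelian_group (opp A)"
    proof (rule abelian_groupI)
      show "\<exists>y\<in>carrier (opp A). y \<oplus>\<^bsub>opp A\<^esub> x = \<zero>\<^bsub>opp A\<^esub>" if "x \<in> carrier (opp A)" for x
        using that by (intro bexI[of _ "\<ominus> x"]) (auto simp: l_neg)
    qed (simp_all add: a_ac)
    show "Group.monoid (opp A)"
      by (rule monoidI) (simp_all add: m_assoc)
  qed (simp_all add: l_distr r_distr)
qed (simp_all add: scal_add_left scal_add_right)

lemma (in k_algebra) opp_pow: "x \<in> carrier A \<Longrightarrow> x [^]\<^bsub>opp A\<^esub> (k::nat) = x [^] k"
proof -
  assume x: "x \<in> carrier A"
  interpret O: k_algebra "opp A" by (rule k_algebra_opp)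
  show ?thesis
    by (induction k) (use x nat_pow_Suc2[OF x] in \<open>auto\<close>)
qed

lemma scalars_pow: "x [^]\<^bsub>scalars\<^esub> (k::nat) = x ^ k"
proof -
  interpret K: k_algebra "scalars :: ('a, 'a) module" by simp
  show ?thesis by (induction k) (simp_all add: mult.commute)
qed


section \<open>The cogroupoid of skew algebras\<close>

text \<open>The two scalars are the objects of the cogroupoid. The last relation is written with \<open>t\<close> on the
  left so that the relations of \<open>C\<close> are literally the case \<open>s = t = \<mu>\<close>.\<close>

definition skew_family_rels ::
    "nat \<Rightarrow> nat \<Rightarrow> 'k::field \<Rightarrow> 'k \<Rightarrow> 'k \<Rightarrow> (('k, gens) free_alg \<times> ('k, gens) free_alg) set" where
  "skew_family_rels n m q s t = skew_rels q \<union> {(scale t 1 + var H ^ n, scale s (var G ^ (m * n)))}"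

locale skew_family =
  fixes n m :: nat and lam :: "'k::field"
  assumes n_gt_1: "n > 1" and coprime: "coprime n m" and root: "primitive_root_of_unity n lam"
begin

definition E :: "'k \<Rightarrow> 'k \<Rightarrow> ('k, ('k, gens) free_alg set) module" where
  "E s t = presented (skew_family_rels n m lam s t)"

abbreviation g where "g s t \<equiv> generator (skew_family_rels n m lam s t) G"
abbreviation gi where "gi s t \<equiv> generator (skew_family_rels n m lam s t) Ginv"
abbreviation h where "h s t \<equiv> generator (skew_family_rels n m lam s t) H"

lemma E_alg [simp]: "k_algebra (E s t)"
  unfolding E_def by (rule k_algebra_presented)

sublocale E: k_algebra "E s t" for s t
  by (rule E_alg)

lemma gens_closed [simp]:
  "generator (skew_family_rels n m lam s t) x \<in> carrier (E s t)"
  unfolding E_def by (rule generator_closed)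

lemma rels_hold_iff:
  assumes B: "k_algebra B" and v: "\<And>x. v x \<in> carrier B"
  shows "(\<forall>(p, q)\<in>skew_family_rels n m lam s t. free_lift B v p = free_lift B v q) \<longleftrightarrow>
    v G \<otimes>\<^bsub>B\<^esub> v Ginv = \<one>\<^bsub>B\<^esub> \<and> v Ginv \<otimes>\<^bsub>B\<^esub> v G = \<one>\<^bsub>B\<^esub> \<and>
    v G \<otimes>\<^bsub>B\<^esub> v H = lam \<odot>\<^bsub>B\<^esub> (v H \<otimes>\<^bsub>B\<^esub> v G) \<and>
    t \<odot>\<^bsub>B\<^esub> \<one>\<^bsub>B\<^esub> \<oplus>\<^bsub>B\<^esub> v H [^]\<^bsub>B\<^esub> n = s \<odot>\<^bsub>B\<^esub> (v G [^]\<^bsub>B\<^esub> (m * n))"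
  by (simp add: skew_family_rels_def skew_rels_def free_lift_simps[OF B v] free_lift_var[OF B v])
     blast

lemma E_rels:
  "g s t \<otimes>\<^bsub>E s t\<^esub> gi s t = \<one>\<^bsub>E s t\<^esub>" "gi s t \<otimes>\<^bsub>E s t\<^esub> g s t = \<one>\<^bsub>E s t\<^esub>"
  "g s t \<otimes>\<^bsub>E s t\<^esub> h s t = lam \<odot>\<^bsub>E s t\<^esub> (h s t \<otimes>\<^bsub>E s t\<^esub> g s t)"
  "t \<odot>\<^bsub>E s t\<^esub> \<one>\<^bsub>E s t\<^esub> \<oplus>\<^bsub>E s t\<^esub> h s t [^]\<^bsub>E s t\<^esub> n = s \<odot>\<^bsub>E s t\<^esub> (g s t [^]\<^bsub>E s t\<^esub> (m * n))"
proof -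
  let ?R = "skew_family_rels n m lam s t"
  have "\<forall>(p, q)\<in>?R. free_lift (presented ?R) (generator ?R) p = free_lift (presented ?R) (generator ?R) q"
    using generator_relation[of _ _ ?R] by blast
  then show
    "g s t \<otimes>\<^bsub>E s t\<^esub> gi s t = \<one>\<^bsub>E s t\<^esub>" "gi s t \<otimes>\<^bsub>E s t\<^esub> g s t = \<one>\<^bsub>E s t\<^esub>"
    "g s t \<otimes>\<^bsub>E s t\<^esub> h s t = lam \<odot>\<^bsub>E s t\<^esub> (h s t \<otimes>\<^bsub>E s t\<^esub> g s t)"
    "t \<odot>\<^bsub>E s t\<^esub> \<one>\<^bsub>E s t\<^esub> \<oplus>\<^bsub>E s t\<^esub> h s t [^]\<^bsub>E s t\<^esub> n = s \<odot>\<^bsub>E s t\<^esub> (g s t [^]\<^bsub>E s t\<^esub> (m * n))"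
    using rels_hold_iff[OF k_algebra_presented generator_closed, of s t ?R] unfolding E_def by auto
qed

lemma E_lift:
  assumes B: "k_algebra B" and cl: "a \<in> carrier B" "a' \<in> carrier B" "b \<in> carrier B"
    and rels: "a \<otimes>\<^bsub>B\<^esub> a' = \<one>\<^bsub>B\<^esub>" "a' \<otimes>\<^bsub>B\<^esub> a = \<one>\<^bsub>B\<^esub>" "a \<otimes>\<^bsub>B\<^esub> b = lam \<odot>\<^bsub>B\<^esub> (b \<otimes>\<^bsub>B\<^esub> a)"
      "t \<odot>\<^bsub>B\<^esub> \<one>\<^bsub>B\<^esub> \<oplus>\<^bsub>B\<^esub> b [^]\<^bsub>B\<^esub> n = s \<odot>\<^bsub>B\<^esub> (a [^]\<^bsub>B\<^esub> (m * n))"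
  shows "\<exists>f. f \<in> alg_hom (E s t) B \<and> f (g s t) = a \<and> f (gi s t) = a' \<and> f (h s t) = b"
proof -
  let ?v = "\<lambda>x. case x of G \<Rightarrow> a | Ginv \<Rightarrow> a' | H \<Rightarrow> b"
  have v: "?v x \<in> carrier B" for x using cl by (cases x) auto
  have "\<forall>(p, q)\<in>skew_family_rels n m lam s t. free_lift B ?v p = free_lift B ?v q"
    using rels by (subst rels_hold_iff[OF B v]) auto
  then obtain f where f: "f \<in> alg_hom (E s t) B"
      "\<forall>x. f (generator (skew_family_rels n m lam s t) x) = ?v x"
    using presented_lift[of B ?v "skew_family_rels n m lam s t", OF B v] unfolding E_def by blast
  show ?thesis
    using f(1) f(2)[rule_format, of G] f(2)[rule_format, of Ginv] f(2)[rule_format, of H]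
    by (intro exI[of _ f]) simp
qed

text \<open>The image of the inverse is forced, so a homomorphism is determined by two generators.\<close>

lemma E_hom_eqI:
  assumes B: "k_algebra B" and f: "f \<in> alg_hom (E s t) B" and f': "f' \<in> alg_hom (E s t) B"
    and eq: "f (g s t) = f' (g s t)" "f (h s t) = f' (h s t)" and c: "c \<in> carrier (E s t)"
  shows "f c = f' c"
proof -
  interpret B: k_algebra B by (rule B)
  have "f (gi s t) \<otimes>\<^bsub>B\<^esub> f (g s t) = \<one>\<^bsub>B\<^esub>"
    using alg_hom_mult[OF f, of "gi s t" "g s t"] by (simp add: E_rels alg_hom_one[OF f])
  moreover have "f (g s t) \<otimes>\<^bsub>B\<^esub> f' (gi s t) = \<one>\<^bsub>B\<^esub>"
    using alg_hom_mult[OF f', of "g s t" "gi s t"] by (simp add: E_rels alg_hom_one[OF f'] eq)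
  ultimately have "f (gi s t) = f' (gi s t)"
    by (rule B.inv_unique) (simp_all add: alg_hom_closed[OF f] alg_hom_closed[OF f'])
  with eq have "f (generator (skew_family_rels n m lam s t) x) = f' (generator (skew_family_rels n m lam s t) x)" for x
    by (cases x) auto
  then show ?thesis
    using presented_hom_eqI[OF B, of f "skew_family_rels n m lam s t" f'] f f' c
    unfolding E_def by blast
qed

lemma E_determined_hom:
  assumes B: "k_algebra B" and f: "f \<in> alg_hom (E s t) B" "f (g s t) = a" "f (h s t) = b"
  shows "determined_hom (E s t) B {(g s t, a), (h s t, b)} f"
  unfolding determined_hom_def
proof (intro conjI)
  show "\<forall>(x, v)\<in>{(g s t, a), (h s t, b)}. f x = v"
    using f(2,3) by simp
  show "\<forall>f'\<in>alg_hom (E s t) B. (\<forall>(x, v)\<in>{(g s t, a), (h s t, b)}. f' x = v) \<longrightarrow>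
      (\<forall>x\<in>carrier (E s t). f' x = f x)"
  proof (intro ballI impI)
    fix f' c
    assume f': "f' \<in> alg_hom (E s t) B" and eq: "\<forall>(x, v)\<in>{(g s t, a), (h s t, b)}. f' x = v"
      and c: "c \<in> carrier (E s t)"
    show "f' c = f c"
      by (rule E_hom_eqI[OF B f' f(1) _ _ c]) (use eq f(2,3) in simp_all)
  qed
qed (rule f(1))

lemma E_induct [consumes 1, case_names one g gi h add smult]:
  assumes c: "c \<in> carrier (E s t)"
    and "P \<one>\<^bsub>E s t\<^esub>"
    and "\<And>x. x \<in> carrier (E s t) \<Longrightarrow> P x \<Longrightarrow> P (x \<otimes>\<^bsub>E s t\<^esub> g s t)"
    and "\<And>x. x \<in> carrier (E s t) \<Longrightarrow> P x \<Longrightarrow> P (x \<otimes>\<^bsub>E s t\<^esub> gi s t)"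
    and "\<And>x. x \<in> carrier (E s t) \<Longrightarrow> P x \<Longrightarrow> P (x \<otimes>\<^bsub>E s t\<^esub> h s t)"
    and "\<And>x y. x \<in> carrier (E s t) \<Longrightarrow> y \<in> carrier (E s t) \<Longrightarrow> P x \<Longrightarrow> P y \<Longrightarrow> P (x \<oplus>\<^bsub>E s t\<^esub> y)"
    and "\<And>k x. x \<in> carrier (E s t) \<Longrightarrow> P x \<Longrightarrow> P (k \<odot>\<^bsub>E s t\<^esub> x)"
  shows "P c"
  using c[unfolded E_def]
proof (induction rule: presented_induct)
  case (gen x y)
  then show ?case
    using assms(3-5)[of x] by (cases y) (auto simp: E_def)
qed (use assms(2,6,7) in \<open>auto simp: E_def\<close>)

lemma g_pow_h: "g s t [^]\<^bsub>E s t\<^esub> (k::nat) \<otimes>\<^bsub>E s t\<^esub> h s t = lam ^ k \<odot>\<^bsub>E s t\<^esub> (h s t \<otimes>\<^bsub>E s t\<^esub> g s t [^]\<^bsub>E s t\<^esub> k)"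
  by (rule E.skew_pow_left) (simp_all add: E_rels)

lemma lam_nonzero: "lam \<noteq> 0"
  using root by (rule primitive_root_nonzero)

lemma gi_h: "gi s t \<otimes>\<^bsub>E s t\<^esub> h s t = inverse lam \<odot>\<^bsub>E s t\<^esub> (h s t \<otimes>\<^bsub>E s t\<^esub> gi s t)"
proof -
  let ?E = "E s t" and ?g = "g s t" and ?i = "gi s t" and ?h = "h s t"
  have "?h \<otimes>\<^bsub>?E\<^esub> ?i = (?i \<otimes>\<^bsub>?E\<^esub> ?g) \<otimes>\<^bsub>?E\<^esub> ?h \<otimes>\<^bsub>?E\<^esub> ?i"
    by (simp add: E_rels)
  also have "\<dots> = ?i \<otimes>\<^bsub>?E\<^esub> (?g \<otimes>\<^bsub>?E\<^esub> ?h) \<otimes>\<^bsub>?E\<^esub> ?i"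
    by (simp add: E.m_assoc)
  also have "\<dots> = lam \<odot>\<^bsub>?E\<^esub> (?i \<otimes>\<^bsub>?E\<^esub> ?h \<otimes>\<^bsub>?E\<^esub> (?g \<otimes>\<^bsub>?E\<^esub> ?i))"
    by (simp only: E_rels(3)) (simp add: E.m_assoc)
  also have "\<dots> = lam \<odot>\<^bsub>?E\<^esub> (?i \<otimes>\<^bsub>?E\<^esub> ?h)"
    by (simp add: E_rels)
  finally show ?thesis using lam_nonzero by simp
qed

lemma g_gi_pow:
  "g s t [^]\<^bsub>E s t\<^esub> (k::nat) \<otimes>\<^bsub>E s t\<^esub> gi s t [^]\<^bsub>E s t\<^esub> k = \<one>\<^bsub>E s t\<^esub>"
  "gi s t [^]\<^bsub>E s t\<^esub> (k::nat) \<otimes>\<^bsub>E s t\<^esub> g s t [^]\<^bsub>E s t\<^esub> k = \<one>\<^bsub>E s t\<^esub>"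
proof -
  let ?E = "E s t"
  have "x [^]\<^bsub>?E\<^esub> k \<otimes>\<^bsub>?E\<^esub> y [^]\<^bsub>?E\<^esub> k = \<one>\<^bsub>?E\<^esub>"
    if "x \<in> carrier ?E" "y \<in> carrier ?E" "x \<otimes>\<^bsub>?E\<^esub> y = \<one>\<^bsub>?E\<^esub>" for x y and k :: nat
  proof (induction k)
    case (Suc k)
    have "x [^]\<^bsub>?E\<^esub> Suc k \<otimes>\<^bsub>?E\<^esub> y [^]\<^bsub>?E\<^esub> Suc k = x [^]\<^bsub>?E\<^esub> k \<otimes>\<^bsub>?E\<^esub> (x \<otimes>\<^bsub>?E\<^esub> y) \<otimes>\<^bsub>?E\<^esub> y [^]\<^bsub>?E\<^esub> k"
      using that(1,2) by (simp only: E.nat_pow_Suc2[of y]) (simp add: E.m_assoc)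
    with Suc that show ?case by simp
  qed simp
  then show "g s t [^]\<^bsub>E s t\<^esub> k \<otimes>\<^bsub>E s t\<^esub> gi s t [^]\<^bsub>E s t\<^esub> k = \<one>\<^bsub>E s t\<^esub>"
    "gi s t [^]\<^bsub>E s t\<^esub> k \<otimes>\<^bsub>E s t\<^esub> g s t [^]\<^bsub>E s t\<^esub> k = \<one>\<^bsub>E s t\<^esub>"
    by (simp_all add: E_rels)
qed


subsection \<open>Comultiplication, counit and antipode\<close>

abbreviation comult_h where
  "comult_h s r t \<equiv> ptensor (E s r) (E r t) (h s r) (g r t [^]\<^bsub>E r t\<^esub> m) \<oplus>\<^bsub>E s r \<boxtimes> E r t\<^esub>
     ptensor (E s r) (E r t) \<one>\<^bsub>E s r\<^esub> (h r t)"

text \<open>The last relation is the only one with content. By the quantum binomial theorem the \<open>n\<close>-th power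
  of the image of \<open>h\<close> is \<open>h\<^sup>n \<otimes> g\<^sup>m\<^sup>n + 1 \<otimes> h\<^sup>n\<close>; adding \<open>t\<close> turns the second summand into
  \<open>r (1 \<otimes> g\<^sup>m\<^sup>n)\<close> and the sum into \<open>(r + h\<^sup>n) \<otimes> g\<^sup>m\<^sup>n = s g\<^sup>m\<^sup>n \<otimes> g\<^sup>m\<^sup>n\<close>.\<close>

lemma comult_exists:
  "\<exists>f. f \<in> alg_hom (E s t) (E s r \<boxtimes> E r t) \<and>
     f (g s t) = ptensor (E s r) (E r t) (g s r) (g r t) \<and>
     f (gi s t) = ptensor (E s r) (E r t) (gi s r) (gi r t) \<and>
     f (h s t) = comult_h s r t"
proof (rule E_lift)
  let ?A = "E s r" and ?B = "E r t"
  let ?p = "ptensor ?A ?B"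
  interpret T: k_algebra "?A \<boxtimes> ?B" by simp
  show "k_algebra (?A \<boxtimes> ?B)" by simp
  show "?p (g s r) (g r t) \<in> carrier (?A \<boxtimes> ?B)" "?p (gi s r) (gi r t) \<in> carrier (?A \<boxtimes> ?B)"
    "comult_h s r t \<in> carrier (?A \<boxtimes> ?B)"
    by auto
  show "?p (g s r) (g r t) \<otimes>\<^bsub>?A \<boxtimes> ?B\<^esub> ?p (gi s r) (gi r t) = \<one>\<^bsub>?A \<boxtimes> ?B\<^esub>"
    "?p (gi s r) (gi r t) \<otimes>\<^bsub>?A \<boxtimes> ?B\<^esub> ?p (g s r) (g r t) = \<one>\<^bsub>?A \<boxtimes> ?B\<^esub>"
    by (simp_all add: ptensor_mult E_rels tensor_one)
  have comm: "g r t \<otimes>\<^bsub>?B\<^esub> g r t [^]\<^bsub>?B\<^esub> m = g r t [^]\<^bsub>?B\<^esub> m \<otimes>\<^bsub>?B\<^esub> g r t"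
    using E.nat_pow_Suc2[of "g r t" r t m] by simp
  show "?p (g s r) (g r t) \<otimes>\<^bsub>?A \<boxtimes> ?B\<^esub> comult_h s r t
      = lam \<odot>\<^bsub>?A \<boxtimes> ?B\<^esub> (comult_h s r t \<otimes>\<^bsub>?A \<boxtimes> ?B\<^esub> ?p (g s r) (g r t))"
    by (simp add: T.r_distr T.l_distr ptensor_mult E_rels comm ptensor_smult_left ptensor_smult_right
        T.scal_add_right)
  let ?P = "?p (h s r) (g r t [^]\<^bsub>?B\<^esub> m)" and ?Q = "?p \<one>\<^bsub>?A\<^esub> (h r t)"
  have PQ: "?P \<otimes>\<^bsub>?A \<boxtimes> ?B\<^esub> ?Q = lam ^ m \<odot>\<^bsub>?A \<boxtimes> ?B\<^esub> (?Q \<otimes>\<^bsub>?A \<boxtimes> ?B\<^esub> ?P)"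
    by (simp add: ptensor_mult g_pow_h ptensor_smult_right)
  have pow: "comult_h s r t [^]\<^bsub>?A \<boxtimes> ?B\<^esub> n = ?P [^]\<^bsub>?A \<boxtimes> ?B\<^esub> n \<oplus>\<^bsub>?A \<boxtimes> ?B\<^esub> ?Q [^]\<^bsub>?A \<boxtimes> ?B\<^esub> n"
    by (rule T.skew_power_of_sum[OF primitive_root_power[OF root coprime] n_gt_1 _ _ PQ]) auto
  let ?gn = "g r t [^]\<^bsub>?B\<^esub> (m * n)"
  have "t \<odot>\<^bsub>?A \<boxtimes> ?B\<^esub> \<one>\<^bsub>?A \<boxtimes> ?B\<^esub> \<oplus>\<^bsub>?A \<boxtimes> ?B\<^esub> comult_h s r t [^]\<^bsub>?A \<boxtimes> ?B\<^esub> n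
      = t \<odot>\<^bsub>?A \<boxtimes> ?B\<^esub> ?p \<one>\<^bsub>?A\<^esub> \<one>\<^bsub>?B\<^esub> \<oplus>\<^bsub>?A \<boxtimes> ?B\<^esub>
        (?p (h s r [^]\<^bsub>?A\<^esub> n) ?gn \<oplus>\<^bsub>?A \<boxtimes> ?B\<^esub> ?p \<one>\<^bsub>?A\<^esub> (h r t [^]\<^bsub>?B\<^esub> n))"
    by (simp add: pow ptensor_pow tensor_one E.nat_pow_pow)
  also have "\<dots> = ?p (h s r [^]\<^bsub>?A\<^esub> n) ?gn \<oplus>\<^bsub>?A \<boxtimes> ?B\<^esub> ?p \<one>\<^bsub>?A\<^esub> (t \<odot>\<^bsub>?B\<^esub> \<one>\<^bsub>?B\<^esub> \<oplus>\<^bsub>?B\<^esub> h r t [^]\<^bsub>?B\<^esub> n)"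
    by (simp add: ptensor_add_right ptensor_smult_right T.a_lcomm)
  also have "\<dots> = ?p (r \<odot>\<^bsub>?A\<^esub> \<one>\<^bsub>?A\<^esub> \<oplus>\<^bsub>?A\<^esub> h s r [^]\<^bsub>?A\<^esub> n) ?gn"
    unfolding E_rels(4)[where s = r and t = t] by (simp add: ptensor_add_left ptensor_smult_left ptensor_smult_right T.a_comm)
  also have "\<dots> = s \<odot>\<^bsub>?A \<boxtimes> ?B\<^esub> (?p (g s r) (g r t) [^]\<^bsub>?A \<boxtimes> ?B\<^esub> (m * n))"
    by (simp add: E_rels ptensor_smult_left ptensor_pow)
  finally show "t \<odot>\<^bsub>?A \<boxtimes> ?B\<^esub> \<one>\<^bsub>?A \<boxtimes> ?B\<^esub> \<oplus>\<^bsub>?A \<boxtimes> ?B\<^esub> comult_h s r t [^]\<^bsub>?A \<boxtimes> ?B\<^esub> n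
      = s \<odot>\<^bsub>?A \<boxtimes> ?B\<^esub> (?p (g s r) (g r t) [^]\<^bsub>?A \<boxtimes> ?B\<^esub> (m * n))" .
qed

text \<open>Only the existence of a homomorphism with these values matters, since its values on the carrier
  are determined by them; the same holds for the counit, the antipode and the representation below.\<close>

definition D where
  "D s r t = (SOME f. f \<in> alg_hom (E s t) (E s r \<boxtimes> E r t) \<and>
     f (g s t) = ptensor (E s r) (E r t) (g s r) (g r t) \<and>
     f (gi s t) = ptensor (E s r) (E r t) (gi s r) (gi r t) \<and>
     f (h s t) = comult_h s r t)"

lemma D_hom: "D s r t \<in> alg_hom (E s t) (E s r \<boxtimes> E r t)"
  and D_g: "D s r t (g s t) = ptensor (E s r) (E r t) (g s r) (g r t)"
  and D_gi: "D s r t (gi s t) = ptensor (E s r) (E r t) (gi s r) (gi r t)"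
  and D_h: "D s r t (h s t) = comult_h s r t"
  using someI_ex[OF comult_exists[of s t r]] by (auto simp: D_def)

lemma counit_exists:
  "\<exists>f. f \<in> alg_hom (E s s) scalars \<and> f (g s s) = 1 \<and> f (gi s s) = 1 \<and> f (h s s) = 0"
  by (rule E_lift) (use n_gt_1 in \<open>auto simp: scalars_pow zero_power\<close>)

definition eps where
  "eps s = (SOME f. f \<in> alg_hom (E s s) scalars \<and> f (g s s) = 1 \<and> f (gi s s) = 1 \<and> f (h s s) = 0)"

lemma eps_hom: "eps s \<in> alg_hom (E s s) scalars"
  and eps_g: "eps s (g s s) = 1" and eps_gi: "eps s (gi s s) = 1" and eps_h: "eps s (h s s) = 0"
  using someI_ex[OF counit_exists[of s]] by (auto simp: eps_def)

abbreviation antipode_h where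
  "antipode_h s t \<equiv> (- 1) \<odot>\<^bsub>E t s\<^esub> (h t s \<otimes>\<^bsub>E t s\<^esub> gi t s [^]\<^bsub>E t s\<^esub> m)"

text \<open>For the last relation: \<open>(h g\<^sup>-\<^sup>m)\<^sup>n\<close> is \<open>h\<^sup>n g\<^sup>-\<^sup>m\<^sup>n\<close> times a power of \<open>\<lambda>\<^sup>-\<^sup>m\<close>, and together with the sign
  \<open>(-1)\<^sup>n\<close> this factor is \<open>-1\<close> by \<open>primitive_root_product\<close>. So the image of \<open>t + h\<^sup>n\<close> is
  \<open>t - (t g\<^sup>m\<^sup>n - s) g\<^sup>-\<^sup>m\<^sup>n = s g\<^sup>-\<^sup>m\<^sup>n\<close>.\<close>

lemma antipode_exists:
  "\<exists>f. f \<in> alg_hom (E s t) (opp (E t s)) \<and> f (g s t) = gi t s \<and> f (gi s t) = g t s \<and>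
     f (h s t) = antipode_h s t"
proof (rule E_lift)
  let ?E = "E t s" and ?g = "g t s" and ?i = "gi t s" and ?h = "h t s"
  let ?im = "?i [^]\<^bsub>?E\<^esub> m"
  show "k_algebra (opp ?E)" by (rule E.k_algebra_opp)
  show "?i \<in> carrier (opp ?E)" "?g \<in> carrier (opp ?E)" "antipode_h s t \<in> carrier (opp ?E)" by auto
  show "?i \<otimes>\<^bsub>opp ?E\<^esub> ?g = \<one>\<^bsub>opp ?E\<^esub>" "?g \<otimes>\<^bsub>opp ?E\<^esub> ?i = \<one>\<^bsub>opp ?E\<^esub>"
    by (simp_all add: E_rels)
  have "?i \<otimes>\<^bsub>?E\<^esub> (?h \<otimes>\<^bsub>?E\<^esub> ?im) = (?i \<otimes>\<^bsub>?E\<^esub> ?h) \<otimes>\<^bsub>?E\<^esub> ?im"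
    by (simp add: E.m_assoc)
  also have "\<dots> = inverse lam \<odot>\<^bsub>?E\<^esub> (?h \<otimes>\<^bsub>?E\<^esub> (?i \<otimes>\<^bsub>?E\<^esub> ?im))"
    by (simp only: gi_h) (simp add: E.m_assoc)
  also have "?i \<otimes>\<^bsub>?E\<^esub> ?im = ?im \<otimes>\<^bsub>?E\<^esub> ?i"
    using E.nat_pow_Suc2[of ?i t s m] by simp
  finally have ih: "?i \<otimes>\<^bsub>?E\<^esub> (?h \<otimes>\<^bsub>?E\<^esub> ?im) = inverse lam \<odot>\<^bsub>?E\<^esub> (?h \<otimes>\<^bsub>?E\<^esub> (?im \<otimes>\<^bsub>?E\<^esub> ?i))" .
  show "?i \<otimes>\<^bsub>opp ?E\<^esub> antipode_h s t = lam \<odot>\<^bsub>opp ?E\<^esub> (antipode_h s t \<otimes>\<^bsub>opp ?E\<^esub> ?i)"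
    using lam_nonzero by (simp add: ih E.m_assoc)
  let ?q = "inverse lam ^ m"
  have root': "primitive_root_of_unity n ?q"
    by (intro primitive_root_power primitive_root_inverse root coprime)
  have skew: "?im \<otimes>\<^bsub>?E\<^esub> ?h = ?q \<odot>\<^bsub>?E\<^esub> (?h \<otimes>\<^bsub>?E\<^esub> ?im)"
    by (rule E.skew_pow_left) (simp_all add: gi_h)
  have pow_neg: "((- 1) \<odot>\<^bsub>?E\<^esub> x) [^]\<^bsub>?E\<^esub> (k::nat) = (- 1) ^ k \<odot>\<^bsub>?E\<^esub> (x [^]\<^bsub>?E\<^esub> k)" if "x \<in> carrier ?E" for x k
    using that by (induction k) (simp_all add: mult.commute)
  let ?hn = "?h [^]\<^bsub>?E\<^esub> n" and ?in = "?i [^]\<^bsub>?E\<^esub> (m * n)"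
  have "antipode_h s t [^]\<^bsub>opp ?E\<^esub> n = antipode_h s t [^]\<^bsub>?E\<^esub> n"
    by (intro E.opp_pow) auto
  also have "\<dots> = ((- 1) ^ n * ?q ^ (\<Sum>i<n. i)) \<odot>\<^bsub>?E\<^esub> (?hn \<otimes>\<^bsub>?E\<^esub> ?in)"
    by (subst pow_neg, simp, subst E.skew_mult_pow[OF _ _ skew]) (simp_all add: E.nat_pow_pow)
  also have "\<dots> = (- 1) \<odot>\<^bsub>?E\<^esub> (?hn \<otimes>\<^bsub>?E\<^esub> ?in)"
    by (simp only: primitive_root_product[OF root'])
  finally have pow: "antipode_h s t [^]\<^bsub>opp ?E\<^esub> n = (- 1) \<odot>\<^bsub>?E\<^esub> (?hn \<otimes>\<^bsub>?E\<^esub> ?in)" .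
  have "(s \<odot>\<^bsub>?E\<^esub> \<one>\<^bsub>?E\<^esub> \<oplus>\<^bsub>?E\<^esub> ?hn) \<otimes>\<^bsub>?E\<^esub> ?in = (t \<odot>\<^bsub>?E\<^esub> (?g [^]\<^bsub>?E\<^esub> (m * n))) \<otimes>\<^bsub>?E\<^esub> ?in"
    by (simp only: E_rels)
  then have eq: "t \<odot>\<^bsub>?E\<^esub> \<one>\<^bsub>?E\<^esub> = s \<odot>\<^bsub>?E\<^esub> ?in \<oplus>\<^bsub>?E\<^esub> ?hn \<otimes>\<^bsub>?E\<^esub> ?in"
    by (simp add: E.l_distr g_gi_pow)
  show "t \<odot>\<^bsub>opp ?E\<^esub> \<one>\<^bsub>opp ?E\<^esub> \<oplus>\<^bsub>opp ?E\<^esub> antipode_h s t [^]\<^bsub>opp ?E\<^esub> n = s \<odot>\<^bsub>opp ?E\<^esub> (?i [^]\<^bsub>opp ?E\<^esub> (m * n))"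
    unfolding pow by (simp add: E.opp_pow eq E.a_assoc E.scal_minus_one E.r_neg)
qed

definition S where
  "S s t = (SOME f. f \<in> alg_hom (E s t) (opp (E t s)) \<and> f (g s t) = gi t s \<and> f (gi s t) = g t s \<and>
     f (h s t) = antipode_h s t)"

lemma S_hom: "S s t \<in> alg_hom (E s t) (opp (E t s))"
  and S_g: "S s t (g s t) = gi t s" and S_gi: "S s t (gi s t) = g t s"
  and S_h: "S s t (h s t) = antipode_h s t"
  using someI_ex[OF antipode_exists[of s t]] by (auto simp: S_def)

lemma S_lin: "S s t \<in> lin_map (E s t) (E t s)"
  using alg_hom_lin[OF S_hom] by (simp add: lin_map_opp)

lemmas S_closed = lin_map_closed[OF S_lin]
  and D_lin = alg_hom_lin[OF D_hom]
  and eps_lin = alg_hom_lin[OF eps_hom]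
  and D_closed = alg_hom_closed[OF D_hom]

lemma S_mult:
  "x \<in> carrier (E s t) \<Longrightarrow> y \<in> carrier (E s t) \<Longrightarrow> S s t (x \<otimes>\<^bsub>E s t\<^esub> y) = S s t y \<otimes>\<^bsub>E t s\<^esub> S s t x"
  using alg_hom_mult[OF S_hom] by simp

lemma S_one: "S s t \<one>\<^bsub>E s t\<^esub> = \<one>\<^bsub>E t s\<^esub>"
  using alg_hom_one[OF S_hom] by simp

lemma S_pow: "x \<in> carrier (E s t) \<Longrightarrow> S s t (x [^]\<^bsub>E s t\<^esub> (k::nat)) = S s t x [^]\<^bsub>E t s\<^esub> k"
  using alg_hom_pow[OF E_alg E.k_algebra_opp S_hom] E.opp_pow[OF S_closed] by simp

end

context skew_family
begin

lemma D_one: "D s r t \<one>\<^bsub>E s t\<^esub> = ptensor (E s r) (E r t) \<one>\<^bsub>E s r\<^esub> \<one>\<^bsub>E r t\<^esub>"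
  by (simp add: alg_hom_one[OF D_hom] tensor_one)

lemma D_g_pow: "D s r t (g s t [^]\<^bsub>E s t\<^esub> (k::nat)) =
    ptensor (E s r) (E r t) (g s r [^]\<^bsub>E s r\<^esub> k) (g r t [^]\<^bsub>E r t\<^esub> k)"
  by (subst alg_hom_pow[OF _ _ D_hom]) (simp_all add: D_g ptensor_pow)

lemma D_gi_pow: "D s r t (gi s t [^]\<^bsub>E s t\<^esub> (k::nat)) =
    ptensor (E s r) (E r t) (gi s r [^]\<^bsub>E s r\<^esub> k) (gi r t [^]\<^bsub>E r t\<^esub> k)"
  by (subst alg_hom_pow[OF _ _ D_hom]) (simp_all add: D_gi ptensor_pow)

text \<open>Both sides are homomorphisms, and both send \<open>h\<close> to
  \<open>h \<otimes> g\<^sup>m \<otimes> g\<^sup>m + 1 \<otimes> h \<otimes> g\<^sup>m + 1 \<otimes> 1 \<otimes> h\<close>.\<close>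

lemma D_assoc:
  assumes c: "c \<in> carrier (E s t)"
  shows "tensor_assoc (E s p) (E p r) (E r t)
      (tensor_map (E s p \<boxtimes> E p r) (E r t) (D s p r) id (D s r t c)) =
    tensor_map (E s p) (E p r \<boxtimes> E r t) id (D p r t) (D s p t c)"
proof (rule E_hom_eqI[OF _ _ _ _ _ c])
  let ?A = "E s p" and ?B = "E p r" and ?C = "E r t"
  show "(\<lambda>c. tensor_assoc ?A ?B ?C (tensor_map (?A \<boxtimes> ?B) ?C (D s p r) id (D s r t c)))
      \<in> alg_hom (E s t) (?A \<boxtimes> (?B \<boxtimes> ?C))"
    by (rule alg_hom_comp[OF alg_hom_comp[OF D_hom tensor_map_alg_hom] tensor_assoc_alg_hom])
       (auto simp: D_hom alg_hom_id)
  show "(\<lambda>c. tensor_map ?A (?B \<boxtimes> ?C) id (D p r t) (D s p t c)) \<in> alg_hom (E s t) (?A \<boxtimes> (?B \<boxtimes> ?C))"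
    by (rule alg_hom_comp[OF D_hom tensor_map_alg_hom]) (auto simp: D_hom alg_hom_id)
  have L: "tensor_map (?A \<boxtimes> ?B) ?C (D s p r) id \<in> lin_map (E s r \<boxtimes> ?C) ((?A \<boxtimes> ?B) \<boxtimes> ?C)"
    and R: "tensor_map ?A (?B \<boxtimes> ?C) id (D p r t) \<in> lin_map (?A \<boxtimes> E p t) (?A \<boxtimes> (?B \<boxtimes> ?C))"
    and M: "tensor_assoc ?A ?B ?C \<in> lin_map ((?A \<boxtimes> ?B) \<boxtimes> ?C) (?A \<boxtimes> (?B \<boxtimes> ?C))"
    by (auto intro!: tensor_map_lin tensor_assoc_lin D_lin lin_map_id)
  interpret ABC: k_algebra "?A \<boxtimes> (?B \<boxtimes> ?C)" by simp
  interpret ABC': k_algebra "(?A \<boxtimes> ?B) \<boxtimes> ?C" by simp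
  show "tensor_assoc ?A ?B ?C (tensor_map (?A \<boxtimes> ?B) ?C (D s p r) id (D s r t (g s t))) =
      tensor_map ?A (?B \<boxtimes> ?C) id (D p r t) (D s p t (g s t))"
    by (simp add: D_g tensor_map_ptensor D_lin lin_map_id tensor_assoc_ptensor)
  show "tensor_assoc ?A ?B ?C (tensor_map (?A \<boxtimes> ?B) ?C (D s p r) id (D s r t (h s t))) =
      tensor_map ?A (?B \<boxtimes> ?C) id (D p r t) (D s p t (h s t))"
    by (simp add: D_h D_one D_g_pow lin_map_add[OF L] lin_map_add[OF R] lin_map_add[OF M]
        tensor_map_ptensor D_lin lin_map_id tensor_assoc_ptensor ptensor_add_left ptensor_add_right
        ABC.a_assoc)
qed simp

lemma eps_one: "eps s \<one>\<^bsub>E s s\<^esub> = 1"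
  using alg_hom_one[OF eps_hom] by simp

lemma eps_mult:
  "x \<in> carrier (E s s) \<Longrightarrow> y \<in> carrier (E s s) \<Longrightarrow> eps s (x \<otimes>\<^bsub>E s s\<^esub> y) = eps s x * eps s y"
  using alg_hom_mult[OF eps_hom] by simp

lemma eps_add:
  "x \<in> carrier (E s s) \<Longrightarrow> y \<in> carrier (E s s) \<Longrightarrow> eps s (x \<oplus>\<^bsub>E s s\<^esub> y) = eps s x + eps s y"
  using alg_hom_add[OF eps_hom] by simp

lemma eps_smult: "x \<in> carrier (E s s) \<Longrightarrow> eps s (k \<odot>\<^bsub>E s s\<^esub> x) = k * eps s x"
  using alg_hom_smult[OF eps_hom] by simp

lemma eps_g_pow: "eps s (g s s [^]\<^bsub>E s s\<^esub> (k::nat)) = 1"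
  by (subst alg_hom_pow[OF _ _ eps_hom]) (simp_all add: scalars_pow eps_g)

lemma eps_left:
  assumes c: "c \<in> carrier (E s t)"
  shows "tensor_lift (E s t) (\<lambda>x y. eps s x \<odot>\<^bsub>E s t\<^esub> y) (D s s t c) = c"
proof (rule E_hom_eqI[OF _ _ _ _ _ c, where f' = "\<lambda>c. c"])
  let ?e = "tensor_lift (E s t) (\<lambda>x y. eps s x \<odot>\<^bsub>E s t\<^esub> y)"
  have b: "bilin (E s s) (E s t) (E s t) (\<lambda>x y. eps s x \<odot>\<^bsub>E s t\<^esub> y)"
    using lin_map_id(1) by (intro bilin_scal_left eps_lin) auto
  have e: "?e \<in> alg_hom (E s s \<boxtimes> E s t) (E s t)"
    by (rule tensor_lift_alg_hom[OF _ _ _ b]) (simp_all add: eps_mult eps_one mult.commute)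
  show "(\<lambda>c. ?e (D s s t c)) \<in> alg_hom (E s t) (E s t)"
    by (rule alg_hom_comp[OF D_hom e])
  show "?e (D s s t (g s t)) = g s t"
    by (simp add: D_g tensor_lift_ptensor b eps_g)
  show "?e (D s s t (h s t)) = h s t"
    by (simp add: D_h alg_hom_add[OF e] tensor_lift_ptensor b eps_h eps_one)
qed (simp_all add: alg_hom_id)

lemma eps_right:
  assumes c: "c \<in> carrier (E s t)"
  shows "tensor_lift (E s t) (\<lambda>x y. eps t y \<odot>\<^bsub>E s t\<^esub> x) (D s t t c) = c"
proof (rule E_hom_eqI[OF _ _ _ _ _ c, where f' = "\<lambda>c. c"])
  let ?e = "tensor_lift (E s t) (\<lambda>x y. eps t y \<odot>\<^bsub>E s t\<^esub> x)"
  have b: "bilin (E s t) (E t t) (E s t) (\<lambda>x y. eps t y \<odot>\<^bsub>E s t\<^esub> x)"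
    using lin_map_id(1) by (intro bilin_scal_right eps_lin) auto
  have e: "?e \<in> alg_hom (E s t \<boxtimes> E t t) (E s t)"
    by (rule tensor_lift_alg_hom[OF _ _ _ b]) (simp_all add: eps_mult eps_one mult.commute)
  show "(\<lambda>c. ?e (D s t t c)) \<in> alg_hom (E s t) (E s t)"
    by (rule alg_hom_comp[OF D_hom e])
  show "?e (D s t t (g s t)) = g s t"
    by (simp add: D_g tensor_lift_ptensor b eps_g)
  show "?e (D s t t (h s t)) = h s t"
    by (simp add: D_h alg_hom_add[OF e] tensor_lift_ptensor b eps_h eps_g_pow)
qed (simp_all add: alg_hom_id)

text \<open>The map \<open>a \<otimes> b \<mapsto> S(a) b\<close> is no homomorphism, but it sends \<open>u (a \<otimes> b)\<close> to \<open>S(a)\<close> times the image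
  of \<open>u\<close> times \<open>b\<close>. So if the image of \<open>u\<close> is a scalar, it can be pulled out; therefore the elements that
  satisfy the antipode axiom are closed under products.\<close>

lemma antipode_left_mult:
  assumes u: "u \<in> carrier (E s t \<boxtimes> E t s)" and v: "v \<in> carrier (E s t \<boxtimes> E t s)"
    and L: "mult_lift (E t s) (S s t) (\<lambda>y. y) u = e \<odot>\<^bsub>E t s\<^esub> \<one>\<^bsub>E t s\<^esub>"
  shows "mult_lift (E t s) (S s t) (\<lambda>y. y) (u \<otimes>\<^bsub>E s t \<boxtimes> E t s\<^esub> v)
    = e \<odot>\<^bsub>E t s\<^esub> mult_lift (E t s) (S s t) (\<lambda>y. y) v"
proof -
  let ?A = "E s t" and ?B = "E t s"
  let ?L = "mult_lift ?B (S s t) (\<lambda>y. y)"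
  interpret AB: k_algebra "?A \<boxtimes> ?B" by simp
  have L_lin: "?L \<in> lin_map (?A \<boxtimes> ?B) ?B" by (intro mult_lift_lin S_lin lin_map_id) auto
  have 1: "?L (u \<otimes>\<^bsub>?A \<boxtimes> ?B\<^esub> ptensor ?A ?B a b) = S s t a \<otimes>\<^bsub>?B\<^esub> ?L u \<otimes>\<^bsub>?B\<^esub> b"
    if a: "a \<in> carrier ?A" and b: "b \<in> carrier ?B" and u: "u \<in> carrier (?A \<boxtimes> ?B)" for a b u
  proof (rule tensor_lin_map_eqI[OF _ _ _ _ _ _ u])
    show "(\<lambda>u. ?L (u \<otimes>\<^bsub>?A \<boxtimes> ?B\<^esub> ptensor ?A ?B a b)) \<in> lin_map (?A \<boxtimes> ?B) ?B"
      using a b by (intro lin_map_comp[OF AB.lin_map_right_mult L_lin]) auto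
    show "(\<lambda>u. S s t a \<otimes>\<^bsub>?B\<^esub> ?L u \<otimes>\<^bsub>?B\<^esub> b) \<in> lin_map (?A \<boxtimes> ?B) ?B"
      using a b by (intro lin_map_comp[OF lin_map_comp[OF L_lin E.lin_map_left_mult] E.lin_map_right_mult])
        (auto simp: S_closed)
  qed (use a b in \<open>simp_all add: ptensor_mult mult_lift_ptensor S_lin lin_map_id S_mult S_closed E.m_assoc\<close>)
  show ?thesis
  proof (rule tensor_lin_map_eqI[OF _ _ _ _ _ _ v])
    show "(\<lambda>v. ?L (u \<otimes>\<^bsub>?A \<boxtimes> ?B\<^esub> v)) \<in> lin_map (?A \<boxtimes> ?B) ?B"
      using u by (intro lin_map_comp[OF AB.lin_map_left_mult L_lin])
    show "(\<lambda>v. e \<odot>\<^bsub>?B\<^esub> ?L v) \<in> lin_map (?A \<boxtimes> ?B) ?B"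
      by (intro E.lin_map_scal L_lin)
  qed (use u in \<open>simp_all add: 1 L mult_lift_ptensor S_lin lin_map_id S_closed\<close>)
qed

lemma antipode_right_mult:
  assumes u: "u \<in> carrier (E s t \<boxtimes> E t s)" and v: "v \<in> carrier (E s t \<boxtimes> E t s)"
    and L: "mult_lift (E s t) (\<lambda>x. x) (S t s) v = e \<odot>\<^bsub>E s t\<^esub> \<one>\<^bsub>E s t\<^esub>"
  shows "mult_lift (E s t) (\<lambda>x. x) (S t s) (u \<otimes>\<^bsub>E s t \<boxtimes> E t s\<^esub> v)
    = e \<odot>\<^bsub>E s t\<^esub> mult_lift (E s t) (\<lambda>x. x) (S t s) u"
proof -
  let ?A = "E s t" and ?B = "E t s"
  let ?L = "mult_lift ?A (\<lambda>x. x) (S t s)"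
  interpret AB: k_algebra "?A \<boxtimes> ?B" by simp
  have L_lin: "?L \<in> lin_map (?A \<boxtimes> ?B) ?A" by (intro mult_lift_lin S_lin lin_map_id) auto
  have 1: "?L (ptensor ?A ?B a b \<otimes>\<^bsub>?A \<boxtimes> ?B\<^esub> v) = a \<otimes>\<^bsub>?A\<^esub> ?L v \<otimes>\<^bsub>?A\<^esub> S t s b"
    if a: "a \<in> carrier ?A" and b: "b \<in> carrier ?B" and v: "v \<in> carrier (?A \<boxtimes> ?B)" for a b v
  proof (rule tensor_lin_map_eqI[OF _ _ _ _ _ _ v])
    show "(\<lambda>v. ?L (ptensor ?A ?B a b \<otimes>\<^bsub>?A \<boxtimes> ?B\<^esub> v)) \<in> lin_map (?A \<boxtimes> ?B) ?A"
      using a b by (intro lin_map_comp[OF AB.lin_map_left_mult L_lin]) auto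
    show "(\<lambda>v. a \<otimes>\<^bsub>?A\<^esub> ?L v \<otimes>\<^bsub>?A\<^esub> S t s b) \<in> lin_map (?A \<boxtimes> ?B) ?A"
      using a b by (intro lin_map_comp[OF lin_map_comp[OF L_lin E.lin_map_left_mult] E.lin_map_right_mult])
        (auto simp: S_closed)
  qed (use a b in \<open>simp_all add: ptensor_mult mult_lift_ptensor S_lin lin_map_id S_mult S_closed E.m_assoc\<close>)
  show ?thesis
  proof (rule tensor_lin_map_eqI[OF _ _ _ _ _ _ u])
    show "(\<lambda>u. ?L (u \<otimes>\<^bsub>?A \<boxtimes> ?B\<^esub> v)) \<in> lin_map (?A \<boxtimes> ?B) ?A"
      using v by (intro lin_map_comp[OF AB.lin_map_right_mult L_lin])
    show "(\<lambda>u. e \<odot>\<^bsub>?A\<^esub> ?L u) \<in> lin_map (?A \<boxtimes> ?B) ?A"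
      by (intro E.lin_map_scal L_lin)
  qed (use v in \<open>simp_all add: 1 L mult_lift_ptensor S_lin lin_map_id S_closed\<close>)
qed

lemma S_left:
  assumes c: "c \<in> carrier (E s s)"
  shows "mult_lift (E t s) (S s t) (\<lambda>y. y) (D s t s c) = eps s c \<odot>\<^bsub>E t s\<^esub> \<one>\<^bsub>E t s\<^esub>"
proof -
  let ?L = "mult_lift (E t s) (S s t) (\<lambda>y. y)"
  have L_lin: "?L \<in> lin_map (E s t \<boxtimes> E t s) (E t s)" by (intro mult_lift_lin S_lin lin_map_id) auto
  note L_p = mult_lift_ptensor[OF E_alg E_alg E_alg S_lin lin_map_id(1)]
  have mult: "?L (D s t s (x \<otimes>\<^bsub>E s s\<^esub> y)) = eps s (x \<otimes>\<^bsub>E s s\<^esub> y) \<odot>\<^bsub>E t s\<^esub> \<one>\<^bsub>E t s\<^esub>"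
    if "x \<in> carrier (E s s)" "y \<in> carrier (E s s)"
      "?L (D s t s x) = eps s x \<odot>\<^bsub>E t s\<^esub> \<one>\<^bsub>E t s\<^esub>" "?L (D s t s y) = eps s y \<odot>\<^bsub>E t s\<^esub> \<one>\<^bsub>E t s\<^esub>" for x y
    using that by (simp add: alg_hom_mult[OF D_hom] antipode_left_mult D_closed eps_mult)
  have h: "?L (D s t s (h s s)) = eps s (h s s) \<odot>\<^bsub>E t s\<^esub> \<one>\<^bsub>E t s\<^esub>"
    by (simp add: D_h lin_map_add[OF L_lin] L_p S_h S_one eps_h E.m_assoc g_gi_pow
        E.scal_minus_one_cancel S_closed)
  show ?thesis
    using c
    by (induction rule: E_induct)
       (simp_all add: mult h D_one L_p S_one eps_one D_g D_gi S_g S_gi eps_g eps_gi E_rels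
         lin_map_add[OF D_lin] lin_map_smult[OF D_lin] lin_map_add[OF L_lin] lin_map_smult[OF L_lin]
         D_closed eps_add eps_smult E.scal_add_left)
qed

lemma S_right:
  assumes c: "c \<in> carrier (E s s)"
  shows "mult_lift (E s t) (\<lambda>x. x) (S t s) (D s t s c) = eps s c \<odot>\<^bsub>E s t\<^esub> \<one>\<^bsub>E s t\<^esub>"
proof -
  let ?L = "mult_lift (E s t) (\<lambda>x. x) (S t s)"
  have L_lin: "?L \<in> lin_map (E s t \<boxtimes> E t s) (E s t)" by (intro mult_lift_lin S_lin lin_map_id) auto
  note L_p = mult_lift_ptensor[OF E_alg E_alg E_alg lin_map_id(1) S_lin]
  have mult: "?L (D s t s (x \<otimes>\<^bsub>E s s\<^esub> y)) = eps s (x \<otimes>\<^bsub>E s s\<^esub> y) \<odot>\<^bsub>E s t\<^esub> \<one>\<^bsub>E s t\<^esub>"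
    if "x \<in> carrier (E s s)" "y \<in> carrier (E s s)"
      "?L (D s t s x) = eps s x \<odot>\<^bsub>E s t\<^esub> \<one>\<^bsub>E s t\<^esub>" "?L (D s t s y) = eps s y \<odot>\<^bsub>E s t\<^esub> \<one>\<^bsub>E s t\<^esub>" for x y
    using that by (simp add: alg_hom_mult[OF D_hom] antipode_right_mult D_closed eps_mult mult.commute)
  have h: "?L (D s t s (h s s)) = eps s (h s s) \<odot>\<^bsub>E s t\<^esub> \<one>\<^bsub>E s t\<^esub>"
    by (simp add: D_h lin_map_add[OF L_lin] L_p S_h S_one S_pow S_g eps_h
        E.scal_minus_one_cancel S_closed)
  show ?thesis
    using c
    by (induction rule: E_induct)
       (simp_all add: mult h D_one L_p S_one eps_one D_g D_gi S_g S_gi eps_g eps_gi E_rels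
         lin_map_add[OF D_lin] lin_map_smult[OF D_lin] lin_map_add[OF L_lin] lin_map_smult[OF L_lin]
         D_closed eps_add eps_smult E.scal_add_left)
qed

lemma cogroupoid: "cogroupoid E D eps S"
  by (rule cogroupoid.intro)
     (rule E_alg D_hom D_assoc eps_hom eps_left eps_right S_lin S_one S_left S_right; assumption?)+

lemma S_S_hom: "(\<lambda>c. S t s (S s t c)) \<in> alg_hom (E s t) (E s t)"
  by (rule alg_homI)
     (simp_all add: S_closed S_mult S_one lin_map_add[OF S_lin] lin_map_smult[OF S_lin])

lemma S_S_h: "S t s (S s t (h s t)) = lam ^ m \<odot>\<^bsub>E s t\<^esub> h s t"
proof -
  let ?gm = "g s t [^]\<^bsub>E s t\<^esub> m" and ?im = "gi s t [^]\<^bsub>E s t\<^esub> m"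
  have "S t s (S s t (h s t)) = ?gm \<otimes>\<^bsub>E s t\<^esub> (h s t \<otimes>\<^bsub>E s t\<^esub> ?im)"
    by (simp add: S_h lin_map_smult[OF S_lin] S_mult S_pow S_gi)
  also have "\<dots> = (?gm \<otimes>\<^bsub>E s t\<^esub> h s t) \<otimes>\<^bsub>E s t\<^esub> ?im"
    by (simp add: E.m_assoc)
  also have "\<dots> = lam ^ m \<odot>\<^bsub>E s t\<^esub> h s t"
    by (simp only: g_pow_h) (simp add: E.m_assoc g_gi_pow)
  finally show ?thesis .
qed

text \<open>The square of the antipode is an endomorphism that fixes \<open>g\<close> and scales \<open>h\<close> by \<open>\<lambda>\<^sup>m\<close>, so its
  \<open>n\<close>-th power is the identity.\<close>

lemma S_bij: "bij_betw (S s s) (carrier (E s s)) (carrier (E s s))"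
proof -
  let ?E = "E s s"
  define T where "T = (\<lambda>c. S s s (S s s c))"
  have T: "T \<in> alg_hom ?E ?E" unfolding T_def by (rule S_S_hom)
  have pow: "(T ^^ k) \<in> alg_hom ?E ?E" for k
  proof (induction k)
    case (Suc k)
    then show ?case using alg_hom_comp[OF Suc T] by (simp add: o_def)
  qed (simp add: alg_hom_id)
  have pg: "(T ^^ k) (g s s) = g s s" for k
    by (induction k) (simp_all add: T_def S_g S_gi)
  have ph: "(T ^^ k) (h s s) = (lam ^ m) ^ k \<odot>\<^bsub>?E\<^esub> h s s" for k
  proof (induction k)
    case (Suc k)
    have "T ((lam ^ m) ^ k \<odot>\<^bsub>?E\<^esub> h s s) = (lam ^ m) ^ k \<odot>\<^bsub>?E\<^esub> T (h s s)"
      by (rule alg_hom_smult[OF T]) simp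
    also have "T (h s s) = lam ^ m \<odot>\<^bsub>?E\<^esub> h s s" by (simp add: T_def S_S_h)
    finally show ?case using Suc by (simp add: mult.commute)
  qed simp
  have "(lam ^ m) ^ n = 1"
    using primitive_root_power[OF root coprime] by (simp add: primitive_root_of_unity_def)
  then have Tn: "(T ^^ n) c = c" if "c \<in> carrier ?E" for c
    by (intro E_hom_eqI[OF _ pow alg_hom_id(1) _ _ that]) (simp_all add: pg ph)
  obtain k where k: "n = Suc k" using n_gt_1 by (cases n) auto
  have Tk: "(T ^^ k) c \<in> carrier ?E" if "c \<in> carrier ?E" for c
    using pow that by (rule alg_hom_closed)
  show ?thesis
    unfolding bij_betw_def
  proof
    show "inj_on (S s s) (carrier ?E)"
    proof (rule inj_onI)
      fix x y assume x: "x \<in> carrier ?E" and y: "y \<in> carrier ?E" and "S s s x = S s s y"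
      then have "T x = T y" by (simp add: T_def)
      then have "(T ^^ n) x = (T ^^ n) y" by (simp add: k funpow_Suc_right del: funpow.simps)
      then show "x = y" using x y by (simp add: Tn)
    qed
    show "S s s ` carrier ?E = carrier ?E"
    proof (intro equalityI subsetI)
      fix y assume y: "y \<in> carrier ?E"
      have "S s s (S s s ((T ^^ k) y)) = y"
        using Tn[OF y] by (simp add: k T_def)
      then show "y \<in> S s s ` carrier ?E"
        using Tk[OF y] S_closed by (metis imageI)
    qed (auto simp: S_closed)
  qed
qed

end

section \<open>Endomorphism algebras of function spaces\<close>

locale function_subspace =
  fixes W :: "('x \<Rightarrow> 'k::field) set"
  assumes W_zero: "(\<lambda>_. 0) \<in> W"
    and W_add: "F \<in> W \<Longrightarrow> F' \<in> W \<Longrightarrow> (\<lambda>x. F x + F' x) \<in> W"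
    and W_scale: "F \<in> W \<Longrightarrow> (\<lambda>x. c * F x) \<in> W"
begin

text \<open>Endomorphisms are set to zero outside \<open>W\<close>, so that equality of functions is equality on \<open>W\<close>.\<close>

definition is_endo :: "(('x \<Rightarrow> 'k) \<Rightarrow> ('x \<Rightarrow> 'k)) \<Rightarrow> bool" where
  "is_endo T \<longleftrightarrow> (\<forall>F\<in>W. T F \<in> W) \<and> (\<forall>F. F \<notin> W \<longrightarrow> T F = (\<lambda>_. 0)) \<and>
     (\<forall>F\<in>W. \<forall>F'\<in>W. T (\<lambda>x. F x + F' x) = (\<lambda>x. T F x + T F' x)) \<and>
     (\<forall>c. \<forall>F\<in>W. T (\<lambda>x. c * F x) = (\<lambda>x. c * T F x))"

definition restr :: "(('x \<Rightarrow> 'k) \<Rightarrow> ('x \<Rightarrow> 'k)) \<Rightarrow> ('x \<Rightarrow> 'k) \<Rightarrow> ('x \<Rightarrow> 'k)" where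
  "restr T F = (if F \<in> W then T F else (\<lambda>_. 0))"

definition endo :: "('k, ('x \<Rightarrow> 'k) \<Rightarrow> ('x \<Rightarrow> 'k)) module" where
  "endo = \<lparr>carrier = Collect is_endo, monoid.mult = (\<lambda>S T F. S (T F)), one = restr (\<lambda>F. F),
     zero = (\<lambda>_ _. 0), add = (\<lambda>S T F x. S F x + T F x), smult = (\<lambda>c T F x. c * T F x)\<rparr>"

lemma endo_simps [simp]:
  "carrier endo = Collect is_endo" "S \<otimes>\<^bsub>endo\<^esub> T = (\<lambda>F. S (T F))" "\<one>\<^bsub>endo\<^esub> = restr (\<lambda>F. F)"
  "\<zero>\<^bsub>endo\<^esub> = (\<lambda>_ _. 0)" "S \<oplus>\<^bsub>endo\<^esub> T = (\<lambda>F x. S F x + T F x)" "c \<odot>\<^bsub>endo\<^esub> T = (\<lambda>F x. c * T F x)"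
  by (simp_all add: endo_def)

lemma is_endoD:
  assumes "is_endo T"
  shows "F \<in> W \<Longrightarrow> T F \<in> W" "F \<notin> W \<Longrightarrow> T F = (\<lambda>_. 0)"
    "F \<in> W \<Longrightarrow> F' \<in> W \<Longrightarrow> T (\<lambda>x. F x + F' x) = (\<lambda>x. T F x + T F' x)"
    "F \<in> W \<Longrightarrow> T (\<lambda>x. c * F x) = (\<lambda>x. c * T F x)"
  using assms unfolding is_endo_def by blast+

lemma is_endo_in: "is_endo T \<Longrightarrow> T F \<in> W"
  by (cases "F \<in> W") (simp_all add: is_endoD W_zero)

lemma is_endo_zero: "is_endo T \<Longrightarrow> T (\<lambda>_. 0) = (\<lambda>_. 0)"
  using is_endoD(4)[OF _ W_zero, of T 0] by simp

lemma is_endo_restr: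
  assumes "\<And>F. F \<in> W \<Longrightarrow> T F \<in> W"
    and "\<And>F F'. T (\<lambda>x. F x + F' x) = (\<lambda>x. T F x + T F' x)" "\<And>c F. T (\<lambda>x. c * F x) = (\<lambda>x. c * T F x)"
  shows "is_endo (restr T)"
  using assms by (simp add: is_endo_def restr_def W_add W_scale)

lemma is_endo_null: "is_endo (\<lambda>_ _. 0)"
  unfolding is_endo_def by (simp add: W_zero)

lemma is_endo_id: "is_endo (restr (\<lambda>F. F))"
  by (rule is_endo_restr) auto

lemma endo_closed:
  assumes S: "is_endo S" and T: "is_endo T"
  shows "is_endo (\<lambda>F x. S F x + T F x)" "is_endo (\<lambda>F x. c * T F x)" "is_endo (\<lambda>F. S (T F))"
proof -
  note S' = is_endoD[OF S] and T' = is_endoD[OF T]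
  show "is_endo (\<lambda>F x. S F x + T F x)"
    unfolding is_endo_def by (simp add: S' T' W_add algebra_simps)
  show "is_endo (\<lambda>F x. c * T F x)"
    unfolding is_endo_def by (simp add: T' W_scale algebra_simps)
  show "is_endo (\<lambda>F. S (T F))"
    unfolding is_endo_def by (simp add: S' T' is_endo_zero[OF S])
qed

lemma k_algebra_endo: "k_algebra endo"
proof (rule k_algebraI)
  show "ring endo"
  proof (rule ringI)
    show "abelian_group endo"
    proof (rule abelian_groupI)
      fix T assume "T \<in> carrier endo"
      then show "\<exists>S\<in>carrier endo. S \<oplus>\<^bsub>endo\<^esub> T = \<zero>\<^bsub>endo\<^esub>"
        using endo_closed(2)[of T T "- 1"] by (intro bexI[of _ "\<lambda>F x. - T F x"]) simp_all
    qed (auto intro: endo_closed is_endo_null simp: add_ac)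
    show "Group.monoid endo"
    proof (rule monoidI)
      fix T assume T: "T \<in> carrier endo"
      then show "\<one>\<^bsub>endo\<^esub> \<otimes>\<^bsub>endo\<^esub> T = T"
        by (auto simp: restr_def is_endo_in)
      show "T \<otimes>\<^bsub>endo\<^esub> \<one>\<^bsub>endo\<^esub> = T"
        using T by (auto simp: restr_def is_endo_zero is_endoD(2))
    qed (auto intro: endo_closed is_endo_id)
    fix S T U assume "S \<in> carrier endo" "T \<in> carrier endo" "U \<in> carrier endo"
    then show "U \<otimes>\<^bsub>endo\<^esub> (S \<oplus>\<^bsub>endo\<^esub> T) = U \<otimes>\<^bsub>endo\<^esub> S \<oplus>\<^bsub>endo\<^esub> U \<otimes>\<^bsub>endo\<^esub> T"
      by (simp add: is_endoD(3) is_endo_in)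
  qed auto
  fix c :: 'k and S T assume "S \<in> carrier endo" "T \<in> carrier endo"
  then show "S \<otimes>\<^bsub>endo\<^esub> (c \<odot>\<^bsub>endo\<^esub> T) = c \<odot>\<^bsub>endo\<^esub> (S \<otimes>\<^bsub>endo\<^esub> T)"
    by (simp add: is_endoD(4) is_endo_in)
qed (auto intro: endo_closed simp: algebra_simps)

end


section \<open>The integral\<close>

context skew_family
begin

text \<open>Think of \<open>F(i, j)\<close> as the value of a functional at \<open>g\<^sup>i h\<^sup>j\<close>. On the algebra with an invertible \<open>g\<close>
  and the single relation \<open>g h = \<lambda> h g\<close>, a functional descends to \<open>E s t\<close> exactly if it satisfies this recurrence. The operators
  below are the action \<open>(a F)(z) = F(z a)\<close> of the generators, and the recurrence makes the last relation
  hold.\<close>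

definition recurrent :: "'k \<Rightarrow> 'k \<Rightarrow> (int \<times> nat \<Rightarrow> 'k) set" where
  "recurrent s t = {F. \<forall>i j. F (i, j + n) = s * F (i + int (m * n), j) - t * F (i, j)}"

lemma recurrentD: "F \<in> recurrent s t \<Longrightarrow> F (i, j + n) = s * F (i + int (m * n), j) - t * F (i, j)"
  by (simp add: recurrent_def)

lemma recurrentI:
  "(\<And>i j. F (i, j + n) = s * F (i + int (m * n), j) - t * F (i, j)) \<Longrightarrow> F \<in> recurrent s t"
  by (simp add: recurrent_def)

sublocale W: function_subspace "recurrent s t" for s t
proof
  show "(\<lambda>_. 0) \<in> recurrent s t" by (rule recurrentI) simp
  fix F assume F: "F \<in> recurrent s t"
  show "(\<lambda>x. c * F x) \<in> recurrent s t" for c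
    by (rule recurrentI, simp only: recurrentD[OF F]) (simp add: right_diff_distrib mult.left_commute)
  fix F' assume F': "F' \<in> recurrent s t"
  show "(\<lambda>x. F x + F' x) \<in> recurrent s t"
    by (rule recurrentI, simp only: recurrentD[OF F] recurrentD[OF F']) (simp add: algebra_simps)
qed

definition gT :: "(int \<times> nat \<Rightarrow> 'k) \<Rightarrow> int \<times> nat \<Rightarrow> 'k" where
  "gT F = (\<lambda>(i, j). inverse lam ^ j * F (i + 1, j))"

definition giT :: "(int \<times> nat \<Rightarrow> 'k) \<Rightarrow> int \<times> nat \<Rightarrow> 'k" where
  "giT F = (\<lambda>(i, j). lam ^ j * F (i - 1, j))"

definition hT :: "(int \<times> nat \<Rightarrow> 'k) \<Rightarrow> int \<times> nat \<Rightarrow> 'k" where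
  "hT F = (\<lambda>(i, j). F (i, j + 1))"

lemma lam_n: "lam ^ n = 1"
  using root by (simp add: primitive_root_of_unity_def)

lemma recurrent_shift:
  assumes F: "F \<in> recurrent s t"
  shows "gT F \<in> recurrent s t" "giT F \<in> recurrent s t" "hT F \<in> recurrent s t"
proof -
  have 1: "inverse lam ^ (j + n) = inverse lam ^ j" "lam ^ (j + n) = lam ^ j" for j
    by (simp_all add: power_add power_inverse lam_n)
  have 2: "i + int (m * n) + 1 = i + 1 + int (m * n)" "i + int (m * n) - 1 = i - 1 + int (m * n)" for i
    by auto
  show "gT F \<in> recurrent s t" "giT F \<in> recurrent s t"
    unfolding recurrent_def gT_def giT_def
    by (auto simp only: mem_Collect_eq prod.case 1 2 recurrentD[OF F] right_diff_distrib mult.left_commute)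
  have 3: "j + n + 1 = j + 1 + n" for j by simp
  show "hT F \<in> recurrent s t"
    unfolding recurrent_def hT_def
    by (simp only: mem_Collect_eq prod.case 3 recurrentD[OF F]) simp
qed

abbreviation op where "op s t T \<equiv> function_subspace.restr (recurrent s t) T"

lemma op_closed:
  "op s t gT \<in> carrier (W.endo s t)" "op s t giT \<in> carrier (W.endo s t)" "op s t hT \<in> carrier (W.endo s t)"
proof -
  show "op s t gT \<in> carrier (W.endo s t)"
    by (simp, rule W.is_endo_restr[OF recurrent_shift(1)]) (auto simp: gT_def algebra_simps)
  show "op s t giT \<in> carrier (W.endo s t)"
    by (simp, rule W.is_endo_restr[OF recurrent_shift(2)]) (auto simp: giT_def algebra_simps)
  show "op s t hT \<in> carrier (W.endo s t)"
    by (simp, rule W.is_endo_restr[OF recurrent_shift(3)]) (auto simp: hT_def algebra_simps)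
qed

lemma op_apply: "F \<in> recurrent s t \<Longrightarrow> op s t T F = T F"
  by (simp add: W.restr_def)

lemma op_g_pow:
  assumes F: "F \<in> recurrent s t"
  shows "(op s t gT [^]\<^bsub>W.endo s t\<^esub> (k::nat)) F = (\<lambda>(i, j). inverse lam ^ (j * k) * F (i + int k, j))"
  using F
proof (induction k arbitrary: F)
  case (Suc k)
  interpret M: k_algebra "W.endo s t" by (rule W.k_algebra_endo)
  have "(op s t gT [^]\<^bsub>W.endo s t\<^esub> Suc k) F = (op s t gT [^]\<^bsub>W.endo s t\<^esub> k) (gT F)"
    using Suc.prems by (simp add: op_apply)
  also have "\<dots> = (\<lambda>(i, j). inverse lam ^ (j * k) * gT F (i + int k, j))"
    by (intro Suc.IH recurrent_shift Suc.prems)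
  also have "\<dots> = (\<lambda>(i, j). inverse lam ^ (j * Suc k) * F (i + int (Suc k), j))"
    by (auto simp: gT_def power_add add_ac)
  finally show ?case .
qed (simp add: op_apply)

lemma op_gi_pow:
  assumes F: "F \<in> recurrent s t"
  shows "(op s t giT [^]\<^bsub>W.endo s t\<^esub> (k::nat)) F = (\<lambda>(i, j). lam ^ (j * k) * F (i - int k, j))"
  using F
proof (induction k arbitrary: F)
  case (Suc k)
  interpret M: k_algebra "W.endo s t" by (rule W.k_algebra_endo)
  have "(op s t giT [^]\<^bsub>W.endo s t\<^esub> Suc k) F = (op s t giT [^]\<^bsub>W.endo s t\<^esub> k) (giT F)"
    using Suc.prems by (simp add: op_apply)
  also have "\<dots> = (\<lambda>(i, j). lam ^ (j * k) * giT F (i - int k, j))"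
    by (intro Suc.IH recurrent_shift Suc.prems)
  also have "\<dots> = (\<lambda>(i, j). lam ^ (j * Suc k) * F (i - int (Suc k), j))"
    by (auto simp: giT_def power_add algebra_simps)
  finally show ?case .
qed (simp add: op_apply)

lemma op_h_pow:
  assumes F: "F \<in> recurrent s t"
  shows "(op s t hT [^]\<^bsub>W.endo s t\<^esub> (k::nat)) F = (\<lambda>(i, j). F (i, j + k))"
  using F
proof (induction k arbitrary: F)
  case (Suc k)
  interpret M: k_algebra "W.endo s t" by (rule W.k_algebra_endo)
  have "(op s t hT [^]\<^bsub>W.endo s t\<^esub> Suc k) F = (op s t hT [^]\<^bsub>W.endo s t\<^esub> k) (hT F)"
    using Suc.prems by (simp add: op_apply)
  also have "\<dots> = (\<lambda>(i, j). hT F (i, j + k))"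
    by (intro Suc.IH recurrent_shift Suc.prems)
  also have "\<dots> = (\<lambda>(i, j). F (i, j + Suc k))"
    by (simp add: hT_def)
  finally show ?case .
qed (simp add: op_apply)

lemma endo_eqI:
  assumes "T \<in> carrier (W.endo s t)" "U \<in> carrier (W.endo s t)" "\<And>F. F \<in> recurrent s t \<Longrightarrow> T F = U F"
  shows "T = U"
proof
  fix F show "T F = U F"
    using assms by (cases "F \<in> recurrent s t") (simp_all add: W.is_endoD(2))
qed

lemma rep_exists:
  "\<exists>R. R \<in> alg_hom (E s t) (W.endo s t) \<and> R (g s t) = op s t gT \<and> R (gi s t) = op s t giT \<and>
     R (h s t) = op s t hT"
proof (rule E_lift[OF W.k_algebra_endo op_closed])
  interpret M: k_algebra "W.endo s t" by (rule W.k_algebra_endo)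
  note cl = op_closed[of s t]
  show "op s t gT \<otimes>\<^bsub>W.endo s t\<^esub> op s t giT = \<one>\<^bsub>W.endo s t\<^esub>"
  proof (rule endo_eqI)
    fix F assume "F \<in> recurrent s t"
    then show "(op s t gT \<otimes>\<^bsub>W.endo s t\<^esub> op s t giT) F = \<one>\<^bsub>W.endo s t\<^esub> F"
      by (simp add: op_apply recurrent_shift)
         (simp add: gT_def giT_def fun_eq_iff mult.assoc[symmetric] power_mult_distrib[symmetric] lam_nonzero)
  qed (use M.m_closed[OF cl(1,2)] M.one_closed in auto)
  show "op s t giT \<otimes>\<^bsub>W.endo s t\<^esub> op s t gT = \<one>\<^bsub>W.endo s t\<^esub>"
  proof (rule endo_eqI)
    fix F assume "F \<in> recurrent s t"
    then show "(op s t giT \<otimes>\<^bsub>W.endo s t\<^esub> op s t gT) F = \<one>\<^bsub>W.endo s t\<^esub> F"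
      by (simp add: op_apply recurrent_shift)
         (simp add: gT_def giT_def fun_eq_iff mult.assoc[symmetric] power_mult_distrib[symmetric] lam_nonzero)
  qed (use M.m_closed[OF cl(2,1)] M.one_closed in auto)
  show "op s t gT \<otimes>\<^bsub>W.endo s t\<^esub> op s t hT = lam \<odot>\<^bsub>W.endo s t\<^esub> (op s t hT \<otimes>\<^bsub>W.endo s t\<^esub> op s t gT)"
  proof (rule endo_eqI)
    fix F assume "F \<in> recurrent s t"
    then show "(op s t gT \<otimes>\<^bsub>W.endo s t\<^esub> op s t hT) F
        = (lam \<odot>\<^bsub>W.endo s t\<^esub> (op s t hT \<otimes>\<^bsub>W.endo s t\<^esub> op s t gT)) F"
      by (simp add: op_apply recurrent_shift)
         (simp add: gT_def hT_def fun_eq_iff mult.assoc[symmetric] lam_nonzero)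
  qed (use M.m_closed[OF cl(1,3)] M.scal_closed[OF M.m_closed[OF cl(3,1)]] in auto)
  show "t \<odot>\<^bsub>W.endo s t\<^esub> \<one>\<^bsub>W.endo s t\<^esub> \<oplus>\<^bsub>W.endo s t\<^esub> op s t hT [^]\<^bsub>W.endo s t\<^esub> n
      = s \<odot>\<^bsub>W.endo s t\<^esub> (op s t gT [^]\<^bsub>W.endo s t\<^esub> (m * n))"
  proof (rule endo_eqI)
    show "t \<odot>\<^bsub>W.endo s t\<^esub> \<one>\<^bsub>W.endo s t\<^esub> \<oplus>\<^bsub>W.endo s t\<^esub> op s t hT [^]\<^bsub>W.endo s t\<^esub> n \<in> carrier (W.endo s t)"
      by (intro M.a_closed M.scal_closed M.nat_pow_closed M.one_closed cl)
    show "s \<odot>\<^bsub>W.endo s t\<^esub> (op s t gT [^]\<^bsub>W.endo s t\<^esub> (m * n)) \<in> carrier (W.endo s t)"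
      by (intro M.scal_closed M.nat_pow_closed cl)
    fix F assume F: "F \<in> recurrent s t"
    have 1: "inverse lam ^ (j * (m * n)) = 1" for j
      using lam_n by (metis inverse_1 mult.assoc mult.commute power_inverse power_mult power_one)
    show "(t \<odot>\<^bsub>W.endo s t\<^esub> \<one>\<^bsub>W.endo s t\<^esub> \<oplus>\<^bsub>W.endo s t\<^esub> op s t hT [^]\<^bsub>W.endo s t\<^esub> n) F
      = (s \<odot>\<^bsub>W.endo s t\<^esub> (op s t gT [^]\<^bsub>W.endo s t\<^esub> (m * n))) F"
      by (simp only: W.endo_simps op_g_pow[OF F] op_h_pow[OF F] op_apply[OF F])
         (auto simp: fun_eq_iff 1 recurrentD[OF F])
  qed
qed

definition rep where
  "rep s t = (SOME R. R \<in> alg_hom (E s t) (W.endo s t) \<and> R (g s t) = op s t gT \<and>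
     R (gi s t) = op s t giT \<and> R (h s t) = op s t hT)"

lemma rep_hom: "rep s t \<in> alg_hom (E s t) (W.endo s t)"
  and rep_g: "rep s t (g s t) = op s t gT" and rep_gi: "rep s t (gi s t) = op s t giT"
  and rep_h: "rep s t (h s t) = op s t hT"
  using someI_ex[OF rep_exists[of s t]] by (auto simp: rep_def)

text \<open>The solution of the recurrence with initial values \<open>1\<close> at \<open>(0, n - 1)\<close> and \<open>0\<close> elsewhere; the recursion
  runs over the blocks of length \<open>n\<close> of the second argument.\<close>

primrec delta_blocks :: "'k \<Rightarrow> 'k \<Rightarrow> nat \<Rightarrow> int \<Rightarrow> nat \<Rightarrow> 'k" where
  "delta_blocks s t 0 i r = (if i = 0 \<and> r = n - 1 then 1 else 0)"
| "delta_blocks s t (Suc q) i r = s * delta_blocks s t q (i + int (m * n)) r - t * delta_blocks s t q i r"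

definition delta :: "'k \<Rightarrow> 'k \<Rightarrow> int \<times> nat \<Rightarrow> 'k" where
  "delta s t = (\<lambda>(i, j). delta_blocks s t (j div n) i (j mod n))"

lemma delta_recurrent: "delta s t \<in> recurrent s t"
  using n_gt_1 by (simp add: recurrent_def delta_def div_add_self2)

lemma delta_basis: "j < n \<Longrightarrow> delta s t (i, j) = (if i = 0 \<and> j = n - 1 then 1 else 0)"
  by (simp add: delta_def)

definition integral :: "'k \<Rightarrow> 'k \<Rightarrow> ('k, gens) free_alg set \<Rightarrow> 'k" where
  "integral s t z = rep s t z (delta s t) (0, 0)"

lemma integral_lin: "integral s t \<in> lin_map (E s t) scalars"
  unfolding integral_def
  by (rule lin_mapI) (simp_all add: alg_hom_add[OF rep_hom] alg_hom_smult[OF rep_hom])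

text \<open>Integral powers of \<open>g\<close>; the negative ones are powers of the generator \<open>gi\<close>, whose image under
  homomorphisms is known.\<close>

definition gpow :: "'k \<Rightarrow> 'k \<Rightarrow> int \<Rightarrow> ('k, gens) free_alg set" where
  "gpow s t i = (if 0 \<le> i then g s t [^]\<^bsub>E s t\<^esub> nat i else gi s t [^]\<^bsub>E s t\<^esub> nat (- i))"

lemma gpow_closed [simp]: "gpow s t i \<in> carrier (E s t)"
  by (simp add: gpow_def del: pow_nat)

lemma rep_closed: "z \<in> carrier (E s t) \<Longrightarrow> F \<in> recurrent s t \<Longrightarrow> rep s t z F \<in> recurrent s t"
  using alg_hom_closed[OF rep_hom, of z s t] by (simp add: W.is_endoD)

lemma rep_gpow:
  assumes F: "F \<in> recurrent s t"
  shows "rep s t (gpow s t i) F (0, 0) = F (i, 0)"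
  using op_g_pow[OF F, of "nat i"] op_gi_pow[OF F, of "nat (- i)"]
  by (simp add: gpow_def alg_hom_pow[OF _ W.k_algebra_endo rep_hom] rep_g rep_gi del: pow_nat)

lemma integral_basis:
  assumes "j < n"
  shows "integral s t (gpow s t i \<otimes>\<^bsub>E s t\<^esub> h s t [^]\<^bsub>E s t\<^esub> j) = (if i = 0 \<and> j = n - 1 then 1 else 0)"
proof -
  have "rep s t (h s t [^]\<^bsub>E s t\<^esub> j) (delta s t) = (\<lambda>(i, j'). delta s t (i, j' + j))"
    by (simp add: alg_hom_pow[OF _ W.k_algebra_endo rep_hom] rep_h op_h_pow delta_recurrent)
  moreover have "rep s t (h s t [^]\<^bsub>E s t\<^esub> j) (delta s t) \<in> recurrent s t"
    by (simp add: rep_closed delta_recurrent)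
  ultimately show ?thesis
    using assms by (simp add: integral_def alg_hom_mult[OF rep_hom] rep_gpow delta_basis)
qed

lemma gpow_0: "gpow s t 0 = \<one>\<^bsub>E s t\<^esub>"
  by (simp add: gpow_def del: pow_nat)

lemma gpow_g: "gpow s t i \<otimes>\<^bsub>E s t\<^esub> g s t = gpow s t (i + 1)"
proof (cases "0 \<le> i")
  case True
  then have "nat (i + 1) = Suc (nat i)" by simp
  with True show ?thesis by (simp add: gpow_def del: pow_nat)
next
  case False
  then have "nat (- i) = Suc (nat (- (i + 1)))" by simp
  then have "gpow s t i \<otimes>\<^bsub>E s t\<^esub> g s t = gi s t [^]\<^bsub>E s t\<^esub> nat (- (i + 1))"
    using False by (simp add: gpow_def E.m_assoc E_rels del: pow_nat)
  then show ?thesis using False by (auto simp: gpow_def simp del: pow_nat)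
qed

lemma gpow_gi: "gpow s t i \<otimes>\<^bsub>E s t\<^esub> gi s t = gpow s t (i - 1)"
proof -
  have "gpow s t i = gpow s t (i - 1) \<otimes>\<^bsub>E s t\<^esub> g s t" by (simp add: gpow_g)
  then show ?thesis by (simp add: E.m_assoc E_rels)
qed

lemma gpow_g_pow: "gpow s t i \<otimes>\<^bsub>E s t\<^esub> g s t [^]\<^bsub>E s t\<^esub> (k::nat) = gpow s t (i + int k)"
proof (induction k)
  case (Suc k)
  have "gpow s t i \<otimes>\<^bsub>E s t\<^esub> g s t [^]\<^bsub>E s t\<^esub> Suc k = gpow s t (i + int k) \<otimes>\<^bsub>E s t\<^esub> g s t"
    by (simp add: Suc[symmetric] E.m_assoc)
  then show ?case by (simp add: gpow_g add_ac)
qed simp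

lemma h_pow_g: "h s t [^]\<^bsub>E s t\<^esub> (j::nat) \<otimes>\<^bsub>E s t\<^esub> g s t = inverse lam ^ j \<odot>\<^bsub>E s t\<^esub> (g s t \<otimes>\<^bsub>E s t\<^esub> h s t [^]\<^bsub>E s t\<^esub> j)"
  using lam_nonzero by (intro E.skew_pow_left) (simp_all add: E_rels)

lemma h_pow_gi: "h s t [^]\<^bsub>E s t\<^esub> (j::nat) \<otimes>\<^bsub>E s t\<^esub> gi s t = lam ^ j \<odot>\<^bsub>E s t\<^esub> (gi s t \<otimes>\<^bsub>E s t\<^esub> h s t [^]\<^bsub>E s t\<^esub> j)"
  using lam_nonzero by (intro E.skew_pow_left) (simp_all add: gi_h)

lemma h_pow_g_pow:
  "h s t [^]\<^bsub>E s t\<^esub> (j::nat) \<otimes>\<^bsub>E s t\<^esub> g s t [^]\<^bsub>E s t\<^esub> (k::nat)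
    = (inverse lam ^ j) ^ k \<odot>\<^bsub>E s t\<^esub> (g s t [^]\<^bsub>E s t\<^esub> k \<otimes>\<^bsub>E s t\<^esub> h s t [^]\<^bsub>E s t\<^esub> j)"
  by (rule E.skew_pow_right) (simp_all add: h_pow_g)

text \<open>The span of these monomials is closed under right multiplication by generators: \<open>g\<close> and \<open>gi\<close>
  commute with \<open>h\<^sup>j\<close> up to a scalar, and \<open>h\<^sup>n\<close> is replaced by \<open>s g\<^sup>m\<^sup>n - t\<close>.\<close>

lemma E_basis_spanning:
  "spanning (E s t) {gpow s t i \<otimes>\<^bsub>E s t\<^esub> h s t [^]\<^bsub>E s t\<^esub> j |i j. j < n}"
proof -
  let ?E = "E s t" and ?B = "{gpow s t i \<otimes>\<^bsub>E s t\<^esub> h s t [^]\<^bsub>E s t\<^esub> j |i j. j < n}"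
  have B: "?B \<subseteq> carrier ?E" by auto
  have base: "gpow s t i \<otimes>\<^bsub>?E\<^esub> h s t [^]\<^bsub>?E\<^esub> j \<in> lspan ?E ?B" if "j < n" for i j
    using that by (intro lspan.base) blast
  have closed: "x \<otimes>\<^bsub>?E\<^esub> y \<in> lspan ?E ?B"
    if x: "x \<in> lspan ?E ?B" and y: "y \<in> carrier ?E" and b: "\<And>b. b \<in> ?B \<Longrightarrow> b \<otimes>\<^bsub>?E\<^esub> y \<in> lspan ?E ?B" for x y
    using x
  proof (induction rule: lspan.induct)
    case zero then show ?case using y by (simp add: lspan.zero)
  next
    case (base x) then show ?case by (rule b)
  next
    case (add x x')
    then show ?case
      using y lspan_closed[OF E_alg B] by (simp add: E.l_distr lspan.add)
  next
    case (smult x c)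
    then show ?case
      using y lspan_closed[OF E_alg B] by (simp add: lspan.smult)
  qed
  have mult_g: "b \<otimes>\<^bsub>?E\<^esub> g s t \<in> lspan ?E ?B" if bB: "b \<in> ?B" for b
  proof -
    obtain i j where b: "b = gpow s t i \<otimes>\<^bsub>?E\<^esub> h s t [^]\<^bsub>?E\<^esub> j" "j < n" using bB by blast
    have "b \<otimes>\<^bsub>?E\<^esub> g s t = inverse lam ^ j \<odot>\<^bsub>?E\<^esub> (gpow s t (i + 1) \<otimes>\<^bsub>?E\<^esub> h s t [^]\<^bsub>?E\<^esub> j)"
      by (simp add: b(1) E.m_assoc h_pow_g) (simp add: E.m_assoc[symmetric] gpow_g)
    then show ?thesis using base[OF b(2)] by (simp add: lspan.smult)
  qed
  have mult_gi: "b \<otimes>\<^bsub>?E\<^esub> gi s t \<in> lspan ?E ?B" if bB: "b \<in> ?B" for b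
  proof -
    obtain i j where b: "b = gpow s t i \<otimes>\<^bsub>?E\<^esub> h s t [^]\<^bsub>?E\<^esub> j" "j < n" using bB by blast
    have "b \<otimes>\<^bsub>?E\<^esub> gi s t = lam ^ j \<odot>\<^bsub>?E\<^esub> (gpow s t (i - 1) \<otimes>\<^bsub>?E\<^esub> h s t [^]\<^bsub>?E\<^esub> j)"
      by (simp add: b(1) E.m_assoc h_pow_gi) (simp add: E.m_assoc[symmetric] gpow_gi)
    then show ?thesis using base[OF b(2)] by (simp add: lspan.smult)
  qed
  have gpow: "gpow s t i \<in> lspan ?E ?B" for i
    using base[of 0 i] n_gt_1 by simp
  have mult_h: "b \<otimes>\<^bsub>?E\<^esub> h s t \<in> lspan ?E ?B" if bB: "b \<in> ?B" for b
  proof -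
    obtain i j where b: "b = gpow s t i \<otimes>\<^bsub>?E\<^esub> h s t [^]\<^bsub>?E\<^esub> j" "j < n" using bB by blast
    then have bh: "b \<otimes>\<^bsub>?E\<^esub> h s t = gpow s t i \<otimes>\<^bsub>?E\<^esub> h s t [^]\<^bsub>?E\<^esub> Suc j"
      by (simp add: E.m_assoc)
    show ?thesis
    proof (cases "Suc j = n")
      case True
      have "h s t [^]\<^bsub>?E\<^esub> n = h s t [^]\<^bsub>?E\<^esub> n \<oplus>\<^bsub>?E\<^esub> (t \<odot>\<^bsub>?E\<^esub> \<one>\<^bsub>?E\<^esub> \<oplus>\<^bsub>?E\<^esub> (- t) \<odot>\<^bsub>?E\<^esub> \<one>\<^bsub>?E\<^esub>)"
        by (simp add: E.scal_minus_left E.r_neg)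
      also have "\<dots> = (t \<odot>\<^bsub>?E\<^esub> \<one>\<^bsub>?E\<^esub> \<oplus>\<^bsub>?E\<^esub> h s t [^]\<^bsub>?E\<^esub> n) \<oplus>\<^bsub>?E\<^esub> (- t) \<odot>\<^bsub>?E\<^esub> \<one>\<^bsub>?E\<^esub>"
        by (simp add: E.a_ac)
      also have "\<dots> = s \<odot>\<^bsub>?E\<^esub> (g s t [^]\<^bsub>?E\<^esub> (m * n)) \<oplus>\<^bsub>?E\<^esub> (- t) \<odot>\<^bsub>?E\<^esub> \<one>\<^bsub>?E\<^esub>"
        by (simp only: E_rels)
      finally have hn: "h s t [^]\<^bsub>?E\<^esub> n = s \<odot>\<^bsub>?E\<^esub> (g s t [^]\<^bsub>?E\<^esub> (m * n)) \<oplus>\<^bsub>?E\<^esub> (- t) \<odot>\<^bsub>?E\<^esub> \<one>\<^bsub>?E\<^esub>" .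
      have "b \<otimes>\<^bsub>?E\<^esub> h s t = s \<odot>\<^bsub>?E\<^esub> gpow s t (i + int (m * n)) \<oplus>\<^bsub>?E\<^esub> (- t) \<odot>\<^bsub>?E\<^esub> gpow s t i"
        unfolding bh True hn by (simp add: E.r_distr gpow_g_pow del: of_nat_mult)
      then show ?thesis using gpow by (simp add: lspan.add lspan.smult)
    next
      case False
      then show ?thesis using base[of "Suc j" i] b(2) bh by simp
    qed
  qed
  have "c \<in> lspan ?E ?B" if "c \<in> carrier ?E" for c
    using that
  proof (induction rule: E_induct)
    case one show ?case using gpow[of 0] by (simp add: gpow_0)
  next
    case (g x) show ?case by (rule closed[OF g(2) gens_closed mult_g])
  next
    case (gi x) show ?case by (rule closed[OF gi(2) gens_closed mult_gi])
  next
    case (h x) show ?case by (rule closed[OF h(2) gens_closed mult_h])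
  qed (rule lspan.add lspan.smult; assumption)+
  with B show ?thesis by (auto simp: spanning_def)
qed

lemma D_gpow: "D s r t (gpow s t i) = ptensor (E s r) (E r t) (gpow s r i) (gpow r t i)"
  by (simp add: gpow_def D_g_pow D_gi_pow del: pow_nat)

text \<open>By the quantum binomial theorem, \<open>D\<close> sends \<open>g\<^sup>i h\<^sup>j\<close> to a combination of the tensors
  \<open>g\<^sup>i h\<^sup>j\<^sup>-\<^sup>k \<otimes> g\<^sup>i h\<^sup>k g\<^sup>m\<^sup>(\<^sup>j\<^sup>-\<^sup>k\<^sup>)\<close> with \<open>k \<le> j < n\<close>. The integral kills the second leg unless \<open>k = n - 1\<close>, which forces
  \<open>j = k\<close>; the remaining first leg is \<open>g\<^sup>i\<close>, and the integral of \<open>g\<^sup>i h\<^sup>n\<^sup>-\<^sup>1\<close> vanishes unless \<open>i = 0\<close>.\<close>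

lemma integral_invariant:
  assumes c: "c \<in> carrier (E s s)"
  shows "tensor_lift (E s s) (\<lambda>x y. integral s s y \<odot>\<^bsub>E s s\<^esub> x) (D s s s c)
    = integral s s c \<odot>\<^bsub>E s s\<^esub> \<one>\<^bsub>E s s\<^esub>"
proof -
  let ?E = "E s s" and ?g = "g s s" and ?h = "h s s" and ?\<phi> = "integral s s" and ?p = "ptensor (E s s) (E s s)"
  let ?L = "tensor_lift ?E (\<lambda>x y. ?\<phi> y \<odot>\<^bsub>?E\<^esub> x)"
  interpret T: k_algebra "?E \<boxtimes> ?E" by simp
  have b: "bilin ?E ?E ?E (\<lambda>x y. ?\<phi> y \<odot>\<^bsub>?E\<^esub> x)"
    using lin_map_id(1) by (intro bilin_scal_right integral_lin) auto
  have L_lin: "?L \<in> lin_map (?E \<boxtimes> ?E) ?E" by (rule tensor_lift_lin[OF _ _ _ b]) auto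
  have basis: "?L (D s s s (gpow s s i \<otimes>\<^bsub>?E\<^esub> ?h [^]\<^bsub>?E\<^esub> j))
      = ?\<phi> (gpow s s i \<otimes>\<^bsub>?E\<^esub> ?h [^]\<^bsub>?E\<^esub> j) \<odot>\<^bsub>?E\<^esub> \<one>\<^bsub>?E\<^esub>" if j: "j < n" for i j
  proof -
    let ?P = "?p ?h (?g [^]\<^bsub>?E\<^esub> m)" and ?Q = "?p \<one>\<^bsub>?E\<^esub> ?h" and ?G = "?p (gpow s s i) (gpow s s i)"
    let ?q = "lam ^ m"
    let ?t = "\<lambda>k. ?Q [^]\<^bsub>?E \<boxtimes> ?E\<^esub> k \<otimes>\<^bsub>?E \<boxtimes> ?E\<^esub> ?P [^]\<^bsub>?E \<boxtimes> ?E\<^esub> (j - k)"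
    have PQ: "?P \<otimes>\<^bsub>?E \<boxtimes> ?E\<^esub> ?Q = ?q \<odot>\<^bsub>?E \<boxtimes> ?E\<^esub> (?Q \<otimes>\<^bsub>?E \<boxtimes> ?E\<^esub> ?P)"
      by (simp add: ptensor_mult g_pow_h ptensor_smult_right)
    have t: "?t k = ?p (?h [^]\<^bsub>?E\<^esub> (j - k)) (?h [^]\<^bsub>?E\<^esub> k \<otimes>\<^bsub>?E\<^esub> ?g [^]\<^bsub>?E\<^esub> (m * (j - k)))" for k
      by (simp add: ptensor_pow ptensor_mult E.nat_pow_pow)
    have Lt: "?L (?G \<otimes>\<^bsub>?E \<boxtimes> ?E\<^esub> (qbinom ?q j k \<odot>\<^bsub>?E \<boxtimes> ?E\<^esub> ?t k)) =
        (qbinom ?q j k * (inverse lam ^ k) ^ (m * (j - k)) *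
           ?\<phi> (gpow s s (i + int (m * (j - k))) \<otimes>\<^bsub>?E\<^esub> ?h [^]\<^bsub>?E\<^esub> k))
          \<odot>\<^bsub>?E\<^esub> (gpow s s i \<otimes>\<^bsub>?E\<^esub> ?h [^]\<^bsub>?E\<^esub> (j - k))" for k
    proof -
      let ?a = "m * (j - k)"
      have "gpow s s i \<otimes>\<^bsub>?E\<^esub> (?h [^]\<^bsub>?E\<^esub> k \<otimes>\<^bsub>?E\<^esub> ?g [^]\<^bsub>?E\<^esub> ?a)
          = (inverse lam ^ k) ^ ?a \<odot>\<^bsub>?E\<^esub> ((gpow s s i \<otimes>\<^bsub>?E\<^esub> ?g [^]\<^bsub>?E\<^esub> ?a) \<otimes>\<^bsub>?E\<^esub> ?h [^]\<^bsub>?E\<^esub> k)"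
        by (simp only: h_pow_g_pow) (simp add: E.m_assoc)
      then have "?\<phi> (gpow s s i \<otimes>\<^bsub>?E\<^esub> (?h [^]\<^bsub>?E\<^esub> k \<otimes>\<^bsub>?E\<^esub> ?g [^]\<^bsub>?E\<^esub> ?a))
          = (inverse lam ^ k) ^ ?a * ?\<phi> (gpow s s (i + int ?a) \<otimes>\<^bsub>?E\<^esub> ?h [^]\<^bsub>?E\<^esub> k)"
        by (simp only: gpow_g_pow lin_map_smult[OF integral_lin] E.m_closed gpow_closed
            E.nat_pow_closed gens_closed scalars_simps)
      then show ?thesis
        unfolding t
        by (simp add: ptensor_mult lin_map_smult[OF L_lin] tensor_lift_ptensor b mult.assoc)
    qed
    have tc: "?t k \<in> carrier (?E \<boxtimes> ?E)" for k by simp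
    have "D s s s (gpow s s i \<otimes>\<^bsub>?E\<^esub> ?h [^]\<^bsub>?E\<^esub> j)
        = ?G \<otimes>\<^bsub>?E \<boxtimes> ?E\<^esub> (?P \<oplus>\<^bsub>?E \<boxtimes> ?E\<^esub> ?Q) [^]\<^bsub>?E \<boxtimes> ?E\<^esub> j"
      by (simp add: alg_hom_mult[OF D_hom] D_gpow alg_hom_pow[OF _ _ D_hom] D_h)
    also have "(?P \<oplus>\<^bsub>?E \<boxtimes> ?E\<^esub> ?Q) [^]\<^bsub>?E \<boxtimes> ?E\<^esub> j
        = (\<Oplus>\<^bsub>?E \<boxtimes> ?E\<^esub>k\<in>{..j}. qbinom ?q j k \<odot>\<^bsub>?E \<boxtimes> ?E\<^esub> ?t k)"
      by (rule T.skew_binomial[OF _ _ PQ]) auto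
    also have "?G \<otimes>\<^bsub>?E \<boxtimes> ?E\<^esub> \<dots>
        = (\<Oplus>\<^bsub>?E \<boxtimes> ?E\<^esub>k\<in>{..j}. ?G \<otimes>\<^bsub>?E \<boxtimes> ?E\<^esub> (qbinom ?q j k \<odot>\<^bsub>?E \<boxtimes> ?E\<^esub> ?t k))"
      using tc by (intro T.finsum_rdistr) auto
    finally have "?L (D s s s (gpow s s i \<otimes>\<^bsub>?E\<^esub> ?h [^]\<^bsub>?E\<^esub> j))
        = (\<Oplus>\<^bsub>?E\<^esub>k\<in>{..j}. ?L (?G \<otimes>\<^bsub>?E \<boxtimes> ?E\<^esub> (qbinom ?q j k \<odot>\<^bsub>?E \<boxtimes> ?E\<^esub> ?t k)))"
      using tc lin_map_finsum[OF T.k_algebra_axioms E_alg L_lin,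
          of "\<lambda>k. ?G \<otimes>\<^bsub>?E \<boxtimes> ?E\<^esub> (qbinom ?q j k \<odot>\<^bsub>?E \<boxtimes> ?E\<^esub> ?t k)" "{..j}"] by simp
    also have "\<dots> = ?L (?G \<otimes>\<^bsub>?E \<boxtimes> ?E\<^esub> (qbinom ?q j j \<odot>\<^bsub>?E \<boxtimes> ?E\<^esub> ?t j))"
    proof (rule E.finsum_single_index)
      fix k assume "k \<in> {..j}" "k \<noteq> j"
      then have "k < n - 1" "k < n" using j by auto
      then show "?L (?G \<otimes>\<^bsub>?E \<boxtimes> ?E\<^esub> (qbinom ?q j k \<odot>\<^bsub>?E \<boxtimes> ?E\<^esub> ?t k)) = \<zero>\<^bsub>?E\<^esub>"
        unfolding Lt by (simp add: integral_basis del: of_nat_mult)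
    qed (use tc in \<open>auto simp: lin_map_closed[OF L_lin]\<close>)
    also have "\<dots> = ?\<phi> (gpow s s i \<otimes>\<^bsub>?E\<^esub> ?h [^]\<^bsub>?E\<^esub> j) \<odot>\<^bsub>?E\<^esub> gpow s s i"
      unfolding Lt by simp
    also have "\<dots> = ?\<phi> (gpow s s i \<otimes>\<^bsub>?E\<^esub> ?h [^]\<^bsub>?E\<^esub> j) \<odot>\<^bsub>?E\<^esub> \<one>\<^bsub>?E\<^esub>"
      using j by (auto simp: integral_basis gpow_0)
    finally show ?thesis .
  qed
  show ?thesis
  proof (rule lin_map_eq_on_spanning[OF _ _ E_basis_spanning _ _ _ c])
    show "(\<lambda>c. ?L (D s s s c)) \<in> lin_map ?E ?E"
      by (rule lin_map_comp[OF D_lin L_lin])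
    show "(\<lambda>c. ?\<phi> c \<odot>\<^bsub>?E\<^esub> \<one>\<^bsub>?E\<^esub>) \<in> lin_map ?E ?E"
      by (rule lin_mapI) (simp_all add: lin_map_add[OF integral_lin] lin_map_smult[OF integral_lin]
          E.scal_add_left)
  qed (use basis in auto)
qed

lemma integral_top: "integral s t (h s t [^]\<^bsub>E s t\<^esub> (n - 1)) = 1"
  using integral_basis[of "n - 1" s t 0] n_gt_1 by (simp add: gpow_0)

lemma compact_type: "compact_type_aqg (E s s) (D s s s) (eps s) (S s s)"
proof (intro compact_type_aqg.intro compact_type_aqg_axioms.intro)
  show "hopf_algebra (E s s) (D s s s) (eps s) (S s s)"
    by (rule cogroupoid.hopf_algebra[OF cogroupoid])
  show "bij_betw (S s s) (carrier (E s s)) (carrier (E s s))" by (rule S_bij)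
  show "\<exists>\<phi>\<in>lin_map (E s s) scalars. (\<exists>c\<in>carrier (E s s). \<phi> c \<noteq> 0) \<and>
      (\<forall>c\<in>carrier (E s s). tensor_lift (E s s) (\<lambda>x y. \<phi> y \<odot>\<^bsub>E s s\<^esub> x) (D s s s c) = \<phi> c \<odot>\<^bsub>E s s\<^esub> \<one>\<^bsub>E s s\<^esub>)"
  proof (intro bexI[OF _ integral_lin] conjI ballI integral_invariant)
    show "\<exists>c\<in>carrier (E s s). integral s s c \<noteq> 0"
      by (rule bexI[of _ "h s s [^]\<^bsub>E s s\<^esub> (n - 1)"]) (simp_all add: integral_top[simplified])
  qed
qed

lemma nontrivial: "\<one>\<^bsub>E s t\<^esub> \<noteq> \<zero>\<^bsub>E s t\<^esub>"
proof
  assume eq: "\<one>\<^bsub>E s t\<^esub> = \<zero>\<^bsub>E s t\<^esub>"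
  let ?x = "h s t [^]\<^bsub>E s t\<^esub> (n - 1)"
  have "?x = \<one>\<^bsub>E s t\<^esub> \<otimes>\<^bsub>E s t\<^esub> ?x" by (rule E.l_one[symmetric]) simp
  also have "\<dots> = \<zero>\<^bsub>E s t\<^esub>" unfolding eq by simp
  finally have "integral s t ?x = integral s t \<zero>\<^bsub>E s t\<^esub>" by (rule arg_cong)
  then show False
    by (simp add: integral_top[simplified] lin_map_zero[OF E_alg k_algebra_scalars integral_lin])
qed

lemma bi_galois: "bi_galois_object (E s s) (D s s s) (eps s) (S s s) (E t t) (D t t t) (eps t) (S t t)
    (E s t) (D s s t) (D s t t)"
proof (rule cogroupoid.bi_galois[OF cogroupoid _ _ compact_type compact_type nontrivial])
  let ?x = "h s t [^]\<^bsub>E s t\<^esub> (n - 1)"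
  show "(\<lambda>z. integral s t (z \<otimes>\<^bsub>E s t\<^esub> ?x)) \<in> lin_map (E s t) scalars"
    by (rule lin_map_comp[OF E.lin_map_right_mult integral_lin]) simp
  show "integral s t (\<one>\<^bsub>E s t\<^esub> \<otimes>\<^bsub>E s t\<^esub> ?x) = 1"
    by (simp add: integral_top[simplified])
qed

end

section \<open>The bi-Galois object\<close>

text \<open>The relations of \<open>A\<close> and \<open>X\<close> are those of the family up to zero terms and the side on which a term stands, which
  does not change the ideal.\<close>

lemma presented_cong:
  assumes "(\<lambda>(p, q). p - q) ` R = (\<lambda>(p, q). p - q) ` R'"
  shows "presented R = presented R'" "generator R = generator R'"
  using assms by (auto simp: presented_def generator_def rel_ideal_def)

lemma rels_A_family: "(\<lambda>(p, q). p - q) ` rels_A n q = (\<lambda>(p, q). p - q) ` skew_family_rels n m q 0 0"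
  by (simp add: rels_A_def skew_family_rels_def image_Un scale_simps)

lemma rels_X_family: "(\<lambda>(p, q). p - q) ` rels_X n m q \<mu> = (\<lambda>(p, q). p - q) ` skew_family_rels n m q \<mu> 0"
  by (simp add: rels_X_def skew_family_rels_def image_Un scale_simps)

lemma rels_C_family: "rels_C n m q \<mu> = skew_family_rels n m q \<mu> \<mu>"
  by (simp add: rels_C_def skew_family_rels_def)

theorem proposition4p4:
  fixes lam \<mu> :: "'k::field" and n m :: nat
    and A X C :: "('k, ('k, gens) free_alg set) module"
    and a b x y u w :: "('k, gens) free_alg set"
  assumes "n > 1" and "m \<ge> 1" and "coprime n m"
    and "primitive_root_of_unity n lam"
    and A: "A = presented (rels_A n lam)"
      and a: "a = generator (rels_A n lam) G" and b: "b = generator (rels_A n lam) H"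
    and X: "X = presented (rels_X n m lam \<mu>)"
      and x: "x = generator (rels_X n m lam \<mu>) G" and y: "y = generator (rels_X n m lam \<mu>) H"
    and C: "C = presented (rels_C n m lam \<mu>)"
      and u: "u = generator (rels_C n m lam \<mu>) G" and w: "w = generator (rels_C n m lam \<mu>) H"
  shows "\<one>\<^bsub>C\<^esub> \<noteq> \<zero>\<^bsub>C\<^esub> \<and>
    (\<exists>\<Delta>A \<epsilon>A SA \<alpha> \<Delta>C \<epsilon>C SC \<gamma>.
       determined_hom A (A \<boxtimes> A)
         {(a, ptensor A A a a),
          (b, ptensor A A b (a [^]\<^bsub>A\<^esub> m) \<oplus>\<^bsub>A \<boxtimes> A\<^esub> ptensor A A \<one>\<^bsub>A\<^esub> b)} \<Delta>A \<and>
       determined_hom X (X \<boxtimes> A)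
         {(x, ptensor X A x a),
          (y, ptensor X A y (a [^]\<^bsub>A\<^esub> m) \<oplus>\<^bsub>X \<boxtimes> A\<^esub> ptensor X A \<one>\<^bsub>X\<^esub> b)} \<alpha> \<and>
       determined_hom C (C \<boxtimes> C)
         {(u, ptensor C C u u),
          (w, ptensor C C w (u [^]\<^bsub>C\<^esub> m) \<oplus>\<^bsub>C \<boxtimes> C\<^esub> ptensor C C \<one>\<^bsub>C\<^esub> w)} \<Delta>C \<and>
       compact_type_aqg C \<Delta>C \<epsilon>C SC \<and>
       determined_hom X (C \<boxtimes> X)
         {(x, ptensor C X u x),
          (y, ptensor C X \<one>\<^bsub>C\<^esub> y \<oplus>\<^bsub>C \<boxtimes> X\<^esub> ptensor C X w (x [^]\<^bsub>X\<^esub> m))} \<gamma> \<and>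
       bi_galois_object C \<Delta>C \<epsilon>C SC A \<Delta>A \<epsilon>A SA X \<gamma> \<alpha>)"
proof -
  interpret F: skew_family n m lam
    by standard (fact assms)+
  have A': "A = F.E 0 0" "a = F.g 0 0" "b = F.h 0 0"
    unfolding A a b F.E_def presented_cong[OF rels_A_family[of n lam m]] by simp_all
  have X': "X = F.E \<mu> 0" "x = F.g \<mu> 0" "y = F.h \<mu> 0"
    unfolding X x y F.E_def presented_cong[OF rels_X_family[of n m lam \<mu>]] by simp_all
  have C': "C = F.E \<mu> \<mu>" "u = F.g \<mu> \<mu>" "w = F.h \<mu> \<mu>"
    unfolding C u w F.E_def rels_C_family by simp_all
  have det: "determined_hom (F.E s t) (F.E s r \<boxtimes> F.E r t)
     {(F.g s t, ptensor (F.E s r) (F.E r t) (F.g s r) (F.g r t)), (F.h s t, F.comult_h s r t)} (F.D s r t)"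
    for s r t
    by (rule F.E_determined_hom) (simp_all add: F.D_hom F.D_g F.D_h)
  \<comment> \<open>The left coaction is stated with its two summands in the other order.\<close>
  interpret CX: k_algebra "F.E \<mu> \<mu> \<boxtimes> F.E \<mu> 0" by simp
  have comm: "ptensor (F.E \<mu> \<mu>) (F.E \<mu> 0) \<one>\<^bsub>F.E \<mu> \<mu>\<^esub> (F.h \<mu> 0) \<oplus>\<^bsub>F.E \<mu> \<mu> \<boxtimes> F.E \<mu> 0\<^esub>
      ptensor (F.E \<mu> \<mu>) (F.E \<mu> 0) (F.h \<mu> \<mu>) (F.g \<mu> 0 [^]\<^bsub>F.E \<mu> 0\<^esub> m) = F.comult_h \<mu> \<mu> 0"
    by (rule CX.a_comm) auto
  show ?thesis
    unfolding A' X' C' comm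
    using F.nontrivial[of \<mu> \<mu>] F.compact_type[of \<mu>] F.bi_galois[of \<mu> 0] det by blast
qed

end
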